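(* Let $\mathcal{L}\in \mathrm{Mat}_d(\mathbb{Z})$ have no non-trivial invariant subspace over $\mathbb{Q}$ and let $k=|\det \mathcal{L}|$. Then there are constants $D_2,\sigma_2>0$ depending only on $d$ and $k$ such that $$|A+\mathcal{L} A| \geq (1+k^{1/d})^d|A|-D_2|A|^{1-\sigma_2}$$ for all finite $A\subset \mathbb{Z}^d$.
   Context: A non-trivial invariant subspace of $\mathcal{L}$ over $\mathbb{Q}$ is a subspace $W\subseteq\mathbb{Q}^d$ with $W\ne\{0\},\mathbb{Q}^d$ and $\mathcal{L}W\subseteq W$. *)

theory Defs
  imports "HOL-Analysis.Analysis"
begin

definition rat_mat :: "int^'n^'m \<Rightarrow> rat^'n^'m" where
  "rat_mat L = (\<chi> i j. of_int (L $ i $ j))"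

definition nontrivial_invariant_subspace :: "int^'n^'n \<Rightarrow> (rat^'n) set \<Rightarrow> bool" where
  "nontrivial_invariant_subspace L W \<longleftrightarrow>
     module.subspace (\<lambda>c (v::rat^'n). c *s v) W \<and> W \<noteq> {0} \<and> W \<noteq> UNIV \<and>
     (\<forall>w\<in>W. rat_mat L *v w \<in> W)"

definition sum_dilate :: "(int^'n) set \<Rightarrow> int^'n^'n \<Rightarrow> (int^'n) set" where
  "sum_dilate A L = {a + L *v b | a b. a \<in> A \<and> b \<in> A}"

end

theory Submission
  imports Defs
begin

text \<open>
  Take a counterexample \<open>A\<close> of minimal size \<open>N\<close>, let \<open>\<Lambda>\<close> be the \<open>L\<close>-invariant lattice generated by
  \<open>A - A\<close>, so that \<open>[\<Lambda> : L \<Lambda>] = k\<close>, and split \<open>A\<close> into classes modulo \<open>L\<^sup>j \<Lambda>\<close>.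

  If some class is missing or very small, then splitting \<open>A\<close> into the other classes and using minimality
  on each of them leaves a large surplus of sums, a contradiction; so for many levels \<open>j\<close> every
  class is populated. If \<open>Y\<close> is the largest class of level \<open>j - 1\<close>, the sets \<open>c + L Y\<close> for
  the classes \<open>c\<close> of level \<open>j\<close> are disjoint, and after rescaling \<open>c\<close> and \<open>L Y\<close> live in the same lattice, so a
  discrete Brunn--Minkowski inequality bounds \<open>|c + L Y|\<close> below by
  \<open>(|c|\<^bsup>1/d\<^esup> + |Y|\<^bsup>1/d\<^esup>)\<^sup>d\<close>. If all classes had the same size this would sum to
  \<open>(1 + k\<^bsup>1/d\<^esup>)\<^sup>d N\<close>. As \<open>A\<close> is a counterexample, the ratio of the largest to the average class must
  therefore grow with \<open>j\<close>: its excess \<open>\<alpha>\<close> over \<open>1\<close> becomes about \<open>sqrt \<alpha>\<close> while it is small and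
  increases geometrically afterwards. But it is bounded, because the sets \<open>c + L Y\<close> with \<open>c\<close> of level
  \<open>j\<close> have at least \<open>|Y|\<close> elements each.

  The error term in the Brunn--Minkowski inequality is the number of lines, in each of \<open>d\<close> independent
  directions, needed to cover \<open>A + L A\<close>. Small doubling makes it a power saving: following dyadic multiples
  through a cover of \<open>A - A + A - A\<close> by boundedly many translates of \<open>A - A\<close>, a pigeonhole argument yields
  \<open>t \<noteq> 0\<close> such that \<open>A + L A\<close> grows only by a power of \<open>log N\<close> when the progression
  \<open>{0, t, \<dots>, N\<^bsup>\<epsilon>\<^esup> t}\<close> is added; the directions are \<open>t, L t, \<dots>, L\<^bsup>d-1\<^esup> t\<close>, which
  are independent since \<open>L\<close> has no invariant subspace.
\<close>

section \<open>A discrete Brunn--Minkowski inequality\<close>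

text \<open>The constants may depend only on \<open>d\<close> and \<open>k\<close>, while the
  entries of \<open>L\<close> are unbounded for a fixed determinant. Hence no step uses a norm of
  \<open>L\<close>; only the doubling constant \<open>C\<close>, the index \<open>k\<close> and
  cosets of lattices enter. Let \<delta> = D N^(-\<sigma>) be the relative deficit of the
  counterexample. The Brunn-Minkowski error is paid once for each of up to k^j classes of level j,
  so only about log(1/\<delta>) levels can be afforded. This suffices: a fixed number i of
  square-root steps lifts the excess to about \<delta>^(1/2^i), and if i is a large enough constant,
  the geometric growth over the remaining levels overtakes this small start. The number J of levels
  is tied to \<delta> through powers of Q = 2 k C, where k accounts for the number of classes and 2
  C for the loss in guaranteed class size per level. Minimality serves only to show that the levels
  are populated; the growth of the largest class uses just the failure of the bound for
  \<open>A\<close> itself. For k = 0 irreducibility forces d = 1 and L = 0, which is treated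
  separately.\<close>

lemma card_sumset_line:
  fixes U V :: "'a::linordered_ab_group_add set"
  assumes "finite U" "U \<noteq> {}" "finite V" "V \<noteq> {}"
  shows "card U + card V \<le> card (U + V) + 1"
proof -
  \<comment> \<open>A chain that first runs through \<open>U\<close> with \<open>Min V\<close>
    fixed, then through \<open>V\<close> with \<open>Max U\<close> fixed: its two pieces share only
    \<open>Max U + Min V\<close>.\<close>
  let ?X = "(\<lambda>u. u + Min V) ` U" and ?Y = "(\<lambda>v. Max U + v) ` V"
  have "u + Min V = Max U + v \<Longrightarrow> u \<in> U \<Longrightarrow> v \<in> V \<Longrightarrow> v = Min V" for u v
    using assms by (metis Max_ge Min_le add_le_cancel_left add_mono_thms_linordered_semiring(3) 
      add_right_mono antisym order.trans)
  then have "?X \<inter> ?Y \<subseteq> {Max U + Min V}"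
    by auto
  then have "card (?X \<inter> ?Y) \<le> 1"
    by (metis card.empty card_insert_disjoint card_mono finite.emptyI finite.insertI insert_absorb
        insert_not_empty One_nat_def)
  moreover have "card ?X = card U" "card ?Y = card V"
    by (auto intro!: card_image simp: inj_on_def)
  moreover have "card (?X \<union> ?Y) + card (?X \<inter> ?Y) = card ?X + card ?Y"
    using assms by (intro card_Un_Int[symmetric]) auto
  moreover have "card (?X \<union> ?Y) \<le> card (U + V)"
  proof (intro card_mono finite_set_plus)
    have "Min V \<in> V" "Max U \<in> U" using assms by simp_all
    then show "?X \<union> ?Y \<subseteq> U + V" by auto
  qed (use assms in auto)
  ultimately show ?thesis by linarith
qed

text \<open>Convexity of \<open>t ^ Suc m\<close> at the points \<open>\<xi> / \<theta>\<close> and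
  \<open>\<eta> / (1 - \<theta>)\<close> with weights \<open>\<theta>\<close> and
  \<open>1 - \<theta>\<close>.\<close>

lemma power_convex_two_point:
  fixes \<xi> \<eta> \<theta> :: real
  assumes "0 \<le> \<xi>" "0 \<le> \<eta>" "0 < \<theta>" "\<theta> < 1"
  shows "(\<xi> + \<eta>) ^ Suc m \<le> \<xi> ^ Suc m / \<theta> ^ m + \<eta> ^ Suc m / (1 - \<theta>) ^ m"
proof -
  have cvx: "convex_on {0::real..} (\<lambda>x. x ^ n)" for n
    by (cases "even n") (auto intro: convex_power_odd convex_on_subset[OF convex_power_even])
  have "((1 - \<theta>) *\<^sub>R (\<eta> / (1 - \<theta>)) + \<theta> *\<^sub>R (\<xi> / \<theta>)) ^ Suc m
      \<le> (1 - \<theta>) * (\<eta> / (1 - \<theta>)) ^ Suc m + \<theta> * (\<xi> / \<theta>) ^ Suc m"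
    using assms by (intro convex_onD[OF cvx]) auto
  moreover have "(1 - \<theta>) *\<^sub>R (\<eta> / (1 - \<theta>)) + \<theta> *\<^sub>R (\<xi> / \<theta>) = \<xi> + \<eta>"
    using assms by simp
  moreover have "(1 - \<theta>) * (\<eta> / (1 - \<theta>)) ^ Suc m = \<eta> ^ Suc m / (1 - \<theta>) ^ m"
    using assms by (simp add: power_divide)
  moreover have "\<theta> * (\<xi> / \<theta>) ^ Suc m = \<xi> ^ Suc m / \<theta> ^ m"
    using assms by (simp add: power_divide)
  ultimately show ?thesis by simp
qed

lemma powr_inverse_power:
  fixes x :: real
  assumes "0 \<le> x" "0 < n"
  shows "(x powr (1 / real n)) ^ n = x"
proof (cases "x = 0")
  case False
  then have "(x powr (1 / real n)) ^ n = (x powr (1 / real n)) powr real n"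
    using assms by (simp add: powr_realpow)
  then show ?thesis using assms False by (simp add: powr_powr)
qed (use assms in \<open>simp add: zero_power\<close>)

text \<open>The passage from dimension \<open>m\<close> to \<open>Suc m\<close>: \<open>x\<close>,
  \<open>y\<close> are the sizes of two sets and \<open>p\<close>, \<open>q\<close> those of two
  matched slices. It is \<open>power_convex_two_point\<close> with \<theta> the share of
  \<open>p powr (1 / m)\<close> in the sum of the two roots.\<close>

lemma brunn_minkowski_holder:
  fixes x y p q :: real
  assumes "0 < x" "0 < y" "0 < p" "0 < q" "0 < m"
  shows "(x powr (1 / real (Suc m)) + y powr (1 / real (Suc m))) ^ Suc m
    \<le> (x / p + y / q) * (p powr (1 / real m) + q powr (1 / real m)) ^ m"
proof -
  define a b where "a = p powr (1 / real m)" and "b = q powr (1 / real m)"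
  have ab: "a > 0" "b > 0" "a ^ m = p" "b ^ m = q"
    using assms by (auto simp: a_def b_def powr_inverse_power simp del: power_Suc)
  define \<theta> where "\<theta> = a / (a + b)"
  have l: "0 < \<theta>" "\<theta> < 1" "1 - \<theta> = b / (a + b)"
    using ab by (auto simp: \<theta>_def field_simps)
  have "(x powr (1 / real (Suc m)) + y powr (1 / real (Suc m))) ^ Suc m
     \<le> (x powr (1 / real (Suc m))) ^ Suc m / \<theta> ^ m + (y powr (1 / real (Suc m))) ^ Suc m / (1 - \<theta>) ^ m"
    using l by (intro power_convex_two_point) auto
  also have "\<dots> = x / \<theta> ^ m + y / (1 - \<theta>) ^ m"
    using assms by (simp add: powr_inverse_power del: power_Suc of_nat_Suc)
  also have "\<dots> = (x / p + y / q) * (a + b) ^ m"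
    using ab l(3) by (simp add: \<theta>_def power_divide field_simps)
  finally show ?thesis by (simp add: a_def b_def)
qed

text \<open>Reads off the level \<open>I l\<close> of the \<open>l\<close>-th cell when the cells of a histogram with level sizes
  \<open>p\<close>, each repeated \<open>y\<close> times, are listed by increasing level.\<close>

lemma quantile_level_exists:
  fixes p :: "nat \<Rightarrow> nat"
  assumes "\<And>l. l \<in> {1..a} \<Longrightarrow> p l > 0" "y > 0"
  shows "\<exists>I. \<forall>l\<in>{1..(\<Sum>l=1..a. p l) * y}. I l \<in> {1..a} \<and>
    (\<Sum>l'=1..l. 1 / (real y * real (p (I l')))) \<le> real (I l)"
  using assms(1)
proof (induction a)
  case 0
  then show ?case by auto
next
  case (Suc a)
  define x where "x = (\<Sum>l=1..a. p l) * y"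
  obtain I where I: "\<And>l. l \<in> {1..x} \<Longrightarrow> I l \<in> {1..a} \<and>
    (\<Sum>l'=1..l. 1 / (real y * real (p (I l')))) \<le> real (I l)"
    using Suc x_def by (metis (no_types, lifting) atLeastAtMost_iff le_SucI)
  define I' where "I' l = (if l \<le> x then I l else Suc a)" for l
  have tot: "(\<Sum>l=1..Suc a. p l) * y = x + p (Suc a) * y"
    by (simp add: x_def algebra_simps)
  have low: "(\<Sum>l'=1..l. 1 / (real y * real (p (I' l')))) = (\<Sum>l'=1..l. 1 / (real y * real (p (I l'))))"
    if "l \<le> x" for l
    using that by (intro sum.cong) (auto simp: I'_def)
  have lowx: "(\<Sum>l'=1..x. 1 / (real y * real (p (I' l')))) \<le> real a"
  proof (cases "x = 0")
    case False
    then show ?thesis using I[of x] low[of x] by auto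
  qed simp
  have "I' l \<in> {1..Suc a} \<and> (\<Sum>l'=1..l. 1 / (real y * real (p (I' l')))) \<le> real (I' l)"
    if l: "l \<in> {1..(\<Sum>l=1..Suc a. p l) * y}" for l
  proof (cases "l \<le> x")
    case True
    then show ?thesis using I[of l] low[of l] l by (auto simp: I'_def)
  next
    case False
    have pp: "p (Suc a) > 0" using Suc.prems by auto
    have "{1..l} = {1..x} \<union> {Suc x..l}" using False by auto
    then have "(\<Sum>l'=1..l. 1 / (real y * real (p (I' l')))) =
      (\<Sum>l'=1..x. 1 / (real y * real (p (I' l')))) + (\<Sum>l'=Suc x..l. 1 / (real y * real (p (I' l'))))"
      by (simp add: sum.union_disjoint)
    also have "(\<Sum>l'=Suc x..l. 1 / (real y * real (p (I' l')))) = real (l - x) / (real y * real (p (Suc a)))"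
      by (simp add: I'_def)
    \<comment> \<open>Level \<open>Suc a\<close> has \<open>p (Suc a) * y\<close> cells of weight
      \<open>1 / (y * p (Suc a))\<close>, so all of them together weigh 1.\<close>
    also have "\<dots> \<le> 1"
    proof -
      have "l - x \<le> p (Suc a) * y" using l tot by auto
      then have "real (l - x) \<le> real y * real (p (Suc a))" by (metis of_nat_le_iff of_nat_mult mult.commute)
      then show ?thesis using pp assms(2) by (simp add: divide_le_eq)
    qed
    finally show ?thesis using lowx False by (auto simp: I'_def)
  qed
  then show ?case by blast
qed

text \<open>Double counting in place of an integral over heights. Among the indices whose set
  contains \<open>v\<close> only the last one, \<open>l0\<close>, matters: all weights up to
  \<open>l0\<close> add up to at most \<open>I l0 + I' l0\<close>, which \<open>H v\<close>
  dominates.\<close>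

lemma weighted_level_count:
  fixes I I' :: "nat \<Rightarrow> nat" and w w' :: "nat \<Rightarrow> real" and Z :: "nat \<Rightarrow> 'v set"
  assumes "\<And>l. l \<in> {1..n} \<Longrightarrow> (\<Sum>l'=1..l. w l') \<le> real (I l)"
    and "\<And>l. l \<in> {1..n} \<Longrightarrow> (\<Sum>l'=1..l. w' l') \<le> real (I' l)"
    and pos: "\<And>l. l \<in> {1..n} \<Longrightarrow> w l \<ge> 0 \<and> w' l \<ge> 0"
    and V: "finite V" "\<And>l. l \<in> {1..n} \<Longrightarrow> Z l \<subseteq> V"
    and H: "\<And>l v. l \<in> {1..n} \<Longrightarrow> v \<in> Z l \<Longrightarrow> real (I l + I' l) \<le> H v"
    and H0: "\<And>v. v \<in> V \<Longrightarrow> 0 \<le> H v"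
  shows "(\<Sum>l=1..n. (w l + w' l) * real (card (Z l))) \<le> (\<Sum>v\<in>V. H v)"
proof -
  have "(\<Sum>l=1..n. (w l + w' l) * real (card (Z l))) = (\<Sum>l=1..n. \<Sum>v\<in>V. if v \<in> Z l then w l + w' l else 0)"
  proof (intro sum.cong refl)
    fix l assume "l \<in> {1..n}"
    then have "V \<inter> Z l = Z l" using V by auto
    then show "(w l + w' l) * real (card (Z l)) = (\<Sum>v\<in>V. if v \<in> Z l then w l + w' l else 0)"
      using V(1) by (simp add: sum.If_cases Int_def)
  qed
  also have "\<dots> = (\<Sum>v\<in>V. \<Sum>l=1..n. if v \<in> Z l then w l + w' l else 0)"
    by (rule sum.swap)
  also have "\<dots> \<le> (\<Sum>v\<in>V. H v)"
  proof (rule sum_mono)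
    fix v assume v: "v \<in> V"
    let ?S = "{l\<in>{1..n}. v \<in> Z l}"
    have eq: "(\<Sum>l=1..n. if v \<in> Z l then w l + w' l else 0) = (\<Sum>l\<in>?S. w l + w' l)"
      by (rule sum.inter_filter[symmetric]) simp
    show "(\<Sum>l=1..n. if v \<in> Z l then w l + w' l else 0) \<le> H v"
    proof (cases "?S = {}")
      case True
      then show ?thesis using eq H0[OF v] by (metis (no_types, lifting) sum.empty)
    next
      case False
      define l0 where "l0 = Max ?S"
      have l0: "l0 \<in> ?S" unfolding l0_def using False by (intro Max_in) auto
      have "(\<Sum>l\<in>?S. w l + w' l) \<le> (\<Sum>l=1..l0. w l + w' l)"
      proof (rule sum_mono2)
        show "?S \<subseteq> {1..l0}" by (auto simp: l0_def intro: Max_ge)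
        fix b assume "b \<in> {1..l0} - ?S"
        then show "0 \<le> w b + w' b" using pos[of b] l0 by auto
      qed auto
      also have "\<dots> \<le> real (I l0 + I' l0)"
        using assms(1)[of l0] assms(2)[of l0] l0 by (simp add: sum.distrib)
      also have "\<dots> \<le> H v" using H[of l0 v] l0 by auto
      finally show ?thesis using eq by simp
    qed
  qed
  finally show ?thesis .
qed

text \<open>Projection along an axis, kept inside the same type so that an induction over
  coordinates need not change the dimension. The image of a set has one point for each line in
  direction \<open>i\<close> that meets the set.\<close>

definition drop_coord :: "'n \<Rightarrow> 'a::zero^'n \<Rightarrow> 'a^'n" where
  "drop_coord i v = (\<chi> j. if j = i then 0 else v $ j)"

lemma drop_coord_nth [simp]: "drop_coord i v $ j = (if j = i then 0 else v $ j)"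
  by (simp add: drop_coord_def)

lemma drop_coord_add: "drop_coord i (u + v) = drop_coord i u + drop_coord i (v :: rat^'n)"
  by (simp add: vec_eq_iff)

lemma drop_coord_commute: "drop_coord i (drop_coord j v) = drop_coord j (drop_coord i v)"
  by (simp add: vec_eq_iff)

lemma drop_coord_eq_imp_eq:
  assumes "drop_coord i u = drop_coord i v" "u $ i = v $ i"
  shows "u = v"
  unfolding vec_eq_iff
proof
  fix j
  show "u $ j = v $ j"
    using assms(2) arg_cong[OF assms(1), of "\<lambda>w. w $ j"] by (cases "j = i") simp_all
qed

lemma card_eq_sum_fibres:
  assumes "finite X"
  shows "card X = (\<Sum>y\<in>f ` X. card {x\<in>X. f x = y})"
  unfolding card_eq_sum by (rule sum.image_gen[OF assms])

text \<open>Fibres lie on a line, so \<open>card_sumset_line\<close> applies to their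
  \<open>i\<close>-th coordinates. The 1 lost per fibre is the origin of the error term
  below.\<close>

lemma card_fibre_sumset:
  fixes X Y :: "(rat^'n) set"
  assumes "finite X" "finite Y" "u \<in> drop_coord i ` X" "v \<in> drop_coord i ` Y"
  shows "card {x\<in>X. drop_coord i x = u} + card {y\<in>Y. drop_coord i y = v}
    \<le> card {z\<in>X+Y. drop_coord i z = u + v} + 1"
proof -
  define fX where "fX = {x\<in>X. drop_coord i x = u}"
  define fY where "fY = {y\<in>Y. drop_coord i y = v}"
  have inj: "inj_on (\<lambda>x. x $ i) {x. drop_coord i x = w}" for w :: "rat^'n"
    by (rule inj_onI, rule drop_coord_eq_imp_eq[of i]) simp_all
  obtain x0 y0 where "x0 \<in> X" "u = drop_coord i x0" "y0 \<in> Y" "v = drop_coord i y0"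
    using assms(3,4) by blast
  then have "x0 \<in> fX" "y0 \<in> fY" by (simp_all add: fX_def fY_def)
  then have ne: "fX \<noteq> {}" "fY \<noteq> {}" by blast+
  have finf: "finite fX" "finite fY" using assms(1,2) by (simp_all add: fX_def fY_def)
  have "card ((\<lambda>x. x $ i) ` fX) = card fX"
    by (rule card_image[OF inj_on_subset[OF inj[of u]]]) (auto simp: fX_def)
  moreover have "card ((\<lambda>x. x $ i) ` fY) = card fY"
    by (rule card_image[OF inj_on_subset[OF inj[of v]]]) (auto simp: fY_def)
  ultimately have "card fX + card fY = card ((\<lambda>x. x $ i) ` fX) + card ((\<lambda>x. x $ i) ` fY)"
    by (simp only:)
  also have "\<dots> \<le> card ((\<lambda>x. x $ i) ` fX + (\<lambda>x. x $ i) ` fY) + 1"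
    using ne finf by (intro card_sumset_line) simp_all
  also have "(\<lambda>x. x $ i) ` fX + (\<lambda>x. x $ i) ` fY \<subseteq> (\<lambda>x. x $ i) ` {z\<in>X+Y. drop_coord i z = u + v}"
    by (force simp: set_plus_def fX_def fY_def drop_coord_add)
  then have "card ((\<lambda>x. x $ i) ` fX + (\<lambda>x. x $ i) ` fY) \<le> card {z\<in>X+Y. drop_coord i z = u + v}"
    by (intro surj_card_le) (simp_all add: assms finite_set_plus)
  finally show ?thesis by (simp add: fX_def fY_def)
qed

lemma sum_card_levels:
  fixes f :: "'a \<Rightarrow> nat"
  assumes "finite U" "\<And>u. u \<in> U \<Longrightarrow> f u \<le> a"
  shows "(\<Sum>l=1..a. card {u\<in>U. l \<le> f u}) = (\<Sum>u\<in>U. f u)"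
proof -
  have "(\<Sum>l=1..a. card {u\<in>U. l \<le> f u}) = (\<Sum>l=1..a. \<Sum>u\<in>U. if l \<le> f u then 1 else 0)"
    using assms(1) by (simp add: sum.If_cases Int_def)
  also have "\<dots> = (\<Sum>u\<in>U. \<Sum>l=1..a. if l \<le> f u then 1 else 0)" by (rule sum.swap)
  also have "\<dots> = (\<Sum>u\<in>U. f u)"
  proof (intro sum.cong refl)
    fix u assume "u \<in> U"
    then have "{1..a} \<inter> {l. l \<le> f u} = {1..f u}" using assms(2) by fastforce
    then show "(\<Sum>l=1..a. if l \<le> f u then 1 else 0) = f u" by (simp add: sum.If_cases)
  qed
  finally show ?thesis .
qed

text \<open>Induction over the set \<open>S\<close> of coordinates that vary. For a new coordinate
  the sets are cut into superlevel sets of their fibre lengths, which are matched by quantile. The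
  induction hypothesis bounds the sum of each matched pair, and over such a sum the fibres of
  \<open>X + Y\<close> have at least the added heights minus 1. Each induction step at most doubles
  the inherited error, hence \<open>2 ^ card S\<close>.\<close>

theorem discrete_brunn_minkowski:
  fixes X Y :: "(rat^'n::finite) set"
  assumes "S \<noteq> {}" "finite X" "X \<noteq> {}" "finite Y" "Y \<noteq> {}"
    and "\<And>x x' j. x \<in> X \<Longrightarrow> x' \<in> X \<Longrightarrow> j \<notin> S \<Longrightarrow> x $ j = x' $ j"
    and "\<And>x x' j. x \<in> Y \<Longrightarrow> x' \<in> Y \<Longrightarrow> j \<notin> S \<Longrightarrow> x $ j = x' $ j"
  shows "(real (card X) powr (1 / real (card S)) + real (card Y) powr (1 / real (card S))) ^ card S
    \<le> real (card (X + Y)) + 2 ^ card S * (\<Sum>i\<in>S. real (card (drop_coord i ` (X + Y))))"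
proof -
  have "finite S" by simp
  then show ?thesis using assms
  proof (induction S arbitrary: X Y rule: finite_ne_induct)
    case (singleton i)
    obtain x0 y0 where xy0: "x0 \<in> X" "y0 \<in> Y" using singleton.prems by blast
    define u v where "u = drop_coord i x0" and "v = drop_coord i y0"
    have "drop_coord i x = u" if "x \<in> X" for x
      using singleton.prems(5)[OF that xy0(1)] by (simp add: u_def vec_eq_iff)
    moreover have "drop_coord i y = v" if "y \<in> Y" for y
      using singleton.prems(6)[OF that xy0(2)] by (simp add: v_def vec_eq_iff)
    ultimately have uv: "drop_coord i ` X = {u}" "drop_coord i ` Y = {v}" using xy0 by auto
    then have e: "{x\<in>X. drop_coord i x = u} = X" "{y\<in>Y. drop_coord i y = v} = Y" by blast+
    have "card {z\<in>X+Y. drop_coord i z = u + v} \<le> card (X + Y)"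
      using singleton.prems by (intro card_mono) (auto intro: finite_set_plus)
    then have "card X + card Y \<le> card (X + Y) + 1"
      using card_fibre_sumset[of X Y u i v] singleton.prems uv e by auto
    moreover have "card (drop_coord i ` (X + Y)) \<ge> 1"
    proof -
      have "drop_coord i (x0 + y0) \<in> drop_coord i ` (X + Y)" using xy0 by blast
      moreover have "finite (drop_coord i ` (X + Y))" using singleton.prems by (simp add: finite_set_plus)
      ultimately show ?thesis by (metis One_nat_def Suc_leI card_gt_0_iff empty_iff)
    qed
    ultimately show ?case by simp
  next
    case (insert i S)
    define m where "m = card S"
    have m: "m > 0" "card (insert i S) = Suc m" using insert.hyps by (auto simp: m_def card_gt_0_iff)
    define \<pi> where "\<pi> = (drop_coord i :: rat^'n \<Rightarrow> _)"
    have fin: "finite X" "finite Y" "finite (X + Y)" using insert.prems by (auto intro: finite_set_plus)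
    define f where "f u = card {x\<in>X. \<pi> x = u}" for u
    define g where "g u = card {x\<in>Y. \<pi> x = u}" for u
    define h where "h u = card {z\<in>X+Y. \<pi> z = u}" for u
    define a where "a = Max (f ` \<pi> ` X)"
    define b where "b = Max (g ` \<pi> ` Y)"
    define P where "P l = {u\<in>\<pi> ` X. l \<le> f u}" for l
    define Q where "Q l = {u\<in>\<pi> ` Y. l \<le> g u}" for l
    define x where "x = card X"
    define y where "y = card Y"
    have xy: "x > 0" "y > 0" using insert.prems by (auto simp: x_def y_def card_gt_0_iff)
    have fa: "f u \<le> a" if "u \<in> \<pi> ` X" for u using that fin by (auto simp: a_def)
    have gb: "g u \<le> b" if "u \<in> \<pi> ` Y" for u using that fin by (auto simp: b_def)
    have "a \<in> f ` \<pi> ` X" unfolding a_def using fin insert.prems by (intro Max_in) auto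
    then have Pne: "P l \<noteq> {}" if "l \<le> a" for l using that by (auto simp: P_def)
    have "b \<in> g ` \<pi> ` Y" unfolding b_def using fin insert.prems by (intro Max_in) auto
    then have Qne: "Q l \<noteq> {}" if "l \<le> b" for l using that by (auto simp: Q_def)
    have Pfin: "finite (P l)" "finite (Q l)" for l using fin by (auto simp: P_def Q_def)
    have sumP: "(\<Sum>l=1..a. card (P l)) = x"
      unfolding P_def x_def using fin fa
      by (subst sum_card_levels) (auto simp: f_def card_eq_sum_fibres[of X \<pi>])
    have sumQ: "(\<Sum>l=1..b. card (Q l)) = y"
      unfolding Q_def y_def using fin gb
      by (subst sum_card_levels) (auto simp: g_def card_eq_sum_fibres[of Y \<pi>])
    have "card (P l) > 0" if "l \<in> {1..a}" for l using that Pne[of l] Pfin by (simp add: card_gt_0_iff)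
    \<comment> \<open>Cells of \<open>X\<close> are repeated \<open>y\<close> times and cells of
      \<open>Y\<close> are repeated \<open>x\<close> times, so both quantile lists have length
      \<open>x * y\<close> and can be matched index by index.\<close>
    from quantile_level_exists[of a "\<lambda>l. card (P l)" y, OF this xy(2), unfolded sumP]
    obtain I where I: "\<And>l. l \<in> {1..x*y} \<Longrightarrow> I l \<in> {1..a} \<and>
        (\<Sum>l'=1..l. 1 / (real y * real (card (P (I l'))))) \<le> real (I l)" by metis
    have "card (Q l) > 0" if "l \<in> {1..b}" for l using that Qne[of l] Pfin by (simp add: card_gt_0_iff)
    from quantile_level_exists[of b "\<lambda>l. card (Q l)" x, OF this xy(1), unfolded sumQ]
    obtain I' where I': "\<And>l. l \<in> {1..x*y} \<Longrightarrow> I' l \<in> {1..b} \<and>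
        (\<Sum>l'=1..l. 1 / (real x * real (card (Q (I' l'))))) \<le> real (I' l)"
      unfolding mult.commute[of y x] by metis
    define Z where "Z l = P (I l) + Q (I' l)" for l
    define w where "w l = 1 / (real y * real (card (P (I l))))" for l
    define w' where "w' l = 1 / (real x * real (card (Q (I' l))))" for l
    have hZ: "real (I l + I' l) \<le> real (h z) + 1 \<and> z \<in> \<pi> ` (X + Y)" if z: "z \<in> Z l" for l z
    proof -
      obtain u v where uv: "u \<in> P (I l)" "v \<in> Q (I' l)" "z = u + v"
        using z by (auto simp: Z_def set_plus_def)
      have "f u + g v \<le> h z + 1"
        unfolding f_def g_def h_def \<pi>_def uv(3) using uv fin
        by (intro card_fibre_sumset) (auto simp: P_def Q_def \<pi>_def)
      then have "real (f u + g v) \<le> real (h z + 1)" by (simp only: of_nat_le_iff)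
      moreover have "z \<in> \<pi> ` (X + Y)"
        using uv by (auto simp: P_def Q_def \<pi>_def drop_coord_add[symmetric] intro!: imageI set_plus_intro)
      ultimately show ?thesis using uv by (auto simp: P_def Q_def)
    qed
    have wsum: "\<And>l. l \<in> {1..x*y} \<Longrightarrow> (\<Sum>l'=1..l. w l') \<le> real (I l)"
       "\<And>l. l \<in> {1..x*y} \<Longrightarrow> (\<Sum>l'=1..l. w' l') \<le> real (I' l)"
      using I I' by (auto simp: w_def w'_def)
    have wpos: "w l \<ge> 0 \<and> w' l \<ge> 0" for l by (simp add: w_def w'_def)
    have main: "(\<Sum>l=1..x*y. (w l + w' l) * real (card (Z l))) \<le> real (card (X + Y)) + real (card (\<pi> ` (X + Y)))"
    proof -
      have "(\<Sum>l=1..x*y. (w l + w' l) * real (card (Z l))) \<le> (\<Sum>z\<in>\<pi> ` (X + Y). real (h z) + 1)"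
        by (rule weighted_level_count[OF wsum wpos]) (use hZ fin in auto)
      also have "\<dots> = real (\<Sum>z\<in>\<pi> ` (X + Y). h z) + real (card (\<pi> ` (X + Y)))"
        by (simp add: sum.distrib)
      also have "(\<Sum>z\<in>\<pi> ` (X + Y). h z) = card (X + Y)"
        using fin by (simp add: h_def card_eq_sum_fibres[of "X + Y" \<pi>])
      finally show ?thesis .
    qed
    \<comment> \<open>The errors of the induction hypothesis are charged to the lines of
      \<open>X + Y\<close> in direction \<open>r\<close>. A non-empty fibre satisfies
      \<open>h z + 1 \<le> 2 * h z\<close>; this is the factor 2 in \<open>H\<close>.\<close>
    have err: "(\<Sum>l=1..x*y. (w l + w' l) * real (card (drop_coord r ` Z l))) \<le> 2 * real (card (drop_coord r ` (X + Y)))"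
      if r: "r \<in> S" for r
    proof -
      have ri: "r \<noteq> i" using r insert.hyps by auto
      define G where "G = drop_coord r ` (X + Y)"
      define H where "H v = 2 * real (card {u\<in>G. \<pi> u = v})" for v
      have "(\<Sum>l=1..x*y. (w l + w' l) * real (card (drop_coord r ` Z l))) \<le> (\<Sum>v\<in>\<pi> ` G. H v)"
      proof (rule weighted_level_count[OF wsum wpos])
        show "finite (\<pi> ` G)" using fin by (auto simp: G_def)
        show "drop_coord r ` Z l \<subseteq> \<pi> ` G" for l
          using hZ by (force simp: G_def image_iff drop_coord_commute[of r] \<pi>_def)
        show "real (I l + I' l) \<le> H v" if l: "l \<in> {1..x*y}" "v \<in> drop_coord r ` Z l" for l v
        proof -
          obtain z where z: "z \<in> Z l" "v = drop_coord r z" using l by auto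
          let ?F = "{s\<in>X+Y. \<pi> s = z}"
          have "?F \<noteq> {}" using hZ[OF z(1)] by auto
          then have "h z \<ge> 1" using fin by (simp add: h_def Suc_le_eq card_gt_0_iff)
          moreover have "h z = card (drop_coord r ` ?F)"
          proof -
            have "s = s'" if "\<pi> s = \<pi> s'" "drop_coord r s = drop_coord r s'" for s s'
            proof (rule drop_coord_eq_imp_eq[of i])
              show "s $ i = s' $ i" using ri arg_cong[OF that(2), of "\<lambda>u. u $ i"] by simp
            qed (use that in \<open>simp add: \<pi>_def\<close>)
            then show ?thesis unfolding h_def by (intro card_image[symmetric]) (auto simp: inj_on_def)
          qed
          moreover have "card (drop_coord r ` ?F) \<le> card {u\<in>G. \<pi> u = v}"
            using fin z by (intro card_mono) (auto simp: G_def \<pi>_def drop_coord_commute[of r])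
          ultimately have "h z + 1 \<le> 2 * card {u\<in>G. \<pi> u = v}" by linarith
          then have "real (h z + 1) \<le> real (2 * card {u\<in>G. \<pi> u = v})" by (simp only: of_nat_le_iff)
          then show ?thesis using hZ[OF z(1)] by (simp add: H_def)
        qed
      qed (auto simp: H_def)
      also have "\<dots> = 2 * real (card G)"
        using fin card_eq_sum_fibres[of G \<pi>] by (simp add: H_def sum_distrib_left[symmetric] G_def)
      finally show ?thesis by (simp add: G_def)
    qed
    define B where "B = (real x powr (1 / real (Suc m)) + real y powr (1 / real (Suc m))) ^ Suc m"
    \<comment> \<open>Since \<open>w l + w' l\<close> equals
      \<open>(x / p + y / q) / (x * y)\<close>, \<open>brunn_minkowski_holder\<close> lets every one
      of the \<open>x * y\<close> indices contribute an equal share of \<open>B\<close>.\<close>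
    have lower: "B / (real x * real y) \<le> (w l + w' l) * real (card (Z l))
        + 2 ^ m * (\<Sum>r\<in>S. (w l + w' l) * real (card (drop_coord r ` Z l)))" if l: "l \<in> {1..x*y}" for l
    proof -
      define p q where "p = card (P (I l))" and "q = card (Q (I' l))"
      have pq: "p > 0" "q > 0" using I[OF l] I'[OF l] Pne Qne Pfin by (auto simp: p_def q_def card_gt_0_iff)
      have "(real p powr (1 / real m) + real q powr (1 / real m)) ^ m
        \<le> real (card (Z l)) + 2 ^ m * (\<Sum>r\<in>S. real (card (drop_coord r ` Z l)))"
        unfolding Z_def p_def q_def m_def
      proof (rule insert.IH)
        have agree: "s $ j = s' $ j" if ss: "s \<in> P (I l)" "s' \<in> P (I l)" and j: "j \<notin> S" for s s' j
        proof -
          obtain t t' where "t \<in> X" "t' \<in> X" "s = drop_coord i t" "s' = drop_coord i t'"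
            using ss unfolding P_def \<pi>_def by blast
          then show ?thesis using insert.prems(5)[of t t' j] j by simp
        qed
        have agree': "s $ j = s' $ j" if ss: "s \<in> Q (I' l)" "s' \<in> Q (I' l)" and j: "j \<notin> S" for s s' j
        proof -
          obtain t t' where "t \<in> Y" "t' \<in> Y" "s = drop_coord i t" "s' = drop_coord i t'"
            using ss unfolding Q_def \<pi>_def by blast
          then show ?thesis using insert.prems(6)[of t t' j] j by simp
        qed
        show "\<And>s s' j. s \<in> P (I l) \<Longrightarrow> s' \<in> P (I l) \<Longrightarrow> j \<notin> S \<Longrightarrow> s $ j = s' $ j" using agree .
        show "\<And>s s' j. s \<in> Q (I' l) \<Longrightarrow> s' \<in> Q (I' l) \<Longrightarrow> j \<notin> S \<Longrightarrow> s $ j = s' $ j" using agree' .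
      qed (use Pne Qne Pfin I[OF l] I'[OF l] insert.hyps in auto)
      then have "(w l + w' l) * (real p powr (1 / real m) + real q powr (1 / real m)) ^ m
        \<le> (w l + w' l) * (real (card (Z l)) + 2 ^ m * (\<Sum>r\<in>S. real (card (drop_coord r ` Z l))))"
        using wpos by (intro mult_left_mono) (auto intro: add_nonneg_nonneg)
      moreover have "B / (real x * real y) \<le> (w l + w' l) * (real p powr (1 / real m) + real q powr (1 / real m)) ^ m"
      proof -
        have "w l + w' l = (real x / p + real y / q) / (real x * real y)"
          using xy pq by (simp add: w_def w'_def p_def[symmetric] q_def[symmetric] field_simps)
        moreover have "B \<le> (real x / p + real y / q) * (real p powr (1 / real m) + real q powr (1 / real m)) ^ m"
          unfolding B_def using xy pq m by (intro brunn_minkowski_holder) auto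
        ultimately show ?thesis using xy by (simp add: divide_right_mono)
      qed
      ultimately show ?thesis by (simp add: algebra_simps sum_distrib_left)
    qed
    have "B = (\<Sum>l=1..x*y. B / (real x * real y))" using xy by simp
    also have "\<dots> \<le> (\<Sum>l=1..x*y. (w l + w' l) * real (card (Z l))
        + 2 ^ m * (\<Sum>r\<in>S. (w l + w' l) * real (card (drop_coord r ` Z l))))"
      by (intro sum_mono lower)
    also have "\<dots> = (\<Sum>l=1..x*y. (w l + w' l) * real (card (Z l)))
        + 2 ^ m * (\<Sum>r\<in>S. \<Sum>l=1..x*y. (w l + w' l) * real (card (drop_coord r ` Z l)))"
      unfolding sum.distrib sum_distrib_left[symmetric] by (subst sum.swap) (simp only: sum_distrib_left)
    also have "\<dots> \<le> (real (card (X + Y)) + real (card (\<pi> ` (X + Y))))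
        + 2 ^ m * (\<Sum>r\<in>S. 2 * real (card (drop_coord r ` (X + Y))))"
      by (intro add_mono main mult_left_mono sum_mono err) auto
    also have "\<dots> \<le> real (card (X + Y)) + 2 ^ Suc m * (\<Sum>r\<in>insert i S. real (card (drop_coord r ` (X + Y))))"
    proof -
      have "1 * real (card (\<pi> ` (X + Y))) \<le> 2 ^ Suc m * real (card (\<pi> ` (X + Y)))"
        by (intro mult_right_mono one_le_power) auto
      then show ?thesis using insert.hyps
        by (simp add: algebra_simps sum_distrib_left \<pi>_def)
    qed
    finally show ?case unfolding m(2) B_def x_def y_def .
  qed
qed

section \<open>Sumset estimates\<close>

lemma card_sumset_le:
  fixes U V :: "'a::ab_group_add set"
  assumes "finite U" "finite V"
  shows "card (U + V) \<le> card U * card V"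
  using assms by (metis card_image_le card_cartesian_product finite_cartesian_product set_plus_image)

lemma card_sumset_ge_left:
  fixes U V :: "'a::ab_group_add set"
  assumes "finite U" "finite V" "v \<in> V"
  shows "card U \<le> card (U + V)"
proof -
  have "U + {v} \<subseteq> U + V" using assms by (intro set_plus_mono2) auto
  then show ?thesis using assms card_mono finite_set_plus card_plus_sing by metis
qed

text \<open>Take \<open>T\<close> maximal in \<open>U\<close> with pairwise disjoint translates
  \<open>t + A\<close>, which is what the injectivity in \<open>\<P>\<close> expresses. By
  maximality every \<open>u + A\<close> meets some \<open>t + A\<close>.\<close>

lemma ruzsa_covering:
  fixes U A :: "'a::ab_group_add set"
  assumes "finite U" "finite A" "A \<noteq> {}"
  shows "\<exists>T. finite T \<and> card T * card A \<le> card (U + A) \<and> U \<subseteq> T + (A + uminus ` A)"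
proof -
  define \<P> where "\<P> = {T \<in> Pow U. inj_on (\<lambda>(s, a). s + a) (T \<times> A)}"
  have "finite \<P>" "{} \<in> \<P>" using assms by (auto simp: \<P>_def)
  then obtain T where T: "T \<in> \<P>" "\<And>T'. T' \<in> \<P> \<Longrightarrow> T \<subseteq> T' \<Longrightarrow> T = T'"
    using finite_has_maximal[of \<P>] by blast
  have TU: "T \<subseteq> U" "finite T" and inj: "inj_on (\<lambda>(s, a). s + a) (T \<times> A)"
    using T(1) assms finite_subset by (auto simp: \<P>_def)
  have "card T * card A = card (T + A)"
    using card_image[OF inj] by (simp add: set_plus_image card_cartesian_product)
  also have "\<dots> \<le> card (U + A)"
    using TU assms by (intro card_mono finite_set_plus set_plus_mono2) auto
  finally have "card T * card A \<le> card (U + A)" .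
  moreover have "u \<in> T + (A + uminus ` A)" if u: "u \<in> U" for u
  proof (cases "u \<in> T")
    case True
    obtain a where "a \<in> A" using assms by blast
    then have "u + (a + - a) \<in> T + (A + uminus ` A)"
      using True by (intro set_plus_intro imageI)
    then show ?thesis by simp
  next
    case False
    then have "insert u T \<notin> \<P>" using T(2)[of "insert u T"] by blast
    then have "\<not> inj_on (\<lambda>(s, a). s + a) (insert u T \<times> A)" using u TU by (auto simp: \<P>_def)
    then obtain s a s' a' where *: "s \<in> insert u T" "s' \<in> insert u T" "a \<in> A" "a' \<in> A"
        "s + a = s' + a'" "(s, a) \<noteq> (s', a')"
      by (auto simp: inj_on_def)
    have "\<not> (s \<in> T \<and> s' \<in> T)" using * inj by (auto simp: inj_on_def)
    moreover have "\<not> (s = u \<and> s' = u)" using * by auto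
    ultimately obtain r b b' where "r \<in> T" "b \<in> A" "b' \<in> A" "u + b = r + b'"
      using * by (metis insert_iff)
    then have "u = r + (b' + - b)" by (simp add: algebra_simps)
    then show ?thesis using \<open>r \<in> T\<close> \<open>b \<in> A\<close> \<open>b' \<in> A\<close> by (metis image_eqI set_plus_intro)
  qed
  ultimately show ?thesis using TU by blast
qed

text \<open>Fix one representation \<open>w = u - v\<close> for every difference; the pair
  \<open>(x + u, x + v)\<close> determines \<open>w\<close> by subtraction, and then
  \<open>x\<close>.\<close>

lemma ruzsa_triangle:
  fixes U V X :: "'a::ab_group_add set"
  assumes "finite U" "finite V" "finite X"
  shows "card (U + uminus ` V) * card X \<le> card (X + U) * card (X + V)"
proof -
  have "\<exists>p\<in>U \<times> V. w = fst p - snd p" if "w \<in> U + uminus ` V" for w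
    using that by (force simp: set_plus_def)
  then obtain g where g: "\<And>w. w \<in> U + uminus ` V \<Longrightarrow> g w \<in> U \<times> V \<and> w = fst (g w) - snd (g w)"
    by metis
  let ?f = "\<lambda>(w, x). (x + fst (g w), x + snd (g w))"
  have "inj_on ?f ((U + uminus ` V) \<times> X)"
  proof (rule inj_onI, clarify)
    fix w x w' x' assume w: "w \<in> U + uminus ` V" "w' \<in> U + uminus ` V"
      and eq: "x + fst (g w) = x' + fst (g w')" "x + snd (g w) = x' + snd (g w')"
    then have "fst (g w) - snd (g w) = fst (g w') - snd (g w')"
      by (metis add_diff_cancel_left)
    then have "w = w'" using g w by metis
    then show "w = w' \<and> x = x'" using eq by auto
  qed
  moreover have "?f ` ((U + uminus ` V) \<times> X) \<subseteq> (X + U) \<times> (X + V)"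
    using g by (fastforce simp: mem_Times_iff)
  moreover have "finite ((X + U) \<times> (X + V))"
    using assms by (intro finite_cartesian_product finite_set_plus)
  ultimately have "card ((U + uminus ` V) \<times> X) \<le> card ((X + U) \<times> (X + V))"
    by (rule card_inj_on_le)
  then show ?thesis by (simp add: card_cartesian_product)
qed

text \<open>\<open>X\<close> minimises \<open>card (X + B) / card X\<close> among the non-empty
  subsets of \<open>A\<close>. Adding the elements of \<open>S\<close> one at a time, the growth of
  \<open>X + B + S\<close> is controlled by the growth of \<open>X + S\<close>.\<close>

lemma petridis:
  fixes A B :: "'a::ab_group_add set"
  assumes A: "finite A" "A \<noteq> {}" and B: "finite B"
  shows "\<exists>X\<subseteq>A. X \<noteq> {} \<and> (\<forall>S. finite S \<longrightarrow>
    real (card (X + B + S)) \<le> real (card (A + B)) / real (card A) * real (card (X + S)))"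
proof -
  define r where "r X = real (card (X + B)) / real (card X)" for X :: "'a set"
  have "finite (Pow A - {{}})" "A \<in> Pow A - {{}}" using A by auto
  then obtain X where X: "X \<in> Pow A - {{}}" "\<And>X'. X' \<in> Pow A - {{}} \<Longrightarrow> r X \<le> r X'"
    using arg_min_if_finite[of "Pow A - {{}}" r] by (metis (no_types, lifting) empty_iff not_less)
  have Xf: "X \<subseteq> A" "X \<noteq> {}" "finite X" using X A finite_subset by auto
  have r0: "0 \<le> r X" by (simp add: r_def)
  have sub: "r X * real (card X') \<le> real (card (X' + B))" if "X' \<subseteq> X" for X'
  proof (cases "X' = {}")
    case False
    then have "r X \<le> r X'" "card X' > 0" using X(2)[of X'] that Xf finite_subset by (auto simp: card_gt_0_iff)
    then show ?thesis by (simp add: r_def[of X'] field_simps)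
  qed simp
  have rX: "real (card (X + B)) = r X * real (card X)"
    using Xf by (simp add: r_def)
  have "real (card (X + B + S)) \<le> r X * real (card (X + S))" if "finite S" for S
    using that
  proof (induction S rule: finite_induct)
    case (insert s S)
    \<comment> \<open>\<open>X'\<close> collects the \<open>x\<close> for which
      \<open>x + B + s\<close> brings nothing new. These cost nothing on the left, where minimality,
      in the form \<open>sub\<close>, bounds the saving \<open>card (X' + B)\<close> from below;
      every other \<open>x\<close> yields a new element \<open>x + s\<close> on the right.\<close>
    define X' where "X' = {x\<in>X. (\<lambda>b. x + b + s) ` B \<subseteq> X + B + S}"
    have X': "X' \<subseteq> X" "finite X'" using Xf by (auto simp: X'_def)
    have fins: "finite (X + B + S)" "finite (X + S)" "finite (X + B)" "finite (X' + B)"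
      using Xf X' B insert by (auto intro!: finite_set_plus)
    have "X + B + insert s S \<subseteq> (X + B + S) \<union> ((\<lambda>z. z + s) ` ((X + B) - (X' + B)))"
    proof
      fix z assume "z \<in> X + B + insert s S"
      then obtain x b s' where z: "z = x + b + s'" "x \<in> X" "b \<in> B" "s' = s \<or> s' \<in> S"
        by (auto simp: set_plus_def)
      show "z \<in> (X + B + S) \<union> ((\<lambda>z. z + s) ` ((X + B) - (X' + B)))"
      proof (cases "s' \<in> S \<or> x + b \<in> X' + B")
        case True
        then show ?thesis
        proof
          assume "x + b \<in> X' + B"
          then obtain x1 b1 where "x + b = x1 + b1" "x1 \<in> X'" "b1 \<in> B" by (auto simp: set_plus_def)
          then have "x + b + s \<in> X + B + S" by (auto simp: X'_def)
          then show ?thesis using z by auto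
        qed (use z in auto)
      next
        case False
        then show ?thesis using z by auto
      qed
    qed
    then have "card (X + B + insert s S) \<le> card ((X + B + S) \<union> ((\<lambda>z. z + s) ` ((X + B) - (X' + B))))"
      using fins by (intro card_mono) auto
    also have "\<dots> \<le> card (X + B + S) + card ((X + B) - (X' + B))"
      using fins by (intro order.trans[OF card_Un_le] add_left_mono card_image_le) auto
    also have "card ((X + B) - (X' + B)) = card (X + B) - card (X' + B)"
      using fins X' by (intro card_Diff_subset set_plus_mono2) auto
    finally have "real (card (X + B + insert s S)) \<le> real (card (X + B + S)) + (real (card (X + B)) - real (card (X' + B)))"
      using card_mono[OF fins(3), of "X' + B"] set_plus_mono2[of X' X B B] X' by (simp add: of_nat_diff)
    also have "\<dots> \<le> r X * real (card (X + S)) + (r X * real (card X) - r X * real (card X'))"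
      using insert.IH sub[OF X'(1)] rX by simp
    also have "\<dots> = r X * (real (card (X + S)) + real (card X) - real (card X'))"
      by (simp add: algebra_simps)
    also have "\<dots> \<le> r X * real (card (X + insert s S))"
    proof (intro mult_left_mono r0)
      have "(X + S) \<union> (\<lambda>x. x + s) ` (X - X') \<subseteq> X + insert s S"
        using set_plus_mono2[of X X S "insert s S"] by auto
      moreover have "(X + S) \<inter> (\<lambda>x. x + s) ` (X - X') = {}"
      proof (rule ccontr)
        assume "\<not> ?thesis"
        then obtain x x1 s1 where x: "x \<in> X" "x \<notin> X'" "x + s = x1 + s1" "x1 \<in> X" "s1 \<in> S"
          by (auto simp: set_plus_def)
        have eq: "x + b + s = (x1 + b) + s1" for b
          using x(3) by (metis add.assoc add.commute)
        have "(\<lambda>b. x + b + s) ` B \<subseteq> X + B + S"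
          unfolding eq using x(4,5) by blast
        then show False using x by (auto simp: X'_def)
      qed
      moreover have "card ((\<lambda>x. x + s) ` (X - X')) = card X - card X'"
        using X' by (subst card_image) (auto simp: inj_on_def card_Diff_subset)
      ultimately have "card (X + S) + (card X - card X') \<le> card (X + insert s S)"
        using card_mono[of "X + insert s S" "(X + S) \<union> (\<lambda>x. x + s) ` (X - X')"] fins Xf insert.hyps
        by (simp add: card_Un_disjoint finite_set_plus)
      moreover have "card X' \<le> card X" using X' Xf by (intro card_mono) auto
      ultimately show "real (card (X + S)) + real (card X) - real (card X') \<le> real (card (X + insert s S))"
        by linarith
    qed
    finally show ?case .
  qed simp
  moreover have "r X \<le> real (card (A + B)) / real (card A)"
    using X(2)[of A] A by (auto simp: r_def)
  ultimately show ?thesis using Xf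
    by (meson mult_right_mono of_nat_0_le_iff order.trans)
qed

section \<open>Iterated sumsets and coverings by translates of the difference set\<close>

definition nfold :: "nat \<Rightarrow> 'a::comm_monoid_add set \<Rightarrow> 'a set" where
  "nfold h A = ((+) A ^^ h) {0}"

lemma nfold_0 [simp]: "nfold 0 A = {0}" and nfold_Suc [simp]: "nfold (Suc h) A = A + nfold h A"
  by (simp_all add: nfold_def)

lemma nfold_add: "nfold (g + h) A = nfold g A + nfold h A"
  by (induction g) (simp_all add: add.assoc)

lemma nfold_sumset: "nfold h (A + B) = nfold h A + nfold h B"
  by (induction h) (simp_all add: ac_simps)

lemma finite_nfold: "finite A \<Longrightarrow> finite (nfold h A)"
  by (induction h) (simp_all add: finite_set_plus)

lemma nfold_mono: "A \<subseteq> B \<Longrightarrow> nfold h A \<subseteq> nfold h B"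
  by (induction h) (simp_all add: set_plus_mono2)

lemma image_sumset:
  assumes "\<And>x y. \<phi> (x + y) = \<phi> x + \<phi> y"
  shows "\<phi> ` (A + B) = \<phi> ` A + \<phi> ` B"
  by (force simp: set_plus_def assms)

lemma image_nfold:
  fixes \<phi> :: "'a::ab_group_add \<Rightarrow> 'b::ab_group_add"
  assumes "\<And>x y. \<phi> (x + y) = \<phi> x + \<phi> y"
  shows "\<phi> ` nfold h A = nfold h (\<phi> ` A)"
proof (induction h)
  case 0
  have "\<phi> 0 = 0" using assms[of 0 0] by simp
  then show ?case by simp
qed (simp add: image_sumset[of \<phi>, OF assms])

lemma card_nfold_le:
  fixes A :: "'a::ab_group_add set"
  assumes "finite A"
  shows "card (nfold h A) \<le> card A ^ h"
proof (induction h)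
  case (Suc h)
  then show ?case using assms card_sumset_le[of A "nfold h A"]
    by (simp add: finite_nfold) (meson dual_order.trans mult_le_mono2)
qed simp

text \<open>Iterating \<open>petridis\<close> gives
  \<open>card (X + nfold h B) \<le> C ^ h * card X\<close>; the triangle inequality with pivot
  \<open>X\<close> then passes to differences.\<close>

lemma plunnecke_difference:
  fixes A B :: "'a::ab_group_add set"
  assumes A: "finite A" "A \<noteq> {}" and B: "finite B" and C: "real (card (A + B)) \<le> C * real (card A)"
  shows "real (card (nfold h (B + uminus ` B))) \<le> C ^ (2 * h) * real (card A)"
proof -
  obtain X where X: "X \<subseteq> A" "X \<noteq> {}" "\<And>S. finite S \<Longrightarrow>
    real (card (X + B + S)) \<le> real (card (A + B)) / real (card A) * real (card (X + S))"
    using petridis[OF A B] by blast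
  have cA: "real (card A) > 0" using A by (simp add: card_gt_0_iff)
  have "finite X" using X(1) A(1) by (rule finite_subset)
  then have cX: "0 < card X" "card X \<le> card A" "finite X" using X A card_mono by (auto simp: card_gt_0_iff)
  have K: "real (card (A + B)) / real (card A) \<le> C" using C cA by (simp add: divide_le_eq)
  have C0: "0 \<le> C" using order.trans[OF _ K, of 0] by simp
  have step: "real (card (X + nfold h B)) \<le> C ^ h * real (card X)" for h
  proof (induction h)
    case (Suc h)
    have "real (card (X + nfold (Suc h) B)) \<le> C * real (card (X + nfold h B))"
      using X(3)[of "nfold h B"] mult_right_mono[OF K, of "real (card (X + nfold h B))"] B
      by (simp add: finite_nfold add.assoc)
    also have "\<dots> \<le> C * (C ^ h * real (card X))" by (rule mult_left_mono[OF Suc C0])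
    finally show ?case by simp
  qed simp
  have neg: "nfold h (uminus ` B) = uminus ` nfold h B"
    by (rule image_nfold[symmetric]) simp
  have "card (nfold h (B + uminus ` B)) * card X \<le> card (X + nfold h B) * card (X + nfold h B)"
    unfolding nfold_sumset neg using B cX by (intro ruzsa_triangle finite_nfold)
  then have "real (card (nfold h (B + uminus ` B)) * card X) \<le> real (card (X + nfold h B) * card (X + nfold h B))"
    by (simp only: of_nat_le_iff)
  then have "real (card (nfold h (B + uminus ` B))) * real (card X) \<le> real (card (X + nfold h B)) * real (card (X + nfold h B))"
    by simp
  also have "\<dots> \<le> (C ^ h * real (card X)) * (C ^ h * real (card X))"
    by (intro mult_mono step) (auto simp: C0)
  also have "\<dots> = (C ^ h * C ^ h * real (card X)) * real (card X)" by (simp only: ac_simps)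
  finally have "real (card (nfold h (B + uminus ` B))) \<le> C ^ h * C ^ h * real (card X)"
    using cX by (metis mult_right_le_imp_le of_nat_0_less_iff)
  also have "C ^ h * C ^ h = C ^ (2 * h)" by (simp add: mult_2 power_add)
  also have "C ^ (2 * h) * real (card X) \<le> C ^ (2 * h) * real (card A)"
    using cX C0 by (intro mult_left_mono) auto
  finally show ?thesis .
qed

definition diff_set :: "'a::ab_group_add set \<Rightarrow> 'a set" where
  "diff_set A = A + uminus ` A"

lemma diff_set_memI: "a \<in> A \<Longrightarrow> b \<in> A \<Longrightarrow> a - b \<in> diff_set A"
  unfolding diff_set_def by (metis diff_conv_add_uminus image_eqI set_plus_intro)

lemma diff_set_uminus: "uminus ` diff_set A = diff_set A"
  unfolding diff_set_def by (simp add: image_sumset image_image add.commute)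

lemma zero_in_diff_set: "A \<noteq> {} \<Longrightarrow> 0 \<in> diff_set A"
  using diff_set_memI[of _ A] by (metis all_not_in_conv diff_self)

lemma finite_diff_set: "finite A \<Longrightarrow> finite (diff_set A)"
  by (simp add: diff_set_def finite_set_plus)

locale small_dilate_sum =
  fixes \<phi> :: "'a::ab_group_add \<Rightarrow> 'a" and A :: "'a set" and C :: real
  assumes add: "\<phi> (x + y) = \<phi> x + \<phi> y" and inj: "inj \<phi>"
    and fin: "finite A" and ne: "A \<noteq> {}"
    and small: "real (card (A + \<phi> ` A)) \<le> C * real (card A)"
begin

lemma card_pos: "0 < real (card A)"
  using fin ne by (simp add: card_gt_0_iff)

lemma C_ge_1: "1 \<le> C"
proof -
  have "card A \<le> card (A + \<phi> ` A)" using fin ne card_sumset_ge_left[of A "\<phi> ` A"] by blast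
  then have "1 * real (card A) \<le> C * real (card A)" using small by linarith
  then show ?thesis using card_pos by (simp del: mult_1)
qed

lemma uminus_image: "\<phi> (- x) = - \<phi> x"
proof -
  have "\<phi> 0 = 0" using add[of 0 0] by simp
  then show ?thesis using add[of x "- x"] by (simp add: eq_neg_iff_add_eq_0 add.commute)
qed

lemma image_diff_set: "\<phi> ` diff_set U = diff_set (\<phi> ` U)"
  unfolding diff_set_def by (simp add: image_sumset[of \<phi>, OF add] image_image uminus_image)

text \<open>The hypothesis \<open>small\<close> adds the image of \<open>A\<close> to
  \<open>A\<close>, so it controls differences inside that image; injectivity of \<phi> carries the
  bound back to \<open>A\<close>.\<close>

lemma card_nfold_diff_set: "real (card (nfold h (diff_set A))) \<le> C ^ (2 * h) * real (card A)"
proof -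
  have "card (nfold h (diff_set A)) = card (\<phi> ` nfold h (diff_set A))"
    using inj by (simp add: card_image inj_on_subset)
  also have "\<phi> ` nfold h (diff_set A) = nfold h (diff_set (\<phi> ` A))"
    by (simp add: image_nfold[of \<phi>, OF add] image_diff_set)
  finally show ?thesis
    using plunnecke_difference[OF fin ne _ small, of h] fin by (simp add: diff_set_def)
qed

lemma cover_nfold_diff_set:
  "\<exists>T. finite T \<and> real (card T) \<le> C ^ (2 * Suc h) \<and> nfold h (diff_set A) \<subseteq> diff_set A + T"
proof -
  obtain T where T: "finite T" "card T * card A \<le> card (nfold h (diff_set A) + A)"
      "nfold h (diff_set A) \<subseteq> T + (A + uminus ` A)"
    using ruzsa_covering[OF finite_nfold[OF finite_diff_set[OF fin]] fin ne] by blast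
  obtain a where a: "a \<in> A" using ne by blast
  \<comment> \<open>Translation by \<open>- a\<close> turns the summand \<open>A\<close> into a part
    of \<open>diff_set A\<close>, so the covering number is governed by one more fold.\<close>
  have "nfold h (diff_set A) + A + {- a} \<subseteq> nfold (Suc h) (diff_set A)"
    using diff_set_memI[OF _ a] by (force simp: set_plus_def)
  then have "card (nfold h (diff_set A) + A + {- a}) \<le> card (nfold (Suc h) (diff_set A))"
    using finite_nfold[OF finite_diff_set[OF fin]] by (intro card_mono)
  then have "card T * card A \<le> card (nfold (Suc h) (diff_set A))"
    using T(2) by (simp only: card_plus_sing)
  then have "real (card T * card A) \<le> C ^ (2 * Suc h) * real (card A)"
    using card_nfold_diff_set[of "Suc h"] by linarith
  then have "real (card T) \<le> C ^ (2 * Suc h)" using card_pos by simp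
  then show ?thesis using T by (auto simp: diff_set_def add.commute)
qed

text \<open>Ruzsa covering puts the image of \<open>A\<close> into \<open>T + diff_set A\<close>.
  Taking differences doubles \<open>diff_set A\<close> and replaces \<open>T\<close> by
  \<open>diff_set T\<close>, hence the two-fold sum and the square of \<open>C\<close>.\<close>

lemma cover_image:
  "\<exists>T. finite T \<and> real (card T) \<le> C\<^sup>2 \<and> \<phi> ` diff_set A \<subseteq> nfold 2 (diff_set A) + T"
proof -
  obtain T where T: "finite T" "card T * card A \<le> card (\<phi> ` A + A)" "\<phi> ` A \<subseteq> T + diff_set A"
    using ruzsa_covering[of "\<phi> ` A" A] fin ne by (auto simp: diff_set_def)
  have "real (card T * card A) \<le> C * real (card A)"
    using T(2) small unfolding add.commute[of A] by linarith
  then have cT: "real (card T) \<le> C" using card_pos by simp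
  have "\<phi> ` diff_set A \<subseteq> (T + diff_set A) + uminus ` (T + diff_set A)"
    unfolding image_diff_set using T(3) by (subst diff_set_def) (intro set_plus_mono2 image_mono)
  also have "\<dots> = nfold 2 (diff_set A) + diff_set T"
    unfolding diff_set_def[of T]
    by (simp add: image_sumset diff_set_uminus numeral_2_eq_2 ac_simps)
  finally have "\<phi> ` diff_set A \<subseteq> nfold 2 (diff_set A) + diff_set T" .
  moreover have "card (diff_set T) \<le> card T * card T"
    unfolding diff_set_def using card_sumset_le[of T "uminus ` T"] T(1) by (simp add: card_image)
  then have "real (card (diff_set T)) \<le> real (card T) * real (card T)" by (metis of_nat_le_iff of_nat_mult)
  moreover have "real (card T) * real (card T) \<le> C * C" using cT C_ge_1 by (intro mult_mono) auto
  ultimately show ?thesis using finite_diff_set[OF T(1)] by (auto simp: power2_eq_square intro!: exI[of _ "diff_set T"])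
qed

text \<open>Every application of \<phi> turns each summand \<open>diff_set A\<close> into two
  summands up to translates, so their number doubles. The covering number depends on
  \<open>C\<close> and \<open>i\<close> only.\<close>

lemma cover_funpow:
  "\<exists>T. finite T \<and> real (card T) \<le> C ^ (2 * 2 ^ i) \<and> (\<phi> ^^ i) ` diff_set A \<subseteq> nfold (2 ^ i) (diff_set A) + T"
proof (induction i)
  case 0
  show ?case using C_ge_1 by (intro exI[of _ "{0}"]) (simp add: one_le_power)
next
  case (Suc i)
  then obtain T where T: "finite T" "real (card T) \<le> C ^ (2 * 2 ^ i)"
    "(\<phi> ^^ i) ` diff_set A \<subseteq> nfold (2 ^ i) (diff_set A) + T" by blast
  obtain T1 where T1: "finite T1" "real (card T1) \<le> C\<^sup>2" "\<phi> ` diff_set A \<subseteq> nfold 2 (diff_set A) + T1"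
    using cover_image by blast
  define T2 where "T2 = nfold (2 ^ i) T1 + \<phi> ` T"
  have "(\<phi> ^^ Suc i) ` diff_set A = \<phi> ` ((\<phi> ^^ i) ` diff_set A)" by (simp add: image_image)
  also have "\<dots> \<subseteq> \<phi> ` (nfold (2 ^ i) (diff_set A) + T)" using T(3) by (rule image_mono)
  also have "\<dots> = nfold (2 ^ i) (\<phi> ` diff_set A) + \<phi> ` T"
    by (simp add: image_sumset[of \<phi>, OF add] image_nfold[of \<phi>, OF add])
  also have "\<dots> \<subseteq> nfold (2 ^ i) (nfold 2 (diff_set A) + T1) + \<phi> ` T"
    using T1(3) by (intro set_plus_mono2 nfold_mono) auto
  also have "\<dots> = nfold (2 ^ Suc i) (diff_set A) + T2"
    by (simp add: nfold_sumset numeral_2_eq_2 T2_def mult_2 nfold_add add.assoc)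
  finally have "(\<phi> ^^ Suc i) ` diff_set A \<subseteq> nfold (2 ^ Suc i) (diff_set A) + T2" .
  moreover have fT2: "finite T2" using T T1 by (simp add: T2_def finite_set_plus finite_nfold)
  moreover have "card T2 \<le> card T1 ^ 2 ^ i * card T"
    unfolding T2_def using T T1 card_sumset_le[of "nfold (2 ^ i) T1" "\<phi> ` T"] card_nfold_le[OF T1(1), of "2 ^ i"]
      inj by (simp add: finite_nfold card_image inj_on_subset) (meson dual_order.trans mult_le_mono1)
  then have "real (card T2) \<le> real (card T1) ^ 2 ^ i * real (card T)"
    by (metis of_nat_le_iff of_nat_mult of_nat_power)
  moreover have "\<dots> \<le> (C\<^sup>2) ^ 2 ^ i * C ^ (2 * 2 ^ i)"
    using T T1 by (intro mult_mono power_mono) auto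
  moreover have "\<dots> = C ^ (2 * 2 ^ Suc i)"
    by (simp add: power_mult[symmetric] power_add[symmetric])
  ultimately show ?case by auto
qed

lemma cover_funpow_sum:
  "\<exists>T. finite T \<and> real (card T) \<le> C ^ (2 * 2 ^ i) * C ^ (2 * Suc (Suc (2 ^ i))) \<and>
    diff_set A + (\<phi> ^^ i) ` diff_set A \<subseteq> diff_set A + T"
proof -
  obtain T where T: "finite T" "real (card T) \<le> C ^ (2 * 2 ^ i)"
    "(\<phi> ^^ i) ` diff_set A \<subseteq> nfold (2 ^ i) (diff_set A) + T" using cover_funpow by blast
  obtain T' where T': "finite T'" "real (card T') \<le> C ^ (2 * Suc (Suc (2 ^ i)))"
     "nfold (Suc (2 ^ i)) (diff_set A) \<subseteq> diff_set A + T'" using cover_nfold_diff_set by blast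
  have "diff_set A + (\<phi> ^^ i) ` diff_set A \<subseteq> diff_set A + (nfold (2 ^ i) (diff_set A) + T)"
    using T by (intro set_plus_mono2) auto
  also have "\<dots> = nfold (Suc (2 ^ i)) (diff_set A) + T" by (simp add: add.assoc)
  also have "\<dots> \<subseteq> diff_set A + T' + T" using T' by (intro set_plus_mono2) auto
  also have "\<dots> = diff_set A + (T + T')" by (simp add: ac_simps)
  finally have "diff_set A + (\<phi> ^^ i) ` diff_set A \<subseteq> diff_set A + (T + T')" .
  moreover have "real (card (T + T')) \<le> real (card T) * real (card T')"
    using card_sumset_le[OF T(1) T'(1)] by (metis of_nat_le_iff of_nat_mult)
  moreover have "\<dots> \<le> C ^ (2 * 2 ^ i) * C ^ (2 * Suc (Suc (2 ^ i)))"
    using T T' by (intro mult_mono) auto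
  ultimately show ?thesis using T T' by (intro exI[of _ "T + T'"]) (auto simp: finite_set_plus)
qed

text \<open>A single \<open>T\<close> for all powers allows repeated absorption with the same
  translates, and its size is bounded in terms of \<open>C\<close> and \<open>n\<close>
  alone.\<close>

lemma cover_funpow_uniform:
  "\<exists>T. finite T \<and> real (card T) \<le> (\<Sum>i<n. C ^ (2 * 2 ^ i) * C ^ (2 * Suc (Suc (2 ^ i)))) \<and>
    (\<forall>i<n. diff_set A + (\<phi> ^^ i) ` diff_set A \<subseteq> diff_set A + T)"
proof (induction n)
  case (Suc n)
  then obtain T where T: "finite T" "real (card T) \<le> (\<Sum>i<n. C ^ (2 * 2 ^ i) * C ^ (2 * Suc (Suc (2 ^ i))))"
    "\<forall>i<n. diff_set A + (\<phi> ^^ i) ` diff_set A \<subseteq> diff_set A + T" by blast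
  obtain T' where T': "finite T'" "real (card T') \<le> C ^ (2 * 2 ^ n) * C ^ (2 * Suc (Suc (2 ^ n)))"
     "diff_set A + (\<phi> ^^ n) ` diff_set A \<subseteq> diff_set A + T'" using cover_funpow_sum by blast
  have "real (card (T \<union> T')) \<le> real (card T) + real (card T')"
    using card_Un_le[of T T'] by linarith
  moreover have "diff_set A + (\<phi> ^^ i) ` diff_set A \<subseteq> diff_set A + (T \<union> T')" if "i < Suc n" for i
    using that T(3) T'(3) unfolding set_plus_Un less_Suc_eq by blast
  ultimately show ?case using T T' by (intro exI[of _ "T \<union> T'"]) auto
qed (auto intro: exI[of _ "{}"])

end

section \<open>A direction containing long progressions\<close>

text \<open>By commutativity a sum of \<open>m\<close> elements of \<open>T\<close> is determined by
  multiplicities in \<open>{0..m}\<close>. As \<open>card T\<close> will be bounded, this is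
  polynomial in \<open>m\<close>; with \<open>m\<close> of order log N it accounts for the loss of a
  power of log N.\<close>

lemma card_nfold_le_poly:
  fixes T :: "(int^'n) set"
  assumes "finite T"
  shows "card (nfold m T) \<le> (m + 1) ^ card T"
proof -
  define ev where "ev f = (\<Sum>t\<in>T. int (f t) *s t)" for f :: "int^'n \<Rightarrow> nat"
  have "nfold m T \<subseteq> ev ` (T \<rightarrow>\<^sub>E {0..m})"
  proof (induction m)
    case 0
    have "ev (\<lambda>x\<in>T. 0) \<in> ev ` (T \<rightarrow>\<^sub>E {0..0})" by (intro imageI) auto
    moreover have "ev (\<lambda>x\<in>T. 0) = 0" by (simp add: ev_def)
    ultimately show ?case by (simp only: nfold_0 insert_subset empty_subsetI simp_thms)
  next
    case (Suc m)
    show ?case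
    proof
      fix z assume "z \<in> nfold (Suc m) T"
      then obtain s y where z: "z = s + y" "s \<in> T" "y \<in> nfold m T" by (auto simp: set_plus_def)
      then obtain f where f: "f \<in> T \<rightarrow>\<^sub>E {0..m}" "y = ev f" using Suc by auto
      have "ev (f(s := Suc (f s))) = (\<Sum>t\<in>T. int (f t) *s t + (if t = s then s else 0))"
        unfolding ev_def
      proof (intro sum.cong refl)
        show "int ((f(s := Suc (f s))) t) *s t = int (f t) *s t + (if t = s then s else 0)" for t
          by (cases "t = s") (simp_all add: vector_sadd_rdistrib add.commute)
      qed
      also have "\<dots> = z" using z f assms by (simp add: sum.distrib ev_def)
      finally have "z = ev (f(s := Suc (f s)))" ..
      moreover have "f(s := Suc (f s)) \<in> T \<rightarrow>\<^sub>E {0..Suc m}"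
        using f(1) z(2) by (auto simp: PiE_iff extensional_def le_Suc_eq)
      ultimately show "z \<in> ev ` (T \<rightarrow>\<^sub>E {0..Suc m})" by blast
    qed
  qed
  then have "card (nfold m T) \<le> card (ev ` (T \<rightarrow>\<^sub>E {0..m}))"
    using assms by (intro card_mono) (auto intro: finite_PiE)
  also have "\<dots> \<le> card (T \<rightarrow>\<^sub>E {0..m})" using assms by (intro card_image_le finite_PiE) auto
  also have "\<dots> = (m + 1) ^ card T" using assms by (simp add: card_PiE)
  finally show ?thesis .
qed

definition multiples_upto :: "nat \<Rightarrow> int^'n \<Rightarrow> (int^'n) set" where
  "multiples_upto I v = (\<lambda>j. int j *s v) ` {..<2 ^ I}"

text \<open>Binary expansion of the multiplier; vanishing digits are filled with
  \<open>0 \<in> B\<close>.\<close>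

lemma multiples_subset_nfold:
  fixes v :: "int^'n"
  assumes "0 \<in> B" "\<And>i. i < I \<Longrightarrow> 2 ^ i *s v \<in> B"
  shows "multiples_upto I v \<subseteq> nfold I B"
  using assms(2)
proof (induction I)
  case 0
  then show ?case by (auto simp: multiples_upto_def)
next
  case (Suc I)
  have IH: "multiples_upto I v \<subseteq> nfold I B" using Suc by auto
  show ?case
  proof
    fix z assume "z \<in> multiples_upto (Suc I) v"
    then obtain j where j: "j < 2 ^ Suc I" "z = int j *s v" by (auto simp: multiples_upto_def)
    show "z \<in> nfold (Suc I) B"
    proof (cases "j < 2 ^ I")
      case True
      then have "z \<in> nfold I B" using IH j by (auto simp: multiples_upto_def)
      then have "0 + z \<in> B + nfold I B" using assms(1) by (intro set_plus_intro)
      then show ?thesis by simp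
    next
      case False
      define j' where "j' = j - 2 ^ I"
      have j': "j = 2 ^ I + j'" "j' < 2 ^ I" using False j by (auto simp: j'_def)
      have "z = 2 ^ I *s v + int j' *s v" using j j' by (simp add: vec_eq_iff algebra_simps)
      moreover have "int j' *s v \<in> nfold I B" using IH j' by (auto simp: multiples_upto_def)
      moreover have "2 ^ I *s v \<in> B" using Suc.prems by auto
      ultimately show ?thesis by auto
    qed
  qed
qed

text \<open>The dyadic multiples of \<open>x\<close> are tracked through the cover of \<open>W + W\<close> by translates of \<open>W\<close>;
  two points with the same itinerary differ by a vector all of whose dyadic multiples stay small.\<close>

lemma dyadic_pigeonhole:
  fixes W T A :: "(int^'n) set"
  assumes WT: "W + W \<subseteq> W + T" and T: "finite T" and A: "finite A" "card T ^ I < card A"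
    and AW: "(\<lambda>a. a - a0) ` A \<subseteq> W"
  shows "\<exists>t. t \<noteq> 0 \<and> (\<forall>i\<le>I. 2 ^ i *s t \<in> W + uminus ` W)"
proof -
  have "\<exists>h. (\<forall>a\<in>A. h a \<in> {..<I} \<rightarrow>\<^sub>E T) \<and>
    (\<forall>a\<in>A. \<forall>b\<in>A. h a = h b \<longrightarrow> (\<forall>i\<le>I. 2 ^ i *s (a - b) \<in> W + uminus ` W))"
  proof -
    have "\<exists>r. w + w - r \<in> W \<and> r \<in> T" if "w \<in> W" for w
    proof -
      have "w + w \<in> W + T" using that WT by blast
      then obtain u r where "u \<in> W" "r \<in> T" "w + w = u + r" by (auto simp: set_plus_def)
      then show ?thesis by (metis add_diff_cancel_right')
    qed
    then obtain g where g: "\<And>w. w \<in> W \<Longrightarrow> w + w - g w \<in> W \<and> g w \<in> T" by metis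
    \<comment> \<open>The map sending \<open>w\<close> to \<open>w + w - g w\<close> preserves
      \<open>W\<close>. Its first \<open>I\<close> shifts \<open>g\<close> form the itinerary, for
      which there are only \<open>card T ^ I\<close> possibilities.\<close>
    define st where "st a i = ((\<lambda>w. w + w - g w) ^^ i) (a - a0)" for a i
    have stW: "st a i \<in> W" if "a \<in> A" for a i
      by (induction i) (use that AW g in \<open>auto simp: st_def\<close>)
    define h where "h a = (\<lambda>i\<in>{..<I}. g (st a i))" for a
    have "2 ^ i *s (a - b) = st a i - st b i" if ab: "a \<in> A" "b \<in> A" "h a = h b" and "i \<le> I" for a b i
      using \<open>i \<le> I\<close>
    proof (induction i)
      case 0
      then show ?case by (simp add: st_def)
    next
      case (Suc i)
      have "g (st a i) = g (st b i)" using fun_cong[OF ab(3), of i] Suc.prems by (simp add: h_def)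
      moreover have "st a (Suc i) = st a i + st a i - g (st a i)" "st b (Suc i) = st b i + st b i - g (st b i)"
        by (simp_all add: st_def)
      moreover have "2 ^ Suc i *s (a - b) = 2 ^ i *s (a - b) + 2 ^ i *s (a - b)"
        by (simp add: vec_eq_iff algebra_simps)
      ultimately show ?case using Suc.IH Suc.prems by (simp only: Suc_leD) (simp only: algebra_simps)
    qed
    then have "2 ^ i *s (a - b) \<in> W + uminus ` W" if "a \<in> A" "b \<in> A" "h a = h b" "i \<le> I" for a b i
      using that stW by (metis diff_conv_add_uminus image_eqI set_plus_intro)
    moreover have "h a \<in> {..<I} \<rightarrow>\<^sub>E T" if "a \<in> A" for a
      using that g stW by (auto simp: h_def)
    ultimately show ?thesis by blast
  qed
  then obtain h where h0: "\<forall>a\<in>A. h a \<in> {..<I} \<rightarrow>\<^sub>E T"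
    and h: "\<forall>a\<in>A. \<forall>b\<in>A. h a = h b \<longrightarrow> (\<forall>i\<le>I. 2 ^ i *s (a - b) \<in> W + uminus ` W)"
    by (elim exE conjE)
  have "card (h ` A) \<le> card ({..<I} \<rightarrow>\<^sub>E T)" 
    using h0 T by (intro card_mono finite_PiE image_subsetI) auto
  also have "\<dots> < card A" using A T by (simp add: card_PiE)
  finally have "\<not> inj_on h A" by (rule pigeonhole)
  then obtain a b where ab: "a \<in> A" "b \<in> A" "h a = h b" "a \<noteq> b" unfolding inj_on_def by blast
  then have "a - b \<noteq> 0" by simp
  moreover have "\<forall>i\<le>I. 2 ^ i *s (a - b) \<in> W + uminus ` W" using h ab by blast
  ultimately show ?thesis by blast
qed

lemma matrix_int_add: "(L :: int^'n^'n) *v (x + y) = L *v x + L *v y"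
  by (simp add: matrix_vector_mult_def vec_eq_iff sum.distrib algebra_simps)

lemma matrix_int_scale: "(L :: int^'n^'n) *v (c *s x) = c *s (L *v x)"
  by (simp add: matrix_vector_mult_def vec_eq_iff sum_distrib_left algebra_simps)

lemma funpow_matrix_scale: "(((*v) (L :: int^'n^'n)) ^^ i) (c *s x) = c *s (((*v) L) ^^ i) x"
  by (induction i) (simp_all add: matrix_int_scale)

text \<open>Absorbing the summands \<open>V\<close> one at a time costs only an
  \<open>m\<close>-fold sum of \<open>T\<close>, of polynomial size in \<open>m\<close>, whereas the
  crude bound \<open>card T ^ m\<close> would be exponential.\<close>

lemma sumset_nfold_absorb:
  assumes "W + V \<subseteq> W + T"
  shows "W + nfold m V \<subseteq> W + nfold m (T :: 'a::ab_group_add set)"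
proof (induction m)
  case (Suc m)
  have "W + nfold (Suc m) V = (W + nfold m V) + V" by (simp add: ac_simps)
  also have "\<dots> \<subseteq> (W + nfold m T) + V" by (rule set_plus_mono2[OF Suc subset_refl])
  also have "\<dots> = (W + V) + nfold m T" by (simp add: ac_simps)
  also have "\<dots> \<subseteq> (W + T) + nfold m T" by (rule set_plus_mono2[OF assms subset_refl])
  finally show ?case by (simp add: ac_simps)
qed simp

text \<open>With \<open>c0 ^ I\<close> just below \<open>card A\<close>, the progression of length
  \<open>2 ^ I\<close> is a fixed power of \<open>card A\<close> long, while the growth bound is
  polynomial in \<open>I\<close>.\<close>

lemma rich_direction:
  fixes C :: real
  shows "\<exists>c0::nat. 2 \<le> c0 \<and> (\<forall>(L :: int^'n^'n) A I. inj ((*v) L) \<and> finite A \<and> A \<noteq> {} \<and>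
    real (card (A + (*v) L ` A)) \<le> C * real (card A) \<and> c0 ^ I < card A \<longrightarrow>
    (\<exists>t. t \<noteq> 0 \<and> (\<forall>i<n. real (card (A + (*v) L ` A + multiples_upto I ((((*v) L) ^^ i) t)))
       \<le> C\<^sup>2 * real c0 * (2 * real I + 1) ^ c0 * real (card A))))"
proof -
  \<comment> \<open>Two extra powers ensure that \<open>i = 0\<close>, used to double inside
    \<open>W\<close>, and \<open>i = 1\<close>, used for the dilate sum itself, are covered for
    every \<open>n\<close>.\<close>
  define n' where "n' = n + 2"
  \<comment> \<open>\<open>c0\<close> dominates the number of translates in \<open>T\<close>. It is
    both the base of the pigeonhole count and the exponent of the polynomial; being at least 2, it
    has unbounded powers.\<close>
  define c0 where "c0 = max 2 (nat \<lceil>\<Sum>i<n'. C ^ (2 * 2 ^ i) * C ^ (2 * Suc (Suc (2 ^ i)))\<rceil>)"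
  have main: "\<exists>t. t \<noteq> 0 \<and> (\<forall>i<n. real (card (A + (*v) L ` A + multiples_upto I ((((*v) L) ^^ i) t)))
       \<le> C\<^sup>2 * real c0 * (2 * real I + 1) ^ c0 * real (card A))"
    if asm: "inj ((*v) L)" "finite A" "A \<noteq> {}" "real (card (A + (*v) L ` A)) \<le> C * real (card A)" "c0 ^ I < card A"
    for L :: "int^'n^'n" and A :: "(int^'n) set" and I
  proof -
    interpret small_dilate_sum "(*v) L" A C
      by (intro small_dilate_sum.intro matrix_int_add asm)
    define W where "W = diff_set A"
    obtain T where T: "finite T" "real (card T) \<le> (\<Sum>i<n'. C ^ (2 * 2 ^ i) * C ^ (2 * Suc (Suc (2 ^ i))))"
      "\<And>i. i < n' \<Longrightarrow> W + (((*v) L) ^^ i) ` W \<subseteq> W + T"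
      using cover_funpow_uniform[of n'] unfolding W_def by blast
    have cT: "card T \<le> c0" using T(2) unfolding c0_def by linarith
    have Wf: "finite W" "0 \<in> W" using fin ne by (auto simp: W_def finite_diff_set zero_in_diff_set)
    obtain a0 where a0: "a0 \<in> A" using ne by blast
    have "W + W \<subseteq> W + T" using T(3)[of 0] by (simp add: n'_def)
    moreover have "card T ^ I < card A" using asm(5) cT by (meson le_less_trans power_mono zero_le)
    moreover have AW: "(\<lambda>a. a - a0) ` A \<subseteq> W" using a0 by (auto simp: W_def diff_set_memI)
    ultimately obtain t where t: "t \<noteq> 0" "\<And>i. i \<le> I \<Longrightarrow> 2 ^ i *s t \<in> W + uminus ` W"
      using dyadic_pigeonhole[of W T A I a0] T(1) fin by blast
    have t2: "2 ^ i *s t \<in> W + W" if "i \<le> I" for i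
      using t(2)[OF that] by (simp add: W_def diff_set_uminus)
    have cTn: "card (nfold m T) \<le> (m + 1) ^ c0" for m
    proof -
      have "(m + 1) ^ card T \<le> (m + 1) ^ c0" using cT by (intro power_increasing) auto
      then show ?thesis using card_nfold_le_poly[OF T(1), of m] by linarith
    qed
    have "real (card (A + (*v) L ` A + multiples_upto I ((((*v) L) ^^ i) t)))
       \<le> C\<^sup>2 * real c0 * (2 * real I + 1) ^ c0 * real (card A)" if i: "i < n" for i
    proof -
      define M where "M = multiples_upto I ((((*v) L) ^^ i) t)"
      define V where "V = (((*v) L) ^^ i) ` W"
      have addi: "(((*v) L) ^^ i) (x + y) = (((*v) L) ^^ i) x + (((*v) L) ^^ i) y" for x y
        by (induction i) (simp_all add: matrix_int_add)
      have V: "V + V = (((*v) L) ^^ i) ` (W + W)"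
        unfolding V_def by (rule image_sumset[symmetric]) (rule addi)
      have "M \<subseteq> nfold I (V + V)" unfolding M_def
      proof (rule multiples_subset_nfold)
        have "0 + 0 \<in> W + W" using Wf by blast
        then have "(((*v) L) ^^ i) (0 *s 0) \<in> V + V" unfolding V by simp
        then show "0 \<in> V + V" by (simp only: funpow_matrix_scale) simp
        show "2 ^ i' *s (((*v) L) ^^ i) t \<in> V + V" if "i' < I" for i'
          unfolding V using t2[of i'] that by (auto simp: funpow_matrix_scale[symmetric])
      qed
      then have M: "M \<subseteq> nfold (2 * I) V" by (simp add: nfold_sumset mult_2 nfold_add)
      \<comment> \<open>Shifted by \<open>x0\<close>, the dilate sum lies in \<open>W + T\<close>.
        The progression \<open>M\<close> lies in \<open>nfold (2 * I) V\<close>, which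
        \<open>W\<close> absorbs at the price of \<open>nfold (2 * I) T\<close>.\<close>
      define x0 where "x0 = a0 + L *v a0"
      have "A + (*v) L ` A + {- x0} \<subseteq> W + (*v) L ` W"
      proof
        fix z assume "z \<in> A + (*v) L ` A + {- x0}"
        then obtain a b where ab: "a \<in> A" "b \<in> A" "z = a + L *v b + - x0" by (auto simp: set_plus_def)
        have "L *v ((b - a0) + a0) = L *v (b - a0) + L *v a0" by (rule matrix_int_add)
        then have "z = (a - a0) + L *v (b - a0)" using ab by (simp add: x0_def)
        then show "z \<in> W + (*v) L ` W" using ab AW by blast
      qed
      also have "\<dots> \<subseteq> W + T" using T(3)[of 1] by (simp add: n'_def)
      finally have Y: "A + (*v) L ` A + {- x0} \<subseteq> W + T" .
      have "A + (*v) L ` A + M + {- x0} = A + (*v) L ` A + {- x0} + M" by (simp only: ac_simps)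
      also have "\<dots> \<subseteq> (W + T) + nfold (2 * I) V" by (intro set_plus_mono2 Y M)
      also have "(W + T) + nfold (2 * I) V = (W + nfold (2 * I) V) + T" by (simp only: ac_simps)
      also have "\<dots> \<subseteq> (W + nfold (2 * I) T) + T"
        using T(3)[of i] i by (intro set_plus_mono2[OF sumset_nfold_absorb subset_refl]) (simp add: n'_def V_def)
      finally have "card (A + (*v) L ` A + M + {- x0}) \<le> card ((W + nfold (2 * I) T) + T)"
        using Wf T(1) by (intro card_mono finite_set_plus finite_nfold)
      then have "card (A + (*v) L ` A + M) \<le> card ((W + nfold (2 * I) T) + T)"
        by (simp only: card_plus_sing)
      also have "\<dots> \<le> card W * card (nfold (2 * I) T) * card T"
      proof (rule order.trans[OF card_sumset_le])
        show "card (W + nfold (2 * I) T) * card T \<le> card W * card (nfold (2 * I) T) * card T"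
          using Wf T(1) by (intro mult_right_mono card_sumset_le finite_nfold) auto
      qed (use Wf T(1) in \<open>auto intro!: finite_set_plus finite_nfold\<close>)
      also have "\<dots> \<le> card W * (2 * I + 1) ^ c0 * c0"
        using cT cTn[of "2 * I"] by (intro mult_mono) auto
      finally have "real (card (A + (*v) L ` A + M)) \<le> real (card W * (2 * I + 1) ^ c0 * c0)"
        by (simp only: of_nat_le_iff)
      also have "\<dots> = real (card W) * ((2 * real I + 1) ^ c0 * real c0)" by (simp add: add.commute)
      also have "\<dots> \<le> (C\<^sup>2 * real (card A)) * ((2 * real I + 1) ^ c0 * real c0)"
        using card_nfold_diff_set[of 1] by (intro mult_right_mono) (auto simp: W_def)
      finally show ?thesis by (simp add: M_def algebra_simps)
    qed
    then show ?thesis using t(1) by blast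
  qed
  have "2 \<le> c0" by (simp add: c0_def)
  then show ?thesis
    by (intro exI[of _ c0] conjI allI impI) (assumption, elim conjE, rule main, assumption+)
qed

section \<open>Krylov coordinates and invariant lattices\<close>

abbreviation (input) irreducible_mat :: "int^'n^'n \<Rightarrow> bool" where
  "irreducible_mat L \<equiv> \<not> (\<exists>W. nontrivial_invariant_subspace L W)"

definition rat_vec :: "int^'n \<Rightarrow> rat^'n" where
  "rat_vec v = (\<chi> i. of_int (v $ i))"

lemma rat_vec_nth [simp]: "rat_vec v $ i = of_int (v $ i)"
  by (simp add: rat_vec_def)

lemma rat_vec_add: "rat_vec (x + y) = rat_vec x + rat_vec y"
  by (simp add: vec_eq_iff)

lemma rat_vec_scale: "rat_vec (c *s x) = of_int c *s rat_vec x"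
  by (simp add: vec_eq_iff)

lemma rat_vec_eq_iff [simp]: "rat_vec x = rat_vec y \<longleftrightarrow> x = y"
  by (simp add: vec_eq_iff)

lemma rat_mat_vec: "rat_mat L *v rat_vec v = rat_vec (L *v v)"
  by (simp add: rat_mat_def matrix_vector_mult_def vec_eq_iff)

lemma det_of_int_mat:
  fixes L :: "int^'n^'n"
  shows "det (\<chi> i j. (of_int (L $ i $ j) :: 'a::comm_ring_1)) = of_int (det L)"
  by (simp add: det_def)

lemma inj_matrix_int:
  fixes L :: "int^'n^'n"
  assumes "det L \<noteq> 0"
  shows "inj ((*v) L)"
proof (rule injI)
  fix x y assume "L *v x = L *v y"
  then have "rat_mat L *v rat_vec x = rat_mat L *v rat_vec y" by (simp add: rat_mat_vec)
  moreover have "invertible (rat_mat L)"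
    using assms by (simp add: invertible_det_nz rat_mat_def det_of_int_mat)
  ultimately have "rat_vec x = rat_vec y" using inj_matrix_vector_mult by (meson injD)
  then show "x = y" by simp
qed

text \<open>At the first iterate of \<open>t\<close> that depends on its predecessors, the span of
  the predecessors is stable under \<open>L\<close>. It contains the non-zero vector
  \<open>t\<close>, so irreducibility makes it everything; dimension forces a dependence by index
  \<open>CARD('n)\<close>.\<close>

lemma krylov_span:
  fixes L :: "int^'n^'n"
  assumes irr: "irreducible_mat L" and t: "t \<noteq> 0"
  shows "vec.span ((\<lambda>i. rat_vec ((((*v) L) ^^ i) t)) ` {..<CARD('n)}) = UNIV"
proof -
  define v where "v i = rat_vec ((((*v) L) ^^ i) t)" for i
  have vS: "rat_mat L *v v i = v (Suc i)" for i by (simp add: v_def rat_mat_vec)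
  have "\<exists>j\<le>CARD('n). v j \<in> vec.span (v ` {..<j})"
  proof (rule ccontr)
    assume "\<not> ?thesis"
    then have no: "v j \<notin> vec.span (v ` {..<j})" if "j \<le> CARD('n)" for j using that by blast
    have "vec.independent (v ` {..<m}) \<and> card (v ` {..<m}) = m" if "m \<le> Suc CARD('n)" for m
      using that
    proof (induction m)
      case (Suc m)
      have "v m \<notin> vec.span (v ` {..<m})" using no Suc.prems by simp
      moreover from this have "v m \<notin> v ` {..<m}" by (meson vec.span_base)
      ultimately show ?case using Suc
        by (simp add: lessThan_Suc vec.independent_insertI)
    qed (simp add: vec.independent_empty)
    from this[of "Suc CARD('n)"] have "Suc CARD('n) \<le> vec.dim (UNIV :: (rat^'n) set)"
      using vec.independent_card_le_dim by (metis order_refl subset_UNIV)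
    then show False unfolding vec_dim_card by simp
  qed
  then obtain j where j: "j \<le> CARD('n)" "v j \<in> vec.span (v ` {..<j})" by blast
  define W where "W = vec.span (v ` {..<j})"
  have v0: "v 0 \<noteq> 0"
  proof
    assume "v 0 = 0"
    then have "rat_vec t = rat_vec 0" by (simp add: v_def vec_eq_iff)
    then show False using t by simp
  qed
  have "v 0 \<in> W" using j v0 by (cases "j = 0") (auto simp: W_def intro: vec.span_base)
  then have "W \<noteq> {0}" using v0 by blast
  moreover have "module.subspace (\<lambda>c (v::rat^'n). c *s v) W"
    unfolding W_def by (rule vec.subspace_span)
  moreover have "rat_mat L *v w \<in> W" if "w \<in> W" for w
  proof -
    have "rat_mat L *v w \<in> vec.span ((*v) (rat_mat L) ` v ` {..<j})"
      using that unfolding vec.span_image W_def by blast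
    also have "\<dots> \<subseteq> W" unfolding W_def
    proof (rule vec.span_minimal[OF _ vec.subspace_span], unfold image_image, rule image_subsetI)
      fix i assume i: "i \<in> {..<j}"
      show "rat_mat L *v v i \<in> vec.span (v ` {..<j})"
      proof (cases "Suc i = j")
        case False
        then show ?thesis using i unfolding vS by (intro vec.span_base imageI) auto
      qed (use j vS in simp)
    qed
    finally show ?thesis .
  qed
  ultimately have "W = UNIV" using irr unfolding nontrivial_invariant_subspace_def by blast
  moreover have "W \<subseteq> vec.span (v ` {..<CARD('n)})"
    unfolding W_def using j by (intro vec.span_mono image_mono) auto
  ultimately show ?thesis unfolding v_def by blast
qed

lemma common_denominator:
  fixes S :: "rat set"
  assumes "finite S"
  shows "\<exists>m::int>0. \<forall>q\<in>S. \<exists>b::int. of_int m * q = of_int b"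
  using assms
proof (induction S rule: finite_induct)
  case empty
  show ?case by (rule exI[of _ 1]) simp
next
  case (insert q S)
  then obtain m :: int where m: "m > 0" "\<forall>q\<in>S. \<exists>b::int. of_int m * q = of_int b" by blast
  obtain a b :: int where ab: "q = of_int a / of_int b" "b > 0"
    by (metis quotient_of_denom_pos quotient_of_div surj_pair)
  have "\<exists>c::int. of_int (m * b) * r = of_int c" if r: "r \<in> insert q S" for r
  proof (cases "r = q")
    case True
    then have "of_int (m * b) * r = of_int (m * a)" using ab by simp
    then show ?thesis by blast
  next
    case False
    then obtain c :: int where c: "of_int m * r = of_int c" using m r by blast
    have "of_int (m * b) * r = of_int b * (of_int m * r)" by simp
    also have "\<dots> = of_int (b * c)" unfolding c by simp
    finally show ?thesis by blast
  qed
  then show ?case using m ab by (intro exI[of _ "m * b"]) auto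
qed

text \<open>\<open>P\<close> has the iterates of \<open>t\<close> as columns, \<Phi> is its inverse,
  \<open>m\<close> clears the denominators of that inverse, and \<open>h\<close> enumerates the
  exponents by the index type. \<Phi> turns lines in the Krylov directions into axis-parallel ones,
  as \<open>discrete_brunn_minkowski\<close> requires; \<open>m\<close> shows that the iterates
  generate a subgroup of finite index.\<close>

lemma krylov_coordinates:
  fixes L :: "int^'n^'n"
  assumes irr: "irreducible_mat L" and t: "t \<noteq> 0"
  shows "\<exists>(\<Phi> :: int^'n \<Rightarrow> rat^'n) (h :: 'n \<Rightarrow> nat) (m :: int).
    (\<forall>x y. \<Phi> (x + y) = \<Phi> x + \<Phi> y) \<and> (\<forall>c x. \<Phi> (c *s x) = of_int c *s \<Phi> x) \<and> inj \<Phi> \<and>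
    (\<forall>i. h i < CARD('n)) \<and> (\<forall>i. \<Phi> ((((*v) L) ^^ h i) t) = axis i 1) \<and>
    m > 0 \<and> (\<forall>z. \<exists>c. m *s z = (\<Sum>i\<in>UNIV. c i *s (((*v) L) ^^ h i) t))"
proof -
  obtain h :: "'n \<Rightarrow> nat" where h: "bij_betw h UNIV {..<CARD('n)}"
    by (metis ex_bij_betw_finite_nat finite_class.finite_UNIV lessThan_atLeast0)
  define v where "v i = rat_vec ((((*v) L) ^^ i) t)" for i
  define P where "P = (\<chi> r i. v (h i) $ r)"
  have colP: "column i P = v (h i)" for i by (simp add: P_def column_def vec_eq_iff)
  have "columns P = v ` range h" unfolding columns_def colP by blast
  then have "columns P = v ` {..<CARD('n)}" using h by (simp add: bij_betw_def)
  then have "vec.span (columns P) = UNIV" using krylov_span[OF irr t] by (simp add: v_def)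
  then obtain B where PB: "P ** B = mat 1" using matrix_right_invertible_span_columns by blast
  then have BP: "B ** P = mat 1" by (simp add: matrix_left_right_inverse)
  define \<Phi> where "\<Phi> z = B *v rat_vec z" for z
  have inv: "P *v \<Phi> z = rat_vec z" for z
    by (simp add: \<Phi>_def matrix_vector_mul_assoc PB)
  have hlt: "h i < CARD('n)" for i using h by (auto simp: bij_betw_def)
  have unit: "\<Phi> ((((*v) L) ^^ h i) t) = axis i 1" for i
  proof -
    have "\<Phi> ((((*v) L) ^^ h i) t) = B *v column i P" by (simp add: \<Phi>_def colP v_def)
    then have "\<Phi> ((((*v) L) ^^ h i) t) $ j = (B ** P) $ j $ i" for j
      by (simp add: matrix_vector_mult_def matrix_matrix_mult_def column_def)
    then show ?thesis by (simp add: BP mat_def axis_def vec_eq_iff)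
  qed
  have "finite (range (\<lambda>(i, j). B $ i $ j))" by simp
  then obtain m :: int where m: "m > 0" "\<forall>q\<in>range (\<lambda>(i, j). B $ i $ j). \<exists>b::int. of_int m * q = of_int b"
    using common_denominator by metis
  then have "\<exists>b::int. of_int m * (B $ i $ j) = of_int b" for i j by force
  then obtain b where b: "\<And>i j. of_int m * (B $ i $ j) = of_int (b i j)" by metis
  have "\<exists>c. m *s z = (\<Sum>i\<in>UNIV. c i *s (((*v) L) ^^ h i) t)" for z
  proof -
    define c where "c i = (\<Sum>j\<in>UNIV. b i j * z $ j)" for i
    have c: "of_int (c i) = of_int m * \<Phi> z $ i" for i
      unfolding c_def \<Phi>_def matrix_vector_mult_def
      by (simp add: sum_distrib_left b[symmetric] mult.assoc)
    have "rat_vec (m *s z) = rat_vec (\<Sum>i\<in>UNIV. c i *s (((*v) L) ^^ h i) t)"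
    proof -
      have "rat_vec (m *s z) $ r = rat_vec (\<Sum>i\<in>UNIV. c i *s (((*v) L) ^^ h i) t) $ r" for r
      proof -
        have "rat_vec (m *s z) $ r = of_int m * (P *v \<Phi> z) $ r" unfolding inv by simp
        also have "\<dots> = (\<Sum>i\<in>UNIV. of_int m * (P $ r $ i * \<Phi> z $ i))"
          by (simp add: matrix_vector_mult_def sum_distrib_left)
        also have "\<dots> = (\<Sum>i\<in>UNIV. of_int (c i) * P $ r $ i)"
          by (intro sum.cong refl) (simp add: c)
        also have "\<dots> = rat_vec (\<Sum>i\<in>UNIV. c i *s (((*v) L) ^^ h i) t) $ r"
          by (simp add: P_def v_def sum_component)
        finally show ?thesis .
      qed
      then show ?thesis by (rule vec_eq_iff[THEN iffD2, OF allI])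
    qed
    then show ?thesis unfolding rat_vec_eq_iff by blast
  qed
  moreover have "inj \<Phi>" using inv by (metis injI rat_vec_eq_iff)
  moreover have "\<Phi> (x + y) = \<Phi> x + \<Phi> y" for x y
    by (simp add: \<Phi>_def rat_vec_add matrix_vector_right_distrib)
  moreover have "\<Phi> (c *s x) = of_int c *s \<Phi> x" for c x
    by (simp add: \<Phi>_def rat_vec_scale vec.scale)
  ultimately show ?thesis
    using hlt unit m(1) by (intro exI[of _ \<Phi>] exI[of _ h] exI[of _ m] conjI allI)
qed

text \<open>A subgroup stable under \<open>L\<close>. Its rank is not prescribed: for irreducible
  \<open>L\<close> one non-zero element already forces finite index, by
  \<open>invariant_lattice_finite_index\<close>.\<close>

definition invariant_lattice :: "int^'n^'n \<Rightarrow> (int^'n) set \<Rightarrow> bool" where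
  "invariant_lattice L S \<longleftrightarrow> 0 \<in> S \<and> (\<forall>x\<in>S. \<forall>y\<in>S. x - y \<in> S) \<and> (\<forall>x\<in>S. L *v x \<in> S)"

lemma invariant_latticeD:
  assumes "invariant_lattice L S"
  shows "0 \<in> S" "x \<in> S \<Longrightarrow> y \<in> S \<Longrightarrow> x - y \<in> S" "x \<in> S \<Longrightarrow> L *v x \<in> S"
    "x \<in> S \<Longrightarrow> - x \<in> S" "x \<in> S \<Longrightarrow> y \<in> S \<Longrightarrow> x + y \<in> S"
proof -
  show *: "0 \<in> S" "x \<in> S \<Longrightarrow> y \<in> S \<Longrightarrow> x - y \<in> S" "x \<in> S \<Longrightarrow> L *v x \<in> S" for x y
    using assms by (auto simp: invariant_lattice_def)
  show n: "x \<in> S \<Longrightarrow> - x \<in> S" for x using *(2)[of 0 x] *(1) by simp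
  show "x \<in> S \<Longrightarrow> y \<in> S \<Longrightarrow> x + y \<in> S" using *(2)[of x "- y"] n by simp
qed

lemma invariant_lattice_scale:
  assumes S: "invariant_lattice L S" and x: "x \<in> S"
  shows "c *s x \<in> S"
proof -
  have nat: "int n *s x \<in> S" for n
  proof (induction n)
    case (Suc n)
    have "int (Suc n) *s x = x + int n *s x" by (simp add: vec_eq_iff algebra_simps)
    then show ?case using Suc invariant_latticeD(5)[OF S x] by simp
  qed (use invariant_latticeD(1)[OF S] in simp)
  show ?thesis
  proof (cases "c \<ge> 0")
    case True
    then show ?thesis using nat[of "nat c"] by simp
  next
    case False
    then have "c *s x = - (int (nat (- c)) *s x)" by (simp add: vec_eq_iff)
    then show ?thesis using nat invariant_latticeD(4)[OF S] by metis
  qed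
qed

lemma invariant_lattice_finite_index:
  fixes L :: "int^'n^'n"
  assumes irr: "irreducible_mat L" and S: "invariant_lattice L S" and t: "t \<in> S" "t \<noteq> 0"
  obtains m :: int where "m > 0" "\<And>z. m *s z \<in> S"
proof -
  obtain h :: "'n \<Rightarrow> nat" and m :: int where
    m: "m > 0" "\<forall>z. \<exists>c. m *s z = (\<Sum>i\<in>UNIV. c i *s (((*v) L) ^^ h i) t)"
    using krylov_coordinates[OF irr t(2)] by (elim exE conjE) (rule that)
  have p: "(((*v) L) ^^ i) t \<in> S" for i
    by (induction i) (use t invariant_latticeD(3)[OF S] in auto)
  have sum: "sum f I \<in> S" if "\<And>i. i \<in> I \<Longrightarrow> f i \<in> S" "finite I" for f and I :: "'n set"
    using that(2,1) by (induction I rule: finite_induct) (auto intro: invariant_latticeD[OF S])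
  have "m *s z \<in> S" for z
  proof -
    obtain c where c: "m *s z = (\<Sum>i\<in>UNIV. c i *s (((*v) L) ^^ h i) t)" using m(2) by blast
    show ?thesis unfolding c by (intro sum invariant_lattice_scale[OF S] p) simp
  qed
  then show ?thesis using that m(1) by blast
qed

lemma invariant_lattice_image:
  assumes "invariant_lattice L S"
  shows "invariant_lattice L ((*v) L ` S)"
proof -
  have d: "L *v x - L *v y = L *v (x - y)" for x y
    using matrix_int_add[of L "x - y" y] by simp
  have z: "L *v 0 = 0" using matrix_int_add[of L 0 0] by simp
  show ?thesis unfolding invariant_lattice_def
  proof (intro conjI ballI)
    show "0 \<in> (*v) L ` S" using imageI[OF invariant_latticeD(1)[OF assms], of "(*v) L"] z by simp
  next
    fix x y assume "x \<in> (*v) L ` S" "y \<in> (*v) L ` S"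
    then obtain u w where "x = L *v u" "y = L *v w" "u \<in> S" "w \<in> S" by blast
    then show "x - y \<in> (*v) L ` S" unfolding d using invariant_latticeD(2)[OF assms] d by blast
  next
    fix x assume "x \<in> (*v) L ` S"
    then have "x \<in> S" using invariant_latticeD(3)[OF assms] by blast
    then show "L *v x \<in> (*v) L ` S" by blast
  qed
qed

text \<open>Representatives of the cosets of \<open>H\<close> in \<open>K\<close>; finiteness makes
  \<open>card R\<close> the index.\<close>

definition transversal :: "'a::ab_group_add set \<Rightarrow> 'a set \<Rightarrow> 'a set \<Rightarrow> bool" where
  "transversal K H R \<longleftrightarrow> finite R \<and> R \<subseteq> K \<and> (\<forall>x\<in>K. \<exists>!r. r \<in> R \<and> x - r \<in> H)"

lemma finite_int_box: "finite {z :: int^'n. \<forall>i. 0 \<le> z $ i \<and> z $ i < m}"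
proof -
  have "{z :: int^'n. \<forall>i. 0 \<le> z $ i \<and> z $ i < m} \<subseteq> vec_lambda ` (UNIV \<rightarrow>\<^sub>E {0..<m})"
  proof
    fix z :: "int^'n" assume "z \<in> {z. \<forall>i. 0 \<le> z $ i \<and> z $ i < m}"
    then have "vec_nth z \<in> UNIV \<rightarrow>\<^sub>E {0..<m}" by auto
    then show "z \<in> vec_lambda ` (UNIV \<rightarrow>\<^sub>E {0..<m})" by (metis image_eqI vec_nth_inverse)
  qed
  then show ?thesis by (rule finite_subset) (intro finite_imageI finite_PiE, simp_all)
qed

text \<open>\<open>H\<close> contains \<open>m\<close> times every vector, so reducing coordinates
  modulo \<open>m\<close> moves each point into a finite box without changing its coset.\<close>

lemma transversal_exists:
  fixes K H :: "(int^'n) set"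
  assumes "invariant_lattice L K" and H: "invariant_lattice L' H" and HK: "H \<subseteq> K"
    and m: "m > 0" "\<And>z. m *s z \<in> H"
  shows "\<exists>R. transversal K H R"
proof -
  \<comment> \<open>Congruent points have the same defining predicate, so \<open>SOME\<close> picks
    the same representative on a whole coset.\<close>
  define rep where "rep x = (SOME y. y \<in> K \<and> x - y \<in> H)" for x
  have rep: "rep x \<in> K \<and> x - rep x \<in> H" if "x \<in> K" for x
    unfolding rep_def by (rule someI[of _ x]) (use that invariant_latticeD(1)[OF H] in simp)
  have tr: "x - z \<in> H" if "x - y \<in> H" "y - z \<in> H" for x y z
    using invariant_latticeD(5)[OF H that] by simp
  have sy: "y - x \<in> H" if "x - y \<in> H" for x y
    using invariant_latticeD(4)[OF H that] by simp
  have cong: "rep x = rep y" if "x - y \<in> H" for x y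
  proof -
    have "(x - w \<in> H) = (y - w \<in> H)" for w using tr sy that by metis
    then show ?thesis by (simp add: rep_def)
  qed
  have "rep ` K \<subseteq> rep ` {z. \<forall>i. 0 \<le> z $ i \<and> z $ i < m}"
  proof
    fix r assume "r \<in> rep ` K"
    then obtain x where x: "r = rep x" by blast
    define y :: "int^'n" where "y = (\<chi> i. x $ i mod m)"
    have "x - y = m *s (\<chi> i. x $ i div m)"
      by (simp add: y_def vec_eq_iff minus_mod_eq_mult_div)
    then have "x - y \<in> H" using m(2) by simp
    then have "rep x = rep y" by (rule cong)
    moreover have "y \<in> {z. \<forall>i. 0 \<le> z $ i \<and> z $ i < m}" using m by (simp add: y_def)
    ultimately show "r \<in> rep ` {z. \<forall>i. 0 \<le> z $ i \<and> z $ i < m}" using x by blast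
  qed
  then have "finite (rep ` K)" by (rule finite_subset[OF _ finite_imageI[OF finite_int_box]])
  moreover have "\<exists>!r. r \<in> rep ` K \<and> x - r \<in> H" if x: "x \<in> K" for x
  proof (rule ex1I[of _ "rep x"])
    show "rep x \<in> rep ` K \<and> x - rep x \<in> H" using x rep by blast
    fix r assume r: "r \<in> rep ` K \<and> x - r \<in> H"
    then obtain y where y: "y \<in> K" "r = rep y" by blast
    then have "x - y \<in> H" using r tr[of x r y] sy[of y r] rep[OF y(1)] by simp
    then have "rep x = rep y" by (rule cong)
    then show "r = rep x" using y by simp
  qed
  moreover have "rep ` K \<subseteq> K" using rep by blast
  ultimately show ?thesis unfolding transversal_def by (intro exI[of _ "rep ` K"] conjI ballI)
qed

section \<open>The index of the image of an invariant lattice\<close>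

text \<open>A Borel tile whose translates by \<Gamma> partition the space; comparing volumes of
  tiles will turn a lattice index into a determinant.\<close>

definition fundamental_domain :: "'a::euclidean_space set \<Rightarrow> 'a set \<Rightarrow> bool" where
  "fundamental_domain \<Gamma> S \<longleftrightarrow> S \<in> sets borel \<and> (\<forall>x. \<exists>!g. g \<in> \<Gamma> \<and> x - g \<in> S)"

lemma emeasure_lborel_vimage_plus:
  fixes c :: "'a::euclidean_space"
  assumes "S \<in> sets borel"
  shows "emeasure lborel {x. c + x \<in> S} = emeasure lborel S"
proof -
  have "emeasure lborel S = emeasure (distr lborel borel ((+) c)) S"
    by (simp add: lborel_distr_plus)
  also have "\<dots> = emeasure lborel ((+) c -` S \<inter> space lborel)"
    using assms by (intro emeasure_distr) auto
  finally show ?thesis by (simp add: vimage_def)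
qed

lemma fundamental_domain_decomposition:
  fixes \<Gamma> :: "'a::euclidean_space set"
  assumes "countable \<Gamma>" and S: "S \<in> sets borel" and T: "fundamental_domain \<Gamma> T"
  shows "emeasure lborel S = (\<integral>\<^sup>+g. emeasure lborel {x. x \<in> S \<and> x - g \<in> T} \<partial>count_space \<Gamma>)"
proof -
  have m: "{x. x \<in> S \<and> x - g \<in> T} \<in> sets lborel" for g
  proof -
    have "(\<lambda>x. x - g) -` T \<inter> space borel \<in> sets borel"
      using T by (intro measurable_sets[of _ borel borel]) (auto simp: fundamental_domain_def)
    then have "S \<inter> ((\<lambda>x. x - g) -` T) \<in> sets borel" using S by auto
    then show ?thesis by (simp add: vimage_def Int_def)
  qed
  have "S = (\<Union>g\<in>\<Gamma>. {x. x \<in> S \<and> x - g \<in> T})"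
    using T unfolding fundamental_domain_def by blast
  then have "emeasure lborel S = emeasure lborel (\<Union>g\<in>\<Gamma>. {x. x \<in> S \<and> x - g \<in> T})" by simp
  also have "\<dots> = (\<integral>\<^sup>+g. emeasure lborel {x. x \<in> S \<and> x - g \<in> T} \<partial>count_space \<Gamma>)"
  proof (rule emeasure_UN_countable)
    show "disjoint_family_on (\<lambda>g. {x. x \<in> S \<and> x - g \<in> T}) \<Gamma>"
      using T unfolding fundamental_domain_def disjoint_family_on_def by blast
  qed (use m assms in auto)
  finally show ?thesis .
qed

text \<open>Cut \<open>S\<close> along the translates of \<open>T\<close>; moving every piece back
  by its lattice vector cuts \<open>T\<close> along the translates of \<open>S\<close>, and negation
  matches the two families of pieces.\<close>

lemma fundamental_domain_emeasure_eq:
  fixes \<Gamma> :: "'a::euclidean_space set"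
  assumes cnt: "countable \<Gamma>" and neg: "\<And>g. g \<in> \<Gamma> \<Longrightarrow> - g \<in> \<Gamma>"
    and S: "fundamental_domain \<Gamma> S" and T: "fundamental_domain \<Gamma> T"
  shows "emeasure lborel S = emeasure lborel T"
proof -
  have SB: "S \<in> sets borel" "T \<in> sets borel" using S T by (auto simp: fundamental_domain_def)
  have "emeasure lborel S = (\<integral>\<^sup>+g. emeasure lborel {x. x \<in> S \<and> x - g \<in> T} \<partial>count_space \<Gamma>)"
    by (rule fundamental_domain_decomposition[OF cnt SB(1) T])
  also have "\<dots> = (\<integral>\<^sup>+g. emeasure lborel {x. x \<in> S \<and> x - (- g) \<in> T} \<partial>count_space \<Gamma>)"
    using neg by (intro nn_integral_bij_count_space[symmetric, where g = uminus] bij_betw_byWitness[where f' = uminus]) auto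
  also have "\<dots> = (\<integral>\<^sup>+g. emeasure lborel {x. x \<in> T \<and> x - g \<in> S} \<partial>count_space \<Gamma>)"
  proof (rule nn_integral_cong)
    fix g
    have "(\<lambda>x. x - g) -` S \<inter> space borel \<in> sets borel"
      using SB by (intro measurable_sets[of _ borel borel]) auto
    then have "T \<inter> ((\<lambda>x. x - g) -` S) \<in> sets borel" using SB by auto
    then have "{x. x \<in> T \<and> x - g \<in> S} \<in> sets borel" by (simp add: vimage_def Int_def)
    from emeasure_lborel_vimage_plus[OF this, of g]
    show "emeasure lborel {x. x \<in> S \<and> x - (- g) \<in> T} = emeasure lborel {x. x \<in> T \<and> x - g \<in> S}"
      by (simp add: add.commute conj_commute)
  qed
  also have "\<dots> = emeasure lborel T"
    by (rule fundamental_domain_decomposition[OF cnt SB(2) S, symmetric])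
  finally show ?thesis .
qed

section \<open>Volumes of unions of unit cubes and of linear images\<close>

definition real_vec :: "int^'n \<Rightarrow> real^'n" where
  "real_vec z = (\<chi> i. of_int (z $ i))"

definition floor_vec :: "real^'n \<Rightarrow> int^'n" where
  "floor_vec x = (\<chi> i. \<lfloor>x $ i\<rfloor>)"

lemma floor_vec_minus: "floor_vec (x - real_vec g) = floor_vec x - g"
  by (simp add: floor_vec_def real_vec_def vec_eq_iff)

lemma real_vec_uminus: "real_vec (- x) = - real_vec x"
  by (simp add: real_vec_def vec_eq_iff)

lemma emeasure_floor_vec_eq:
  fixes r :: "int^'n"
  shows "{x. floor_vec x = r} \<in> sets borel \<and> emeasure lborel {x. floor_vec x = r} = 1"
proof -
  let ?F = "{x. floor_vec x = r}"
  have eq: "?F = (\<Inter>i\<in>UNIV. {x. of_int (r $ i) \<le> x $ i} \<inter> {x. x $ i < of_int (r $ i) + 1})"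
    by (auto simp: floor_vec_def vec_eq_iff floor_eq_iff)
  have meas: "?F \<in> sets borel"
    unfolding eq
  proof (intro sets.finite_INT sets.Int)
    show "{x :: real^'n. of_int (r $ i) \<le> x $ i} \<in> sets borel" for i
      by (intro borel_closed closed_Collect_le continuous_intros)
    show "{x :: real^'n. x $ i < of_int (r $ i) + 1} \<in> sets borel" for i
      by (intro borel_open open_Collect_less continuous_intros)
  qed auto
  define a where "a = real_vec r"
  define b where "b = real_vec r + (\<chi> i. 1)"
  have ab: "box a b \<subseteq> ?F" "?F \<subseteq> cbox a b"
    unfolding eq by (auto simp: a_def b_def real_vec_def mem_box_cart less_imp_le)
  have "a \<in> cbox a b" by (simp add: a_def b_def mem_box_cart)
  then have "measure lborel (cbox a b) = 1"
    by (subst content_cbox_cart) (auto simp: a_def b_def)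
  then have c1: "emeasure lborel (cbox a b) = 1"
    using emeasure_lborel_cbox_finite[of a b] by (simp add: emeasure_eq_ennreal_measure)
  have "emeasure lborel (box a b) = emeasure lborel (cbox a b)"
    by (simp add: emeasure_lborel_cbox_eq emeasure_lborel_box_eq)
  then have "1 \<le> emeasure lborel ?F" "emeasure lborel ?F \<le> 1"
    using emeasure_mono[OF ab(1), of lborel] emeasure_mono[OF ab(2), of lborel] meas c1 by auto
  then show ?thesis using meas by (auto intro: antisym)
qed

lemma emeasure_floor_vec_in:
  fixes F :: "(int^'n) set"
  assumes "finite F"
  shows "{x. floor_vec x \<in> F} \<in> sets borel \<and> emeasure lborel {x. floor_vec x \<in> F} = of_nat (card F)"
proof -
  have eq: "{x. floor_vec x \<in> F} = (\<Union>r\<in>F. {x. floor_vec x = r})" by auto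
  have meas: "{x. floor_vec x = r} \<in> sets borel" for r :: "int^'n" using emeasure_floor_vec_eq by blast
  have "emeasure lborel (\<Union>r\<in>F. {x. floor_vec x = r}) = (\<Sum>r\<in>F. emeasure lborel {x. floor_vec x = r})"
    using assms meas by (intro sum_emeasure[symmetric]) (auto simp: disjoint_family_on_def)
  also have "\<dots> = of_nat (card F)" by (simp add: emeasure_floor_vec_eq)
  finally show ?thesis unfolding eq using assms meas by auto
qed

lemma fundamental_domain_floor_vec:
  fixes \<Lambda> :: "(int^'n) set"
  assumes "finite F" and F: "\<And>z. \<exists>!g. g \<in> \<Lambda> \<and> z - g \<in> F"
  shows "fundamental_domain (real_vec ` \<Lambda>) {x. floor_vec x \<in> F}"
  unfolding fundamental_domain_def
proof (intro conjI allI)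
  show "{x. floor_vec x \<in> F} \<in> sets borel" using emeasure_floor_vec_in[OF assms(1)] by blast
  fix x :: "real^'n"
  have "\<exists>g. g \<in> \<Lambda> \<and> floor_vec x - g \<in> F \<and> (\<forall>g'. g' \<in> \<Lambda> \<and> floor_vec x - g' \<in> F \<longrightarrow> g' = g)"
    using F[of "floor_vec x"] unfolding Ex1_def by simp
  then obtain g where g: "g \<in> \<Lambda>" "floor_vec x - g \<in> F" "\<forall>g'. g' \<in> \<Lambda> \<and> floor_vec x - g' \<in> F \<longrightarrow> g' = g"
    by (elim exE conjE)
  show "\<exists>!g. g \<in> real_vec ` \<Lambda> \<and> x - g \<in> {x. floor_vec x \<in> F}"
  proof (rule ex1I[of _ "real_vec g"])
    show "real_vec g \<in> real_vec ` \<Lambda> \<and> x - real_vec g \<in> {x. floor_vec x \<in> F}"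
      using g(1,2) by (simp add: floor_vec_minus)
    fix h assume "h \<in> real_vec ` \<Lambda> \<and> x - h \<in> {x. floor_vec x \<in> F}"
    then obtain g' where g': "g' \<in> \<Lambda>" "h = real_vec g'" "floor_vec (x - real_vec g') \<in> F" by blast
    have "floor_vec x - g' \<in> F" using g'(3) by (simp add: floor_vec_minus)
    then have "g' = g" using g(3) g'(1) by blast
    then show "h = real_vec g" using g'(2) by simp
  qed
qed

text \<open>The claim is multiplicative in the matrix, so elementary matrices suffice, and
  \<open>PI\<close> reduces a generator to boxes. The predicate \<open>P\<close> includes
  measurability of images so that products can be chained, and the condition on \<open>det M\<close>
  makes the zero-row case vacuous.\<close>

lemma measure_matrix_image:
  fixes M :: "real^'n^'n"
  assumes "det M \<noteq> 0" "S \<in> lmeasurable"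
  shows "measure lebesgue ((*v) M ` S) = \<bar>det M\<bar> * measure lebesgue S"
proof -
  define P where "P M \<longleftrightarrow> (det M \<noteq> 0 \<longrightarrow> (\<forall>S\<in>lmeasurable. (*v) M ` S \<in> lmeasurable \<and>
    measure lebesgue ((*v) M ` S) = \<bar>det M\<bar> * measure lebesgue S))" for M :: "real^'n^'n"
  have PI: "P M" if "\<And>a b. cbox a b \<noteq> {} \<Longrightarrow> measure lebesgue ((*v) M ` cbox a b) = \<bar>det M\<bar> * measure lebesgue (cbox a b)" for M
  proof -
    have "measure lebesgue ((*v) M ` cbox a b) = \<bar>det M\<bar> * measure lebesgue (cbox a b)" for a b
      using that by (cases "cbox a b = {}") auto
    note im = this
    show ?thesis unfolding P_def
    proof (intro impI ballI)
      fix S :: "(real^'n) set" assume "S \<in> lmeasurable"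
      from measure_linear_sufficient[OF matrix_vector_mul_linear[of M] this im]
      show "(*v) M ` S \<in> lmeasurable \<and> measure lebesgue ((*v) M ` S) = \<bar>det M\<bar> * measure lebesgue S"
        by simp
    qed
  qed
  have "P M"
  proof (induction M rule: induct_matrix_elementary_alt)
    case (1 A B)
    show ?case unfolding P_def
    proof (intro impI ballI)
      fix S :: "(real^'n) set" assume d: "det (A ** B) \<noteq> 0" and S: "S \<in> lmeasurable"
      have AB: "det A \<noteq> 0" "det B \<noteq> 0" using d by (auto simp: det_mul)
      have im: "(*v) (A ** B) ` S = (*v) A ` (*v) B ` S"
        by (simp add: image_image matrix_vector_mul_assoc)
      have B: "(*v) B ` S \<in> lmeasurable" "measure lebesgue ((*v) B ` S) = \<bar>det B\<bar> * measure lebesgue S"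
        using 1(2) AB S by (auto simp: P_def)
      show "(*v) (A ** B) ` S \<in> lmeasurable \<and>
        measure lebesgue ((*v) (A ** B) ` S) = \<bar>det (A ** B)\<bar> * measure lebesgue S"
        using 1(1) AB B unfolding im P_def by (simp add: det_mul abs_mult)
    qed
  next
    case (2 A i)
    then show ?case by (simp add: P_def det_zero_row)
  next
    case (3 A)
    have "(*v) A = (\<lambda>x. \<chi> k. A $ k $ k * x $ k)"
    proof
      fix x :: "real^'n"
      have "(\<Sum>j\<in>UNIV. A $ k $ j * x $ j) = (\<Sum>j\<in>UNIV. if j = k then A $ k $ k * x $ k else 0)" for k
        using 3 by (intro sum.cong) auto
      then show "A *v x = (\<chi> k. A $ k $ k * x $ k)" by (simp add: matrix_vector_mult_def vec_eq_iff)
    qed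
    then show ?case using 3 by (simp add: P_def measurable_stretch measure_stretch det_diagonal)
  next
    case (4 m n)
    let ?\<tau> = "Transposition.transpose m n"
    let ?M = "(\<chi> i j. mat 1 $ i $ ?\<tau> j) :: real^'n^'n"
    have perm: "?\<tau> permutes UNIV" by (simp add: permutes_swap_id)
    have det1: "\<bar>det ?M\<bar> = 1" using 4 by (simp add: det_permute_columns[OF perm] sign_swap_id)
    have act: "?M *v x = (\<chi> i. x $ ?\<tau> i)" for x :: "real^'n"
    proof -
      have "(\<Sum>j\<in>UNIV. mat 1 $ i $ ?\<tau> j * x $ j) = (\<Sum>j\<in>UNIV. if j = ?\<tau> i then x $ j else 0)" for i
        by (intro sum.cong refl) (auto simp: mat_def transpose_eq_iff)
      then show ?thesis by (simp add: matrix_vector_mult_def vec_eq_iff)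
    qed
    show ?case
    proof (rule PI)
      fix a b :: "real^'n" assume ne: "cbox a b \<noteq> {}"
      have eq: "(*v) ?M ` cbox a b = cbox (?M *v a) (?M *v b)"
      proof -
        have invol: "?M *v (?M *v x) = x" for x by (simp add: act vec_eq_iff)
        have mem: "?M *v x \<in> cbox (?M *v a) (?M *v b) \<longleftrightarrow> x \<in> cbox a b" for x
          unfolding act mem_box_cart by simp (metis transpose_involutory)
        show ?thesis
        proof
          show "(*v) ?M ` cbox a b \<subseteq> cbox (?M *v a) (?M *v b)" using mem by blast
          show "cbox (?M *v a) (?M *v b) \<subseteq> (*v) ?M ` cbox a b"
          proof
            fix y assume "y \<in> cbox (?M *v a) (?M *v b)"
            then have "?M *v (?M *v y) \<in> cbox (?M *v a) (?M *v b)" by (simp only: invol)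
            then have "?M *v y \<in> cbox a b" by (simp only: mem)
            then show "y \<in> (*v) ?M ` cbox a b" using imageI[of "?M *v y" "cbox a b" "(*v) ?M"] by (simp only: invol)
          qed
        qed
      qed
      have "cbox (?M *v a) (?M *v b) \<noteq> {}" using ne eq by blast
      then have "measure lebesgue (cbox (?M *v a) (?M *v b)) = (\<Prod>i\<in>UNIV. b $ ?\<tau> i - a $ ?\<tau> i)"
        by (simp add: content_cbox_cart act)
      also have "\<dots> = (\<Prod>i\<in>UNIV. b $ i - a $ i)"
        using prod.permute[OF perm, of "\<lambda>i. b $ i - a $ i"] by (simp add: o_def)
      finally show "measure lebesgue ((*v) ?M ` cbox a b) = \<bar>det ?M\<bar> * measure lebesgue (cbox a b)"
        using ne by (simp add: eq det1 content_cbox_cart)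
    qed
  next
    case (5 m n)
    let ?M = "(\<chi> i j. of_bool (i = m \<and> j = n \<or> i = j)) :: real^'n^'n"
    have "?M = (\<chi> k. if k = m then row m (mat 1) + 1 *s row n (mat 1) else row k (mat 1))"
      using 5 by (auto simp: vec_eq_iff row_def mat_def)
    then have det1: "det ?M = 1" using 5 by (simp add: det_row_operation del: vector_smult_lid)
    have act: "(*v) ?M = (\<lambda>x. \<chi> i. if i = m then x $ m + x $ n else x $ i)"
    proof
      fix x :: "real^'n"
      have "(\<Sum>j\<in>UNIV. of_bool (i = m \<and> j = n \<or> i = j) * x $ j) =
        (\<Sum>j\<in>UNIV. (if j = i then x $ j else 0) + (if j = n then (if i = m then x $ n else 0) else 0))" for i
        using 5 by (intro sum.cong) auto
      then show "?M *v x = (\<chi> i. if i = m then x $ m + x $ n else x $ i)"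
        by (simp add: matrix_vector_mult_def vec_eq_iff sum.distrib)
    qed
    show ?case
    proof (rule PI)
      fix a b :: "real^'n" assume ne: "cbox a b \<noteq> {}"
      \<comment> \<open>\<open>measure_shear_interval\<close> asks for a non-negative lower end in
        coordinate \<open>n\<close>; the translation by \<open>w\<close> moves that end to
        0.\<close>
      define w where "w = axis n (a $ n)"
      have ab: "cbox a b = (+) w ` cbox (a - w) (b - w)"
        by (simp add: cbox_translation[symmetric])
      have "(*v) ?M ` cbox a b = (+) (?M *v w) ` (*v) ?M ` cbox (a - w) (b - w)"
        unfolding ab by (simp add: image_image matrix_vector_right_distrib)
      then have "measure lebesgue ((*v) ?M ` cbox a b) = measure lebesgue ((*v) ?M ` cbox (a - w) (b - w))"
        by (simp only: measure_translation)
      also have "\<dots> = measure lebesgue (cbox (a - w) (b - w))"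
        unfolding act using 5 ne ab by (intro measure_shear_interval) (auto simp: w_def axis_def)
      also have "\<dots> = measure lebesgue (cbox a b)"
        unfolding ab by (simp only: measure_translation)
      finally show "measure lebesgue ((*v) ?M ` cbox a b) = \<bar>det ?M\<bar> * measure lebesgue (cbox a b)"
        by (simp only: det1 abs_one mult_1)
    qed
  qed
  then show ?thesis using assms by (simp add: P_def)
qed

lemma fundamental_domain_linear_image:
  fixes M :: "real^'n^'n"
  assumes S: "fundamental_domain \<Gamma> S" and M: "invertible M"
  shows "fundamental_domain ((*v) M ` \<Gamma>) ((*v) M ` S)"
  unfolding fundamental_domain_def
proof (intro conjI allI)
  obtain B where B: "M ** B = mat 1" "B ** M = mat 1" using M by (auto simp: invertible_def)
  have inv: "M *v (B *v x) = x" "B *v (M *v x) = x" for x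
    by (simp_all add: matrix_vector_mul_assoc B)
  have eq: "(*v) M ` S = (*v) B -` S \<inter> space borel" using inv by (auto simp: image_iff) metis
  show "(*v) M ` S \<in> sets borel" unfolding eq
    using S by (intro measurable_sets[of _ borel borel] borel_measurable_continuous_onI)
      (auto simp: fundamental_domain_def intro!: continuous_intros)
  fix x
  obtain g where g: "g \<in> \<Gamma>" "B *v x - g \<in> S" "\<And>g'. g' \<in> \<Gamma> \<Longrightarrow> B *v x - g' \<in> S \<Longrightarrow> g' = g"
    using S unfolding fundamental_domain_def by blast
  have sub: "x - M *v g' = M *v (B *v x - g')" for g'
    by (simp add: matrix_vector_mult_diff_distrib inv)
  show "\<exists>!h. h \<in> (*v) M ` \<Gamma> \<and> x - h \<in> (*v) M ` S"
  proof (rule ex1I[of _ "M *v g"])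
    show "M *v g \<in> (*v) M ` \<Gamma> \<and> x - M *v g \<in> (*v) M ` S" using g sub by blast
    fix h assume h: "h \<in> (*v) M ` \<Gamma> \<and> x - h \<in> (*v) M ` S"
    then obtain g' s where gs: "g' \<in> \<Gamma>" "h = M *v g'" "s \<in> S" "x - h = M *v s" by blast
    then have "M *v (B *v x - g') = M *v s" using sub by simp
    then have "B *v x - g' = s" using inv(2) by metis
    then show "h = M *v g" using g(3) gs by blast
  qed
qed

lemma transversal_shift:
  assumes "transversal UNIV H R"
  shows "\<exists>!g. g \<in> H \<and> z - g \<in> R"
proof -
  obtain r where r: "r \<in> R" "z - r \<in> H" "\<And>r'. r' \<in> R \<Longrightarrow> z - r' \<in> H \<Longrightarrow> r' = r"
    using assms unfolding transversal_def by (metis UNIV_I)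
  show ?thesis
  proof (rule ex1I[of _ "z - r"])
    fix g assume "g \<in> H \<and> z - g \<in> R"
    then have "z - g = r" by (intro r(3)) auto
    then show "g = z - r" by (simp add: algebra_simps)
  qed (use r(1,2) in simp)
qed

text \<open>Multiplicativity of the index along
  \<open>H \<subseteq> K \<subseteq> UNIV\<close>.\<close>

lemma transversal_compose:
  fixes K :: "(int^'n) set"
  assumes K: "invariant_lattice L K" and H0: "0 \<in> H" and HK: "H \<subseteq> K"
    and R0: "transversal UNIV K R0" and R: "transversal K H R"
  shows "transversal UNIV H (R + R0) \<and> card (R + R0) = card R * card R0"
proof -
  have uniq0: "r0 = r0'" if "r0 \<in> R0" "r0' \<in> R0" "z - r0 \<in> K" "z - r0' \<in> K" for z r0 r0'
    using R0 that unfolding transversal_def by (metis UNIV_I)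
  have uniq: "r = r'" if "r \<in> R" "r' \<in> R" "z \<in> K" "z - r \<in> H" "z - r' \<in> H" for z r r'
    using R that unfolding transversal_def by metis
  have RK: "R \<subseteq> K" using R by (simp add: transversal_def)
  have key: "r0 = r0' \<and> r = r'"
    if "r0 \<in> R0" "r0' \<in> R0" "r \<in> R" "r' \<in> R" "z - (r + r0) \<in> H" "z - (r' + r0') \<in> H" for z r r' r0 r0'
  proof -
    have "z - r0 = (z - (r + r0)) + r" "z - r0' = (z - (r' + r0')) + r'" by (simp_all add: algebra_simps)
    then have k: "z - r0 \<in> K" "z - r0' \<in> K"
      using that HK RK invariant_latticeD(5)[OF K] by (metis subsetD)+
    then have e: "r0 = r0'" using uniq0 that by blast
    have "z - r0 - r \<in> H" "z - r0 - r' \<in> H" using that e by (simp_all add: algebra_simps)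
    then show ?thesis using uniq[OF that(3,4) k(1)] e by blast
  qed
  have "\<exists>!s. s \<in> R + R0 \<and> z - s \<in> H" for z
  proof -
    obtain r0 where r0: "r0 \<in> R0" "z - r0 \<in> K" using R0 unfolding transversal_def by (metis UNIV_I)
    obtain r where r: "r \<in> R" "z - r0 - r \<in> H" using R r0 unfolding transversal_def by metis
    show ?thesis
    proof (rule ex1I[of _ "r + r0"])
      show "r + r0 \<in> R + R0 \<and> z - (r + r0) \<in> H" 
        using r r0 set_plus_intro[OF r(1) r0(1)] by (simp add: diff_diff_eq add.commute[of r0])
      fix s assume s: "s \<in> R + R0 \<and> z - s \<in> H"
      then obtain r' r0' where s': "r' \<in> R" "r0' \<in> R0" "s = r' + r0'" by (auto simp: set_plus_def)
      have "z - (r + r0) \<in> H" using r by (simp add: algebra_simps)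
      then show "s = r + r0" using key[of r0 r0' r r' z] s s' r r0 by simp
    qed
  qed
  moreover have f: "finite R" "finite R0" using R R0 by (auto simp: transversal_def)
  moreover have "card (R + R0) = card R * card R0"
  proof -
    have "inj_on (\<lambda>(r, r0). r + r0) (R \<times> R0)"
    proof (rule inj_onI, clarify)
      fix r r0 r' r0' assume m: "r \<in> R" "r0 \<in> R0" "r' \<in> R" "r0' \<in> R0" and "r + r0 = r' + r0'"
      then have "(r + r0) - (r + r0) \<in> H" "(r + r0) - (r' + r0') \<in> H" using H0 by simp_all
      then show "r = r' \<and> r0 = r0'" using key[of r0 r0' r r'] m by blast
    qed
    then show ?thesis by (simp add: set_plus_image card_image card_cartesian_product)
  qed
  ultimately show ?thesis unfolding transversal_def by (auto simp: finite_set_plus)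
qed

text \<open>Two fundamental domains of the image lattice \<open>H\<close> are compared: the unit
  cubes over \<open>R + R0\<close>, of volume \<open>card R * card R0\<close>, and the linear image
  of the cubes over \<open>R0\<close>, of volume |det L| times \<open>card R0\<close>.\<close>

lemma invariant_lattice_index:
  fixes L :: "int^'n^'n"
  assumes irr: "irreducible_mat L" and det: "det L \<noteq> 0"
    and \<Lambda>: "invariant_lattice L \<Lambda>" and t: "t \<in> \<Lambda>" "t \<noteq> 0"
  obtains R where "transversal \<Lambda> ((*v) L ` \<Lambda>) R" "int (card R) = \<bar>det L\<bar>"
proof -
  define H where "H = (*v) L ` \<Lambda>"
  have H: "invariant_lattice L H" unfolding H_def by (rule invariant_lattice_image[OF \<Lambda>])
  have HL: "H \<subseteq> \<Lambda>" using invariant_latticeD(3)[OF \<Lambda>] by (auto simp: H_def)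
  have "L *v t \<noteq> L *v 0" using injD[OF inj_matrix_int[OF det]] t by blast
  then have Lt: "L *v t \<in> H" "L *v t \<noteq> 0" using t matrix_int_add[of L 0 0] by (auto simp: H_def)
  obtain m where m: "m > 0" "\<And>z. m *s z \<in> H"
    using invariant_lattice_finite_index[OF irr H Lt] by blast
  have "invariant_lattice L UNIV" by (simp add: invariant_lattice_def)
  then obtain R0 where R0: "transversal UNIV \<Lambda> R0"
    using transversal_exists[OF _ \<Lambda> subset_UNIV m(1)] m(2) HL by blast
  obtain R where R: "transversal \<Lambda> H R"
    using transversal_exists[OF \<Lambda> H HL m] by blast
  have comp: "transversal UNIV H (R + R0)" "card (R + R0) = card R * card R0"
    using transversal_compose[OF \<Lambda> invariant_latticeD(1)[OF H] HL R0 R] by blast+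
  have fin: "finite R0" "finite (R + R0)" using R0 comp(1) by (auto simp: transversal_def)
  define M :: "real^'n^'n" where "M = (\<chi> i j. of_int (L $ i $ j))"
  have detM: "det M = of_int (det L)" by (simp add: M_def det_of_int_mat)
  have invM: "invertible M" using det by (simp add: invertible_det_nz detM)
  have MR: "M *v real_vec z = real_vec (L *v z)" for z
    by (simp add: M_def real_vec_def matrix_vector_mult_def vec_eq_iff)
  define S where "S = {x :: real^'n. floor_vec x \<in> R0}"
  have "fundamental_domain (real_vec ` \<Lambda>) S"
    unfolding S_def using fin transversal_shift[OF R0] by (intro fundamental_domain_floor_vec)
  then have "fundamental_domain ((*v) M ` real_vec ` \<Lambda>) ((*v) M ` S)"
    by (rule fundamental_domain_linear_image[OF _ invM])
  moreover have "(*v) M ` real_vec ` \<Lambda> = real_vec ` H"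
    by (simp add: image_image MR H_def)
  ultimately have fd2: "fundamental_domain (real_vec ` H) ((*v) M ` S)" by simp
  have fd1: "fundamental_domain (real_vec ` H) {x. floor_vec x \<in> R + R0}"
    using fin transversal_shift[OF comp(1)] by (intro fundamental_domain_floor_vec)
  have "countable (real_vec ` H)"
  proof -
    have "countable (UNIV :: (int^'n) set)"
    proof -
      have "vec_nth ` (UNIV :: (int^'n) set) \<subseteq> UNIV \<rightarrow>\<^sub>E UNIV" by auto
      moreover have "countable ((UNIV :: 'n set) \<rightarrow>\<^sub>E (UNIV :: int set))" by (intro countable_PiE) auto
      ultimately have "countable (vec_nth ` (UNIV :: (int^'n) set))" by (rule countable_subset)
      then show ?thesis by (rule countable_image_inj_on) (simp add: inj_on_def vec_nth_inject)
    qed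
    then show ?thesis by (meson countable_image countable_subset subset_UNIV)
  qed
  then have "emeasure lborel ((*v) M ` S) = emeasure lborel {x :: real^'n. floor_vec x \<in> R + R0}"
  proof (rule fundamental_domain_emeasure_eq[OF _ _ fd2 fd1])
    show "- g \<in> real_vec ` H" if "g \<in> real_vec ` H" for g
      using that invariant_latticeD(4)[OF H] by (auto simp: real_vec_uminus[symmetric])
  qed
  also have "\<dots> = of_nat (card R * card R0)" using emeasure_floor_vec_in[OF fin(2)] comp(2) by simp
  finally have e2: "emeasure lborel ((*v) M ` S) = of_nat (card R * card R0)" .
  have S: "S \<in> sets borel" "emeasure lborel S = of_nat (card R0)"
    using emeasure_floor_vec_in[OF fin(1)] by (auto simp: S_def)
  have m1: "measure lebesgue S = real (card R0)"
    using S by (simp add: measure_def)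
  have "S \<in> lmeasurable" using S by (auto simp: fmeasurable_def of_nat_less_top)
  then have "measure lebesgue ((*v) M ` S) = \<bar>det M\<bar> * measure lebesgue S"
    using det detM by (intro measure_matrix_image) auto
  moreover have "(*v) M ` S \<in> sets borel" using fd2 by (simp add: fundamental_domain_def)
  then have "measure lebesgue ((*v) M ` S) = real (card R * card R0)"
    using e2 by (intro measure_eq_emeasure_eq_ennreal) (simp_all add: ennreal_of_nat_eq_real_of_nat ennreal_mult)
  ultimately have "real (card R) * real (card R0) = \<bar>of_int (det L)\<bar> * real (card R0)"
    using m1 detM by simp
  moreover have "card R0 > 0"
    using R0 fin unfolding transversal_def by (metis UNIV_I card_gt_0_iff empty_iff)
  ultimately have "real (card R) = \<bar>of_int (det L)\<bar>" by simp
  then have "int (card R) = \<bar>det L\<bar>" by linarith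
  then show ?thesis using that R unfolding H_def by blast
qed

section \<open>Brunn--Minkowski for dilates\<close>

text \<open>Choose one point of \<open>Z\<close> on every line in direction \<open>v\<close>; its
  translates along the progression stay on that line, so all these points are distinct.\<close>

lemma card_lines_le:
  fixes \<Phi> :: "int^'n \<Rightarrow> rat^'n" and Z :: "(int^'n) set"
  assumes add: "\<And>x y. \<Phi> (x + y) = \<Phi> x + \<Phi> y" and scale: "\<And>c x. \<Phi> (c *s x) = of_int c *s \<Phi> x"
    and Z: "finite Z" and v: "\<Phi> v = axis i 1"
  shows "card (drop_coord i ` \<Phi> ` Z) * 2 ^ I \<le> card (Z + multiples_upto I v)"
proof -
  define V where "V = drop_coord i ` \<Phi> ` Z"
  have "\<exists>z\<in>Z. drop_coord i (\<Phi> z) = u" if "u \<in> V" for u using that by (auto simp: V_def)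
  then obtain g where g: "\<And>u. u \<in> V \<Longrightarrow> g u \<in> Z \<and> drop_coord i (\<Phi> (g u)) = u" by metis
  let ?f = "\<lambda>(u, j). g u + int j *s v"
  have im: "\<Phi> (g u + int j *s v) = \<Phi> (g u) + of_nat j *s axis i 1" for u j
    by (simp add: add scale v)
  have "inj_on ?f (V \<times> {..<2 ^ I})"
  proof (rule inj_onI, clarify)
    fix u j u' j' assume u: "u \<in> V" "u' \<in> V" and eq: "g u + int j *s v = g u' + int j' *s v"
    have e: "\<Phi> (g u) + of_nat j *s axis i 1 = \<Phi> (g u') + of_nat j' *s axis i 1"
      using arg_cong[OF eq, of \<Phi>] by (simp only: im)
    have "drop_coord i (of_nat m *s axis i 1) = (0 :: rat^'n)" for m :: nat
      by (simp add: vec_eq_iff axis_def)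
    then have "u = u'"
      using arg_cong[OF e, of "drop_coord i"] g[OF u(1)] g[OF u(2)] by (simp add: drop_coord_add)
    moreover have "(of_nat j :: rat) = of_nat j'"
      using arg_cong[OF e, of "\<lambda>w. w $ i"] \<open>u = u'\<close> by (simp add: axis_def)
    ultimately show "u = u' \<and> j = j'" by simp
  qed
  moreover have "?f ` (V \<times> {..<2 ^ I}) \<subseteq> Z + multiples_upto I v"
    using g by (auto simp: multiples_upto_def intro!: set_plus_intro)
  moreover have "finite (Z + multiples_upto I v)"
    using Z by (intro finite_set_plus) (auto simp: multiples_upto_def)
  ultimately have "card (V \<times> {..<(2::nat) ^ I}) \<le> card (Z + multiples_upto I v)" by (rule card_inj_on_le)
  then show ?thesis by (simp add: card_cartesian_product V_def)
qed

lemma poly_le_exp: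
  fixes c0 :: nat
  assumes "c0 > 0"
  shows "\<exists>K>0. \<forall>I::nat. (2 * real I + 1) ^ c0 \<le> K * 2 powr (real I / 2)"
proof -
  \<comment> \<open>Chosen so that \<open>c0 * \<epsilon> * 2 * I\<close> equals
    \<open>I / 2 * ln 2\<close>.\<close>
  define \<epsilon> where "\<epsilon> = ln 2 / (4 * real c0)"
  have e: "\<epsilon> > 0" using assms by (simp add: \<epsilon>_def)
  define K where "K = exp (real c0 * (\<epsilon> - 1 - ln \<epsilon>))"
  have "(2 * real I + 1) ^ c0 \<le> K * 2 powr (real I / 2)" for I :: nat
  proof -
    have "ln (\<epsilon> * (2 * real I + 1)) \<le> \<epsilon> * (2 * real I + 1) - 1" using e by (intro ln_le_minus_one) auto
    then have "ln (2 * real I + 1) \<le> \<epsilon> * (2 * real I + 1) - 1 - ln \<epsilon>" using e by (simp add: ln_mult)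
    then have "real c0 * ln (2 * real I + 1) \<le> real c0 * (\<epsilon> * (2 * real I + 1) - 1 - ln \<epsilon>)"
      by (rule mult_left_mono) simp
    also have "\<dots> = real c0 * (\<epsilon> - 1 - ln \<epsilon>) + real I / 2 * ln 2"
      using assms by (simp add: \<epsilon>_def field_simps)
    finally have "exp (real c0 * ln (2 * real I + 1)) \<le> exp (real c0 * (\<epsilon> - 1 - ln \<epsilon>) + real I / 2 * ln 2)"
      by simp
    also have "\<dots> = K * 2 powr (real I / 2)" by (simp add: exp_add K_def powr_def)
    also have "exp (real c0 * ln (2 * real I + 1)) = (2 * real I + 1) ^ c0"
      by (simp add: exp_of_nat_mult)
    finally show ?thesis .
  qed
  then show ?thesis by (intro exI[of _ K]) (auto simp: K_def)
qed

lemma log_bracket: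
  fixes c0 N :: nat
  assumes "c0 \<ge> 2" "N \<ge> 2"
  shows "\<exists>I. c0 ^ I < N \<and> N \<le> c0 ^ Suc I"
proof -
  have "N < 2 ^ N" by (rule less_exp)
  also have "(2::nat) ^ N \<le> c0 ^ N" using assms by (intro power_mono) auto
  finally have ex: "\<exists>i. N \<le> c0 ^ i" by (intro exI[of _ N]) simp
  define i where "i = (LEAST i. N \<le> c0 ^ i)"
  have i: "N \<le> c0 ^ i" unfolding i_def using ex by (rule LeastI_ex)
  then have "i \<noteq> 0" using assms by (metis One_nat_def Suc_1 not_less_eq_eq power_0)
  then obtain I where I: "i = Suc I" by (metis not0_implies_Suc)
  have "\<not> N \<le> c0 ^ I" using not_less_Least[of I "\<lambda>i. N \<le> c0 ^ i"] I i_def by auto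
  then show ?thesis using i I by (intro exI[of _ I]) auto
qed

text \<open>The error is measured by \<open>A\<close>, not by \<open>X\<close> and \<open>Y\<close>:
  subsets of \<open>A\<close> need not have small doubling themselves, but the lines that cover the
  dilate sum of \<open>A\<close> also cover that of \<open>X\<close> and \<open>Y\<close>.\<close>

theorem dilate_brunn_minkowski:
  fixes C :: real
  assumes "C \<ge> 1"
  shows "\<exists>c \<sigma>. c > 0 \<and> \<sigma> > 0 \<and> \<sigma> \<le> 1 \<and> (\<forall>(L :: int^'n::finite^'n) A. irreducible_mat L \<and> det L \<noteq> 0 \<and> finite A \<and> card A \<ge> 2 \<and>
     real (card (A + (*v) L ` A)) \<le> C * real (card A) \<longrightarrow>
     (\<forall>X Y. X \<subseteq> A \<and> Y \<subseteq> A \<and> X \<noteq> {} \<and> Y \<noteq> {} \<longrightarrow>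
       (real (card X) powr (1 / real CARD('n)) + real (card Y) powr (1 / real CARD('n))) ^ CARD('n)
       \<le> real (card (X + (*v) L ` Y)) + c * real (card A) powr (1 - \<sigma>)))"
proof -
  define d where "d = CARD('n)"
  obtain c0 where c0: "2 \<le> c0" and rich: "\<forall>(L :: int^'n^'n) A I. inj ((*v) L) \<and> finite A \<and> A \<noteq> {} \<and>
    real (card (A + (*v) L ` A)) \<le> C * real (card A) \<and> c0 ^ I < card A \<longrightarrow>
    (\<exists>t. t \<noteq> 0 \<and> (\<forall>i<d. real (card (A + (*v) L ` A + multiples_upto I ((((*v) L) ^^ i) t)))
       \<le> C\<^sup>2 * real c0 * (2 * real I + 1) ^ c0 * real (card A)))"
    using rich_direction[of C d, where 'n = 'n] by (elim exE conjE)
  obtain K where K: "K > 0" "\<And>I::nat. (2 * real I + 1) ^ c0 \<le> K * 2 powr (real I / 2)"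
    using poly_le_exp[of c0] c0 by auto
  \<comment> \<open>\<open>N \<le> c0 ^ Suc I\<close> gives \<open>2 ^ Suc I \<ge> N powr s\<close>.
    Half of this exponent is given up to the polynomial factor in \<open>I\<close>, which leaves the
    saving \<open>s / 2\<close>.\<close>
  define s where "s = ln 2 / ln (real c0)"
  have s: "0 < s" "s \<le> 1" using c0 by (auto simp: s_def)
  \<comment> \<open>\<open>2 ^ d * d\<close> comes from the \<open>d\<close> directions in
    \<open>discrete_brunn_minkowski\<close>, the square of \<open>C\<close> and \<open>c0\<close>
    from the rich direction, \<open>K\<close> from \<open>poly_le_exp\<close>, and the root of 2
    from replacing \<open>Suc I\<close> by \<open>I\<close>.\<close>
  define c where "c = 2 ^ d * real d * (C\<^sup>2 * real c0 * K * 2 powr (1/2))"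
  have "c > 0" using c0 K assms by (auto simp: c_def d_def)
  have main: "(real (card X) powr (1 / real d) + real (card Y) powr (1 / real d)) ^ d
       \<le> real (card (X + (*v) L ` Y)) + c * real (card A) powr (1 - s / 2)"
    if irr: "irreducible_mat L" and det: "det L \<noteq> 0" and A: "finite A" "card A \<ge> 2"
      and small: "real (card (A + (*v) L ` A)) \<le> C * real (card A)"
      and XY: "X \<subseteq> A" "Y \<subseteq> A" "X \<noteq> {}" "Y \<noteq> {}"
    for L :: "int^'n^'n" and A X Y
  proof -
    define N where "N = card A"
    obtain I where I: "c0 ^ I < N" "N \<le> c0 ^ Suc I" using log_bracket[OF c0] A unfolding N_def by blast
    have inj: "inj ((*v) L)" by (rule inj_matrix_int[OF det])
    have "A \<noteq> {}" using XY by auto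
    then obtain t where t: "t \<noteq> 0" "\<And>i. i < d \<Longrightarrow> real (card (A + (*v) L ` A + multiples_upto I ((((*v) L) ^^ i) t)))
       \<le> C\<^sup>2 * real c0 * (2 * real I + 1) ^ c0 * real (card A)"
      using rich[rule_format, of L A I] inj A small I by (auto simp: N_def)
    obtain \<Phi> :: "int^'n \<Rightarrow> rat^'n" and h :: "'n \<Rightarrow> nat" where
      \<Phi>: "\<forall>x y. \<Phi> (x + y) = \<Phi> x + \<Phi> y" "\<forall>c x. \<Phi> (c *s x) = of_int c *s \<Phi> x" "inj \<Phi>"
      and h: "\<forall>i. h i < CARD('n)" "\<forall>i. \<Phi> ((((*v) L) ^^ h i) t) = axis i 1"
      using krylov_coordinates[OF irr t(1)] by (elim exE conjE) (rule that)
    define Z where "Z = A + (*v) L ` A"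
    have finZ: "finite Z" using A by (simp add: Z_def finite_set_plus)
    have fin: "finite X" "finite Y" using XY A finite_subset by auto
    have sub: "X + (*v) L ` Y \<subseteq> Z" unfolding Z_def using XY by (intro set_plus_mono2) auto
    have lines: "real (card (drop_coord i ` (\<Phi> ` X + \<Phi> ` (*v) L ` Y))) \<le> C\<^sup>2 * real c0 * K * 2 powr (1/2) * real N powr (1 - s / 2)" for i
    proof -
      have eqs: "\<Phi> ` X + \<Phi> ` (*v) L ` Y = \<Phi> ` (X + (*v) L ` Y)"
        using \<Phi>(1) by (intro image_sumset[symmetric]) blast
      have "card (drop_coord i ` (\<Phi> ` X + \<Phi> ` (*v) L ` Y)) \<le> card (drop_coord i ` \<Phi> ` Z)"
        unfolding eqs using sub finZ by (intro card_mono image_mono) auto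
      then have "card (drop_coord i ` (\<Phi> ` X + \<Phi> ` (*v) L ` Y)) * 2 ^ I \<le> card (Z + multiples_upto I ((((*v) L) ^^ h i) t))"
        using card_lines_le[of \<Phi> Z "(((*v) L) ^^ h i) t" i I] \<Phi> h finZ
        by (meson le_trans mult_le_mono1)
      then have "real (card (drop_coord i ` (\<Phi> ` X + \<Phi> ` (*v) L ` Y)) * 2 ^ I) \<le> real (card (Z + multiples_upto I ((((*v) L) ^^ h i) t)))"
        by (simp only: of_nat_le_iff)
      also have "\<dots> \<le> C\<^sup>2 * real c0 * (2 * real I + 1) ^ c0 * real N"
        unfolding Z_def N_def using h by (intro t(2)) (simp add: d_def)
      also have "\<dots> \<le> C\<^sup>2 * real c0 * (K * 2 powr (real I / 2)) * real N"
        using K by (intro mult_right_mono mult_left_mono) auto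
      finally have "real (card (drop_coord i ` (\<Phi> ` X + \<Phi> ` (*v) L ` Y))) * 2 powr real I \<le> C\<^sup>2 * real c0 * (K * 2 powr (real I / 2)) * real N"
        by (simp add: powr_realpow)
      then have "real (card (drop_coord i ` (\<Phi> ` X + \<Phi> ` (*v) L ` Y))) \<le> C\<^sup>2 * real c0 * (K * 2 powr (real I / 2)) * real N / 2 powr real I"
        by (simp add: pos_le_divide_eq)
      also have "\<dots> = C\<^sup>2 * real c0 * K * (2 powr (real I / 2) / 2 powr real I) * real N" by simp
      also have "2 powr (real I / 2) / 2 powr real I = 2 powr (- (real I / 2))"
        by (simp add: powr_diff[symmetric])
      also have "C\<^sup>2 * real c0 * K * 2 powr (- (real I / 2)) * real N
          \<le> C\<^sup>2 * real c0 * K * (2 powr (1/2) * real N powr (- (s / 2))) * real N"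
      proof (intro mult_right_mono mult_left_mono)
        have N0: "real N > 0" using A by (simp add: N_def)
        have "real N powr s \<le> (real c0 powr real (Suc I)) powr s"
        proof (rule powr_mono2)
          have "real N \<le> real (c0 ^ Suc I)" using I by (simp only: of_nat_le_iff)
          then show "real N \<le> real c0 powr real (Suc I)" using c0 by (simp add: powr_realpow del: of_nat_Suc)
        qed (use s in auto)
        also have "\<dots> = 2 powr real (Suc I)"
          using c0 by (simp add: powr_powr powr_def s_def)
        finally have "(real N powr s) powr (1/2) \<le> (2 powr real (Suc I)) powr (1/2)"
          by (intro powr_mono2) auto
        then have "real N powr (s / 2) \<le> 2 powr (real I / 2 + 1 / 2)"
          by (simp add: powr_powr add_divide_distrib algebra_simps)
        then have "real N powr (s / 2) \<le> 2 powr (1/2) * 2 powr (real I / 2)" by (simp add: powr_add mult.commute)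
        then show "2 powr (- (real I / 2)) \<le> 2 powr (1/2) * real N powr (- (s / 2))"
          using N0 by (simp add: powr_minus field_simps)
      qed (use K c0 in auto)
      also have "\<dots> = C\<^sup>2 * real c0 * K * 2 powr (1/2) * (real N powr 1 * real N powr (- (s / 2)))"
        using A by (simp add: N_def)
      also have "real N powr 1 * real N powr (- (s / 2)) = real N powr (1 - s / 2)"
        by (simp only: powr_add[symmetric]) simp
      finally show ?thesis .
    qed
    have cX: "card (\<Phi> ` X) = card X" "card (\<Phi> ` (*v) L ` Y) = card Y"
      "card (\<Phi> ` (X + (*v) L ` Y)) = card (X + (*v) L ` Y)"
      using \<Phi>(3) inj by (simp_all add: card_image inj_on_subset)
    have "(real (card (\<Phi> ` X)) powr (1 / real (card (UNIV :: 'n set))) + real (card (\<Phi> ` (*v) L ` Y)) powr (1 / real (card (UNIV :: 'n set)))) ^ card (UNIV :: 'n set)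
      \<le> real (card (\<Phi> ` X + \<Phi> ` (*v) L ` Y)) + 2 ^ card (UNIV :: 'n set) * (\<Sum>i\<in>UNIV. real (card (drop_coord i ` (\<Phi> ` X + \<Phi> ` (*v) L ` Y))))"
      by (rule discrete_brunn_minkowski) (use fin XY in auto)
    also have "\<Phi> ` X + \<Phi> ` (*v) L ` Y = \<Phi> ` (X + (*v) L ` Y)"
      using \<Phi>(1) by (intro image_sumset[symmetric]) blast
    also have "(\<Sum>i\<in>UNIV. real (card (drop_coord i ` \<Phi> ` (X + (*v) L ` Y)))) \<le>
        (\<Sum>i\<in>(UNIV :: 'n set). C\<^sup>2 * real c0 * K * 2 powr (1/2) * real N powr (1 - s / 2))"
      using lines \<open>\<Phi> ` X + \<Phi> ` (*v) L ` Y = \<Phi> ` (X + (*v) L ` Y)\<close> by (intro sum_mono) simp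
    finally show ?thesis
      unfolding cX by (simp add: d_def c_def N_def algebra_simps)
  qed
  have "0 < s / 2" "s / 2 \<le> 1" using s by auto
  with \<open>c > 0\<close> show ?thesis
    by (intro exI[of _ c] exI[of _ "s / 2"] conjI allI impI; (elim conjE)?)
      (assumption | rule main[unfolded d_def])+
qed

section \<open>Real inequalities\<close>

text \<open>As a function of \<open>r ^ n\<close>, the right-hand side lies above its chord. In the
  binomial expansions the term with \<open>v ^ i\<close>, \<open>i \<ge> 1\<close>, carries
  \<open>r ^ n\<close> on the left and the larger \<open>r ^ i\<close> on the right.\<close>

lemma power_scaled_increment:
  fixes r v c :: real
  assumes "0 \<le> r" "r \<le> 1" "0 \<le> v" "0 \<le> c"
  shows "(1 - r ^ n) * c ^ n + r ^ n * (v + c) ^ n \<le> (r * v + c) ^ n"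
proof -
  have "r ^ n * ((v + c) ^ n - c ^ n) \<le> (r * v + c) ^ n - c ^ n"
  proof (induction n)
    case (Suc n)
    define X where "X = (v + c) ^ n - c ^ n"
    have X: "X \<ge> 0" using assms by (simp add: X_def power_mono)
    have "r ^ Suc n * ((v + c) ^ Suc n - c ^ Suc n) = r ^ Suc n * ((v + c) * X) + r ^ n * (r * v * c ^ n)"
      by (simp add: X_def algebra_simps)
    also have "\<dots> \<le> (r * v + c) * (r ^ n * X) + r * v * c ^ n"
    proof (rule add_mono)
      have "r * c \<le> c" using assms by (simp add: mult_left_le_one_le)
      then have "r * (v + c) * (r ^ n * X) \<le> (r * v + c) * (r ^ n * X)"
        using assms X by (intro mult_right_mono) (auto simp: algebra_simps)
      then show "r ^ Suc n * ((v + c) * X) \<le> (r * v + c) * (r ^ n * X)" by (simp add: ac_simps)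
      show "r ^ n * (r * v * c ^ n) \<le> r * v * c ^ n"
        using assms by (intro mult_left_le_one_le) (auto simp: power_le_one)
    qed
    also have "\<dots> \<le> (r * v + c) * ((r * v + c) ^ n - c ^ n) + r * v * c ^ n"
      using Suc assms by (intro add_right_mono mult_left_mono) (auto simp: X_def)
    also have "\<dots> = (r * v + c) ^ Suc n - c ^ Suc n" by (simp add: algebra_simps)
    finally show ?case .
  qed simp
  then show ?thesis by (simp add: algebra_simps)
qed

text \<open>The increment of \<open>t ^ n\<close> over a step of length \<open>p\<close> grows with
  the starting point.\<close>

lemma power_increment_mono:
  fixes p q \<kappa> :: real
  assumes "0 \<le> p" "0 \<le> \<kappa>" "\<kappa> \<le> q"
  shows "(p + \<kappa>) ^ n + q ^ n - \<kappa> ^ n \<le> (p + q) ^ n"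
proof (induction n)
  case (Suc n)
  have "0 \<le> (q - \<kappa>) * ((p + \<kappa>) ^ n - \<kappa> ^ n) + p * (q ^ n - \<kappa> ^ n)"
    using assms by (intro add_nonneg_nonneg mult_nonneg_nonneg) (auto simp: power_mono)
  then have "(p + \<kappa>) ^ Suc n + q ^ Suc n - \<kappa> ^ Suc n \<le> (p + q) * ((p + \<kappa>) ^ n + q ^ n - \<kappa> ^ n)"
    by (simp add: algebra_simps)
  also have "\<dots> \<le> (p + q) * (p + q) ^ n" using Suc assms by (intro mult_left_mono) auto
  finally show ?case by simp
qed simp

lemma power_tangent_le:
  fixes x y :: real
  assumes "0 \<le> x" "0 \<le> y"
  shows "y ^ Suc n + real (Suc n) * y ^ n * (x - y) \<le> x ^ Suc n"
proof (induction n)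
  case (Suc n)
  have "0 \<le> (x - y) * (x - y) * y ^ n" using assms by simp
  moreover have "y ^ Suc (Suc n) + real (Suc (Suc n)) * y ^ Suc n * (x - y) + real (Suc n) * ((x - y) * (x - y) * y ^ n)
      = x * (y ^ Suc n + real (Suc n) * y ^ n * (x - y))"
    by (simp add: algebra_simps)
  ultimately have "y ^ Suc (Suc n) + real (Suc (Suc n)) * y ^ Suc n * (x - y) \<le> x * (y ^ Suc n + real (Suc n) * y ^ n * (x - y))"
    by (smt (verit) mult_nonneg_nonneg of_nat_0_le_iff)
  also have "\<dots> \<le> x * x ^ Suc n" using Suc assms by (intro mult_left_mono) auto
  finally show ?case by simp
qed simp

text \<open>With \<open>u = 1 + v\<close>, Young's inequality bounds \<open>u powr (1 - s)\<close>
  above by the linear \<open>w\<close>, so \<open>u powr s\<close> is at least \<open>u / w\<close>;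
  the quadratic term pays for \<open>s * (1 - s) * v\<^sup>2\<close> because
  \<open>w \<ge> 1/2\<close>.\<close>

lemma powr_quadratic_lower_bound:
  fixes s v :: real
  assumes "0 \<le> s" "s \<le> 1" "\<bar>v\<bar> \<le> 1/2"
  shows "1 + s * v - v\<^sup>2 / 2 \<le> (1 + v) powr s"
proof -
  define u where "u = 1 + v"
  have u: "u > 0" using assms by (auto simp: u_def)
  define w where "w = 1 + (1 - s) * v"
  have "\<bar>(1 - s) * v\<bar> \<le> 1 * (1/2)" unfolding abs_mult using assms by (intro mult_mono) auto
  then have w: "w \<ge> 1/2" by (auto simp: w_def)
  have "u powr (1 - s) * 1 powr s \<le> (1 - s) * u + s * 1"
    using assms u by (intro Youngs_inequality_0) auto
  then have "u powr (1 - s) \<le> w" by (simp add: u_def w_def algebra_simps)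
  then have "u powr s * u powr (1 - s) \<le> u powr s * w" by (intro mult_left_mono) auto
  then have le: "u \<le> u powr s * w" using u by (simp add: powr_add[symmetric])
  have "s * (1 - s) \<le> 1/4"
    using zero_le_power2[of "s - 1/2"] by (simp add: power2_eq_square algebra_simps)
  then have "s * (1 - s) * v\<^sup>2 \<le> 1/4 * v\<^sup>2" by (intro mult_right_mono) auto
  moreover have "(1/2) * (v\<^sup>2 / 2) \<le> w * (v\<^sup>2 / 2)" using w by (intro mult_right_mono) auto
  moreover have "(1 + s * v) * w = u + s * (1 - s) * v\<^sup>2"
    by (simp add: u_def w_def power2_eq_square algebra_simps)
  ultimately have "(1 + s * v - v\<^sup>2 / 2) * w \<le> u" by (simp add: algebra_simps)
  then have "(1 + s * v - v\<^sup>2 / 2) * w \<le> u powr s * w" using le by linarith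
  then show ?thesis using w by (simp add: u_def)
qed

text \<open>With \<open>u\<close> the normalised sizes of the classes at one level, of mean \<open>1\<close> and maximum \<open>1 + b\<close>, and
  \<open>1 + a\<close> the normalised maximum one level up, these two lemmas show that a failure of the
  expected bound forces \<open>b\<close> to be much larger than \<open>a\<close>.\<close>

context
  fixes d k :: nat and \<kappa> C a b \<eta> :: real and F :: "'c set" and u :: "'c \<Rightarrow> real"
  assumes d: "d > 0" and k: "k \<ge> 1" and \<kappa>: "\<kappa> \<ge> 0" "\<kappa> ^ d = real k" and C: "C = (1 + \<kappa>) ^ d"
    and F: "finite F" "F \<noteq> {}" and u: "\<And>x. x \<in> F \<Longrightarrow> 0 \<le> u x \<and> u x \<le> 1 + b" "(\<Sum>x\<in>F. u x) = real (card F)"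
    and a: "0 \<le> a" and \<eta>: "\<eta> > 0"
    and fail: "(\<Sum>x\<in>F. (u x powr (1 / real d) + \<kappa> * (1 + a) powr (1 / real d)) ^ d) < real (card F) * (C - \<eta>)"
begin

lemma scaled_root_power: "(\<kappa> * (1 + a) powr (1 / real d)) ^ d = real k * (1 + a)"
  using a d \<kappa> by (simp add: power_mult_distrib powr_inverse_power)

lemma card_index_pos: "real (card F) > 0"
  using F by (simp add: card_gt_0_iff)

lemma C_gt_k: "C > real k"
proof -
  have "\<kappa> ^ d < (1 + \<kappa>) ^ d" using \<kappa> d by (intro power_strict_mono) auto
  then show ?thesis by (simp add: C \<kappa>)
qed

lemma max_density_mono: "b \<ge> a" and max_density_grows: "b * (C - real k) \<ge> a * C + \<eta>"
proof -
  have pt: "((1 + a) powr (1 / real d) * (1 + \<kappa>)) ^ d = (1 + a) * C"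
    using a d by (simp add: power_mult_distrib powr_inverse_power C)
  show ba: "b \<ge> a"
  proof (rule ccontr)
    assume "\<not> b \<ge> a"
    \<comment> \<open>If all normalised sizes were at most \<open>1 + a\<close>, every term would be
      at least \<open>C * u x\<close>, and these add up to the full
      \<open>C * card F\<close>.\<close>
    have "C * u x \<le> (u x powr (1 / real d) + \<kappa> * (1 + a) powr (1 / real d)) ^ d" if x: "x \<in> F" for x
    proof -
      have "u x powr (1 / real d) \<le> (1 + a) powr (1 / real d)"
        using u(1)[OF x] \<open>\<not> b \<ge> a\<close> by (intro powr_mono2) auto
      then have "u x powr (1 / real d) * (1 + \<kappa>) \<le> u x powr (1 / real d) + \<kappa> * (1 + a) powr (1 / real d)"
        using \<kappa> by (simp add: algebra_simps mult_left_mono)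
      then have "(u x powr (1 / real d) * (1 + \<kappa>)) ^ d \<le> (u x powr (1 / real d) + \<kappa> * (1 + a) powr (1 / real d)) ^ d"
        using \<kappa> by (intro power_mono) auto
      then show ?thesis using u(1)[OF x] d by (simp add: power_mult_distrib powr_inverse_power C mult.commute)
    qed
    then have "(\<Sum>x\<in>F. C * u x) \<le> (\<Sum>x\<in>F. (u x powr (1 / real d) + \<kappa> * (1 + a) powr (1 / real d)) ^ d)"
      by (rule sum_mono)
    then have "C * real (card F) < real (card F) * (C - \<eta>)"
      using fail u(2) by (simp add: sum_distrib_left[symmetric])
    then show False using mult_pos_pos[OF card_index_pos \<eta>] by (simp add: algebra_simps)
  qed
  define c where "c = \<kappa> * (1 + a) powr (1 / real d)"
  define v where "v = (1 + b) powr (1 / real d)"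
  \<comment> \<open>The chord of \<open>power_scaled_increment\<close> with
    \<open>r ^ d = u x / (1 + b)\<close>. It is linear in \<open>u x\<close>, so the sum over
    \<open>F\<close> depends only on the mean.\<close>
  have low: "(1 - u x / (1 + b)) * (real k * (1 + a)) + u x / (1 + b) * ((1 + a) * C) \<le> (u x powr (1 / real d) + c) ^ d"
    if x: "x \<in> F" for x
  proof -
    define r where "r = (u x / (1 + b)) powr (1 / real d)"
    have b1: "1 + b > 0" using a ba by simp
    have q: "0 \<le> u x / (1 + b)" "u x / (1 + b) \<le> 1" using u(1)[OF x] b1 by auto
    have r: "0 \<le> r" "r \<le> 1" "r ^ d = u x / (1 + b)"
      unfolding r_def using q d powr_mono2[of "1 / real d" "u x / (1 + b)" 1]
      by (simp_all add: powr_inverse_power)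
    have rv: "r * v = u x powr (1 / real d)"
      unfolding r_def v_def using u(1)[OF x] b1 by (simp add: powr_divide)
    have "(1 - r ^ d) * c ^ d + r ^ d * (v + c) ^ d \<le> (r * v + c) ^ d"
      using r \<kappa> by (intro power_scaled_increment) (auto simp: v_def c_def)
    moreover have "(1 + a) * C \<le> (v + c) ^ d"
    proof -
      have "(1 + a) powr (1 / real d) \<le> v" unfolding v_def using a ba by (intro powr_mono2) auto
      then have "((1 + a) powr (1 / real d) * (1 + \<kappa>)) ^ d \<le> (v + c) ^ d"
        using \<kappa> by (intro power_mono) (auto simp: c_def algebra_simps)
      then show ?thesis by (simp add: pt)
    qed
    then have "r ^ d * ((1 + a) * C) \<le> r ^ d * (v + c) ^ d" using r(1) by (intro mult_left_mono zero_le_power)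
    moreover have "c ^ d = real k * (1 + a)" unfolding c_def by (rule scaled_root_power)
    ultimately show ?thesis using r(3) rv by simp
  qed
  have b1: "1 + b > 0" using a ba by simp
  have "(\<Sum>x\<in>F. (1 - u x / (1 + b)) * (real k * (1 + a)) + u x / (1 + b) * ((1 + a) * C))
      < real (card F) * (C - \<eta>)"
    using sum_mono[OF low] fail unfolding c_def by (rule le_less_trans)
  moreover have "(\<Sum>x\<in>F. (1 - u x / (1 + b)) * (real k * (1 + a)) + u x / (1 + b) * ((1 + a) * C))
      = real (card F) * ((1 + a) * (real k * b + C) / (1 + b))"
  proof -
    have "(1 - y / (1 + b)) * (real k * (1 + a)) + y / (1 + b) * ((1 + a) * C)
      = real k * (1 + a) + y * (((1 + a) * C - real k * (1 + a)) / (1 + b))" for y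
      by (simp add: divide_inverse algebra_simps)
    then have "(\<Sum>x\<in>F. (1 - u x / (1 + b)) * (real k * (1 + a)) + u x / (1 + b) * ((1 + a) * C))
      = real (card F) * (real k * (1 + a)) + real (card F) * (((1 + a) * C - real k * (1 + a)) / (1 + b))"
      by (simp only: sum.distrib sum_distrib_right[symmetric] u(2) sum_constant)
    also have "\<dots> = real (card F) * (real k * (1 + a) + ((1 + a) * C - real k * (1 + a)) / (1 + b))"
      by (simp only: distrib_left)
    also have "real k * (1 + a) + ((1 + a) * C - real k * (1 + a)) / (1 + b) = (1 + a) * (real k * b + C) / (1 + b)"
      using b1 by (simp add: add_divide_eq_iff) (simp add: algebra_simps)
    finally show ?thesis .
  qed
  ultimately have "real (card F) * ((1 + a) * (real k * b + C) / (1 + b)) < real (card F) * (C - \<eta>)"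
    by (simp only:)
  then have "(1 + a) * (real k * b + C) / (1 + b) < C - \<eta>"
    by (rule mult_left_less_imp_less) simp
  then have "(1 + a) * (real k * b + C) < (C - \<eta>) * (1 + b)" using b1 by (simp add: pos_divide_less_eq)
  moreover have "0 \<le> a * (real k * b)" "0 \<le> \<eta> * b" using a ba \<eta> by auto
  ultimately show "b * (C - real k) \<ge> a * C + \<eta>" by (simp add: algebra_simps)
qed

lemma max_density_quadratic:
  assumes nb: "real (card F) * b \<le> 1/2"
  shows "real d * C / 2 * (real (card F) * b)\<^sup>2 > a + \<eta>"
proof -
  define n where "n = real (card F)"
  have n1: "n \<ge> 1" using F by (simp add: n_def Suc_le_eq card_gt_0_iff)
  have b0: "b \<ge> 0" using max_density_mono a by simp
  \<comment> \<open>The mean is 1 and no upward deviation exceeds \<open>b\<close>, so a downward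
    deviation is at most the sum of the others, hence at most \<open>n * b\<close>.\<close>
  have dev: "\<bar>u x - 1\<bar> \<le> n * b" if x: "x \<in> F" for x
  proof -
    have "(\<Sum>y\<in>F. u y - 1) = 0" using u(2) by (simp add: sum_subtractf)
    then have "u x - 1 = - (\<Sum>y\<in>F - {x}. u y - 1)" using F x by (simp add: sum.remove)
    moreover have "(\<Sum>y\<in>F - {x}. u y - 1) \<le> (\<Sum>y\<in>F - {x}. b)" using u(1) by (intro sum_mono) force
    moreover have "(\<Sum>y\<in>F - {x}. b) \<le> n * b"
      using F x b0 by (simp add: n_def mult_right_mono)
    moreover have "u x - 1 \<le> 1 * b" using u(1)[OF x] by simp
    moreover have "1 * b \<le> n * b" using n1 b0 by (rule mult_right_mono)
    ultimately show ?thesis by linarith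
  qed
  obtain m where m: "d = Suc m" using d by (cases d) auto
  \<comment> \<open>Second-order expansion around \<open>u x = 1\<close>. The linear term vanishes
    on summation, and the gain \<open>k * a\<close> from the larger partner set has to be offset by
    the quadratic loss.\<close>
  have low: "C + (1 + \<kappa>) ^ m * (u x - 1) - real d * C / 2 * (n * b)\<^sup>2 + real k * a
      \<le> (u x powr (1 / real d) + \<kappa> * (1 + a) powr (1 / real d)) ^ d" if x: "x \<in> F" for x
  proof -
    define v where "v = u x - 1"
    define p where "p = u x powr (1 / real d)"
    have v: "\<bar>v\<bar> \<le> n * b" using dev[OF x] by (simp add: v_def)
    have "1 + 1 / real d * v - v\<^sup>2 / 2 \<le> (1 + v) powr (1 / real d)"
      using v nb d by (intro powr_quadratic_lower_bound) (auto simp: n_def)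
    then have p: "1 + v / real d - v\<^sup>2 / 2 \<le> p" by (simp add: p_def v_def)
    have "(1 + \<kappa>) ^ Suc m + real (Suc m) * (1 + \<kappa>) ^ m * ((p + \<kappa>) - (1 + \<kappa>)) \<le> (p + \<kappa>) ^ Suc m"
      using \<kappa> by (intro power_tangent_le) (auto simp: p_def)
    then have "C + real d * (1 + \<kappa>) ^ m * (p - 1) \<le> (p + \<kappa>) ^ d" by (simp add: C m)
    moreover have "real d * (1 + \<kappa>) ^ m * (v / real d - v\<^sup>2 / 2) \<le> real d * (1 + \<kappa>) ^ m * (p - 1)"
      using p \<kappa> by (intro mult_left_mono) auto
    moreover have "real d * (1 + \<kappa>) ^ m * (v / real d - v\<^sup>2 / 2) = (1 + \<kappa>) ^ m * v - real d * (1 + \<kappa>) ^ m / 2 * v\<^sup>2"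
      using d by (simp add: field_simps)
    moreover have "real d * (1 + \<kappa>) ^ m / 2 * v\<^sup>2 \<le> real d * C / 2 * (n * b)\<^sup>2"
    proof (intro mult_mono)
      have "1 * (1 + \<kappa>) ^ m \<le> (1 + \<kappa>) * (1 + \<kappa>) ^ m" using \<kappa> by (intro mult_right_mono) auto
      then have "(1 + \<kappa>) ^ m \<le> C" by (simp add: C m)
      then show "real d * (1 + \<kappa>) ^ m / 2 \<le> real d * C / 2" by (simp add: mult_left_mono)
      show "v\<^sup>2 \<le> (n * b)\<^sup>2" using v by (metis abs_ge_zero power2_abs power_mono)
      show "0 \<le> real d * C / 2" using C_gt_k by simp
    qed simp
    moreover have "(p + \<kappa>) ^ d + real k * a \<le> (p + \<kappa> * (1 + a) powr (1 / real d)) ^ d"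
    proof -
      have "1 powr (1 / real d) \<le> (1 + a) powr (1 / real d)" using a by (intro powr_mono2) auto
      then have "\<kappa> * 1 \<le> \<kappa> * (1 + a) powr (1 / real d)" using \<kappa> by (intro mult_left_mono) auto
      then have "(p + \<kappa>) ^ d + (\<kappa> * (1 + a) powr (1 / real d)) ^ d - \<kappa> ^ d \<le> (p + \<kappa> * (1 + a) powr (1 / real d)) ^ d"
        using \<kappa> by (intro power_increment_mono) (auto simp: p_def)
      then show ?thesis unfolding scaled_root_power \<kappa>(2) by (simp add: algebra_simps)
    qed
    ultimately show ?thesis unfolding p_def v_def by linarith
  qed
  have "(\<Sum>x\<in>F. C + (1 + \<kappa>) ^ m * (u x - 1) - real d * C / 2 * (n * b)\<^sup>2 + real k * a) < n * (C - \<eta>)"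
    using sum_mono[OF low] fail unfolding n_def by (rule le_less_trans)
  moreover have "(\<Sum>x\<in>F. C + (1 + \<kappa>) ^ m * (u x - 1) - real d * C / 2 * (n * b)\<^sup>2 + real k * a)
      = n * (C - real d * C / 2 * (n * b)\<^sup>2 + real k * a)"
  proof -
    have "(\<Sum>x\<in>F. (1 + \<kappa>) ^ m * (u x - 1)) = 0"
      using u(2) by (simp add: sum_distrib_left[symmetric] sum_subtractf)
    then show ?thesis by (simp add: sum.distrib sum_subtractf n_def algebra_simps)
  qed
  ultimately have "C - real d * C / 2 * (n * b)\<^sup>2 + real k * a < C - \<eta>" using n1 by simp
  moreover have "1 * a \<le> real k * a" using k a by (intro mult_right_mono) auto
  ultimately show ?thesis unfolding n_def by linarith
qed

end

text \<open>With \<open>x = 1 / Q ^ Suc J\<close>, the first \<open>i + 1\<close> square-root steps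
  reach a constant multiple of \<open>x powr (1 / 2 ^ Suc i)\<close>. For
  \<open>Q \<le> \<rho> powr (2 ^ i)\<close> this is at least of order
  \<open>\<rho> powr (- Suc J / 2)\<close>, while the remaining steps multiply by \<rho> to nearly
  the power \<open>J\<close>. The number \<open>i\<close> depends on \<open>Q\<close> and \<rho>
  only.\<close>

lemma density_recursion_unbounded:
  fixes \<rho> Q c B :: real and q :: nat
  assumes \<rho>: "\<rho> > 1" and Q: "Q > 1" and c: "c > 0" and q: "q \<ge> 1"
  shows "\<exists>j0\<ge>2. \<forall>J\<ge>j0. \<forall>\<alpha> :: nat \<Rightarrow> real. (\<forall>j. 0 \<le> \<alpha> j) \<and>
    (\<forall>j\<in>{2..J}. \<rho> * \<alpha> (j - 1) \<le> \<alpha> j) \<and>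
    (\<forall>j\<in>{2..J}. min (1 / (2 * real q ^ j)) (sqrt (c * (\<alpha> (j - 1) + 1 / Q ^ Suc J)) / real q ^ j) \<le> \<alpha> j)
    \<longrightarrow> B < \<alpha> J"
proof -
  \<comment> \<open>\<open>e l\<close> is the constant in
    \<open>\<alpha> (2 + l) \<ge> e l * x powr (1 / 2 ^ Suc l)\<close>. The first branch of each
    minimum does no harm because \<open>x \<le> 1\<close>.\<close>
  define e where "e = rec_nat (min (1 / (2 * real q ^ 2)) (sqrt c / real q ^ 2))
    (\<lambda>i e. min (1 / (2 * real q ^ (3 + i))) (sqrt (c * e) / real q ^ (3 + i)))"
  have e0: "e 0 = min (1 / (2 * real q ^ 2)) (sqrt c / real q ^ 2)"
    and eS: "e (Suc i) = min (1 / (2 * real q ^ (3 + i))) (sqrt (c * e i) / real q ^ (3 + i))" for i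
    by (simp_all add: e_def)
  have epos: "e i > 0" for i
    by (induction i) (use c q in \<open>simp_all add: e0 eS\<close>)
  obtain i where i: "Q < \<rho> ^ i" using real_arch_pow[OF \<rho>] by blast
  have "i < 2 ^ i" by (rule less_exp)
  then have "\<rho> ^ i \<le> \<rho> ^ (2 ^ i)" using \<rho> by (intro power_increasing) auto
  moreover have "\<rho> ^ (2 ^ i) = \<rho> powr (2 ^ i)" using powr_realpow[of \<rho> "2 ^ i"] \<rho> by simp
  ultimately have Qi: "Q \<le> \<rho> powr (2 ^ i)" using i by linarith
  obtain n where n: "B / e i < (\<rho> powr (1/2)) ^ n"
    using real_arch_pow[of "\<rho> powr (1/2)"] \<rho> by (metis gr_one_powr half_gt_zero_iff zero_less_one)
  \<comment> \<open>With \<open>l = J - 2 - i\<close> geometric steps left,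
    \<open>l - (J + 1) / 2\<close> equals \<open>(J - 5 - 2 * i) / 2\<close>, which is at least
    \<open>n / 2\<close>.\<close>
  define j0 where "j0 = n + 5 + 2 * i"
  have main: "B < \<alpha> J" if J: "J \<ge> j0" and nn: "\<And>j. 0 \<le> \<alpha> j"
      and R1: "\<And>j. j \<in> {2..J} \<Longrightarrow> \<rho> * \<alpha> (j - 1) \<le> \<alpha> j"
      and R2: "\<And>j. j \<in> {2..J} \<Longrightarrow> min (1 / (2 * real q ^ j)) (sqrt (c * (\<alpha> (j - 1) + 1 / Q ^ Suc J)) / real q ^ j) \<le> \<alpha> j"
    for J and \<alpha> :: "nat \<Rightarrow> real"
  proof -
    define x where "x = 1 / Q ^ Suc J"
    have x: "0 < x" "x \<le> 1" using Q by (auto simp: x_def divide_le_eq one_le_power simp del: power_Suc)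
    have low: "e l * x powr (1 / 2 ^ Suc l) \<le> \<alpha> (2 + l)" if "2 + l \<le> J" for l
      using that
    proof (induction l)
      case 0
      have sx: "sqrt x \<le> 1" using x by simp
      have "e 0 * sqrt x \<le> min (1 / (2 * real q ^ 2)) (sqrt (c * (\<alpha> 1 + x)) / real q ^ 2)"
      proof (rule min.boundedI)
        have "e 0 * sqrt x \<le> e 0 * 1" using sx epos[of 0] by (intro mult_left_mono) auto
        then show "e 0 * sqrt x \<le> 1 / (2 * real q ^ 2)" by (simp add: e0)
        have "e 0 * sqrt x \<le> sqrt c / real q ^ 2 * sqrt x" using x by (intro mult_right_mono) (auto simp: e0)
        also have "\<dots> = sqrt (c * x) / real q ^ 2" by (simp add: real_sqrt_mult)
        also have "\<dots> \<le> sqrt (c * (\<alpha> 1 + x)) / real q ^ 2"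
          using nn[of 1] c by (intro divide_right_mono real_sqrt_le_mono mult_left_mono) auto
        finally show "e 0 * sqrt x \<le> sqrt (c * (\<alpha> 1 + x)) / real q ^ 2" .
      qed
      also have "\<dots> \<le> \<alpha> 2" using R2[of 2] 0 by (simp add: x_def)
      finally show ?case using x by (simp add: powr_half_sqrt)
    next
      case (Suc l)
      define y where "y = x powr (1 / 2 ^ Suc l)"
      have y: "0 < y" "y \<le> 1" using x powr_mono2[of "1 / 2 ^ Suc l" x 1] by (auto simp: y_def)
      have IH: "e l * y \<le> \<alpha> (2 + l)" using Suc by (simp add: y_def)
      have "e (Suc l) * sqrt y \<le> min (1 / (2 * real q ^ (3 + l))) (sqrt (c * (\<alpha> (2 + l) + x)) / real q ^ (3 + l))"
      proof (rule min.boundedI)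
        have "e (Suc l) * sqrt y \<le> e (Suc l) * 1" using y epos[of "Suc l"] by (intro mult_left_mono) auto
        then show "e (Suc l) * sqrt y \<le> 1 / (2 * real q ^ (3 + l))" by (simp add: eS)
        have "e (Suc l) * sqrt y \<le> sqrt (c * e l) / real q ^ (3 + l) * sqrt y"
          using y by (intro mult_right_mono) (auto simp: eS)
        also have "\<dots> = sqrt (c * (e l * y)) / real q ^ (3 + l)" by (simp add: real_sqrt_mult)
        also have "\<dots> \<le> sqrt (c * (\<alpha> (2 + l) + x)) / real q ^ (3 + l)"
          using IH x c by (intro divide_right_mono real_sqrt_le_mono mult_left_mono) auto
        finally show "e (Suc l) * sqrt y \<le> sqrt (c * (\<alpha> (2 + l) + x)) / real q ^ (3 + l)" .
      qed
      also have "\<dots> \<le> \<alpha> (3 + l)" using R2[of "3 + l"] Suc.prems by (simp add: x_def)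
      also have "sqrt y = x powr (1 / 2 ^ Suc (Suc l))"
        using y by (simp add: powr_half_sqrt[symmetric] y_def powr_powr)
      finally show ?case by (simp add: numeral_3_eq_3)
    qed
    have grow: "\<rho> ^ l * \<alpha> (2 + i) \<le> \<alpha> (2 + i + l)" if "2 + i + l \<le> J" for l
      using that
    proof (induction l)
      case (Suc l)
      have "\<rho> ^ Suc l * \<alpha> (2 + i) = \<rho> * (\<rho> ^ l * \<alpha> (2 + i))" by simp
      also have "\<dots> \<le> \<rho> * \<alpha> (2 + i + l)" using Suc \<rho> by (intro mult_left_mono) auto
      also have "\<dots> \<le> \<alpha> (2 + i + Suc l)" using R1[of "2 + i + Suc l"] Suc.prems by simp
      finally show ?case .
    qed simp
    define l where "l = J - 2 - i"
    have l: "J = 2 + i + l" using J by (simp add: l_def j0_def)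
    have xlow: "\<rho> powr (- (real (Suc J) / 2)) \<le> x powr (1 / 2 ^ Suc i)"
    proof -
      have "Q ^ Suc J \<le> (\<rho> powr (2 ^ i)) ^ Suc J" using Qi Q by (intro power_mono) auto
      also have "\<dots> = \<rho> powr (2 ^ i * real (Suc J))"
        using \<rho> by (simp add: powr_realpow[symmetric] powr_powr del: of_nat_Suc power_Suc)
      finally have "\<rho> powr (- (2 ^ i * real (Suc J))) \<le> x"
        using Q \<rho> by (simp add: x_def powr_minus field_simps del: of_nat_Suc power_Suc)
      then have "(\<rho> powr (- (2 ^ i * real (Suc J)))) powr (1 / 2 ^ Suc i) \<le> x powr (1 / 2 ^ Suc i)"
        by (intro powr_mono2) auto
      then show ?thesis by (simp add: powr_powr)
    qed
    have "B < e i * (\<rho> powr (1/2)) ^ n" using n epos[of i] by (simp add: divide_less_eq mult.commute)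
    also have "\<dots> = e i * \<rho> powr (real n / 2)" using \<rho> by (simp add: powr_realpow[symmetric] powr_powr)
    also have "\<dots> \<le> e i * \<rho> powr (real l + (- (real (Suc J) / 2)))"
      using epos[of i] \<rho> J l by (intro mult_left_mono powr_mono) (auto simp: j0_def field_simps)
    also have "\<dots> = \<rho> ^ l * (e i * \<rho> powr (- (real (Suc J) / 2)))"
      using \<rho> by (simp only: powr_add powr_realpow[of \<rho> l] less_trans[OF zero_less_one \<rho>] ac_simps)
    also have "\<dots> \<le> \<rho> ^ l * (e i * x powr (1 / 2 ^ Suc i))"
      using \<rho> epos[of i] xlow by (intro mult_left_mono) auto
    also have "\<dots> \<le> \<rho> ^ l * \<alpha> (2 + i)"
      using \<rho> low[of i] l by (intro mult_left_mono) auto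
    also have "\<dots> \<le> \<alpha> J" using grow[of l] l by simp
    finally show ?thesis .
  qed
  have "2 \<le> j0" by (simp add: j0_def)
  then show ?thesis
    by (intro exI[of _ j0] conjI allI impI; (elim conjE)?) (assumption | rule main | blast)+
qed

section \<open>Residue classes modulo powers of the matrix\<close>

text \<open>Concavity of the power \<open>1 - \<sigma>\<close>, obtained from Young's inequality
  against the mean \<open>m\<close>. It bounds the total error when a set is split into
  classes.\<close>

lemma sum_powr_le:
  fixes f :: "'a \<Rightarrow> real"
  assumes "finite F" "F \<noteq> {}" "\<And>x. x \<in> F \<Longrightarrow> f x > 0" "0 \<le> \<sigma>" "\<sigma> \<le> 1"
  shows "(\<Sum>x\<in>F. f x powr (1 - \<sigma>)) \<le> real (card F) powr \<sigma> * (\<Sum>x\<in>F. f x) powr (1 - \<sigma>)"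
proof -
  define N where "N = (\<Sum>x\<in>F. f x)"
  define n where "n = real (card F)"
  have N: "N > 0" unfolding N_def using assms by (intro sum_pos) auto
  have n: "n > 0" using assms by (simp add: n_def card_gt_0_iff)
  define m where "m = N / n"
  have m: "m > 0" using N n by (simp add: m_def)
  have "m powr \<sigma> * (\<Sum>x\<in>F. f x powr (1 - \<sigma>)) = (\<Sum>x\<in>F. f x powr (1 - \<sigma>) * m powr \<sigma>)"
    by (simp add: sum_distrib_left mult.commute)
  also have "\<dots> \<le> (\<Sum>x\<in>F. (1 - \<sigma>) * f x + \<sigma> * m)"
    using assms m by (intro sum_mono Youngs_inequality_0) auto
  also have "\<dots> = (1 - \<sigma>) * N + \<sigma> * (n * m)"
    by (simp add: sum.distrib sum_distrib_left[symmetric] N_def n_def)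
  also have "\<dots> = N" using n by (simp add: m_def algebra_simps)
  finally have "(\<Sum>x\<in>F. f x powr (1 - \<sigma>)) \<le> N / m powr \<sigma>"
    using m by (simp add: pos_le_divide_eq mult.commute)
  also have "\<dots> = N * n powr \<sigma> / N powr \<sigma>" using N n by (simp add: m_def powr_divide)
  also have "\<dots> = n powr \<sigma> * (N powr 1 / N powr \<sigma>)" using N by simp
  also have "N powr 1 / N powr \<sigma> = N powr (1 - \<sigma>)" by (simp only: powr_diff)
  finally show ?thesis by (simp add: N_def n_def)
qed

lemma sum_card_le_of_disjoint:
  fixes T :: "'c \<Rightarrow> 'a set"
  assumes "finite S" "finite F" "\<And>c. c \<in> F \<Longrightarrow> T c \<subseteq> S"
    "\<And>c c' z. c \<in> F \<Longrightarrow> c' \<in> F \<Longrightarrow> z \<in> T c \<Longrightarrow> z \<in> T c' \<Longrightarrow> c = c'"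
  shows "(\<Sum>c\<in>F. card (T c)) \<le> card S"
proof -
  have "(\<Sum>c\<in>F. card (T c)) = card (\<Union>c\<in>F. T c)"
    using assms finite_subset by (subst card_UN_disjoint) (auto, blast)
  also have "\<dots> \<le> card S" using assms by (intro card_mono) auto
  finally show ?thesis .
qed

locale dilate_classes =
  fixes L :: "int^'n::finite^'n" and k :: nat and A :: "(int^'n) set"
  assumes irr: "irreducible_mat L" and detk: "\<bar>det L\<bar> = int k" and k1: "k \<ge> 1"
    and finA: "finite A" and cardA: "card A \<ge> 2"
begin

definition lat :: "(int^'n) set" where
  "lat = \<Inter> {S. invariant_lattice L S \<and> (\<forall>a\<in>A. \<forall>b\<in>A. a - b \<in> S)}"

lemma lat_mem: "a \<in> A \<Longrightarrow> b \<in> A \<Longrightarrow> a - b \<in> lat"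
  by (auto simp: lat_def)

lemma lat_min: "invariant_lattice L S \<Longrightarrow> (\<And>a b. a \<in> A \<Longrightarrow> b \<in> A \<Longrightarrow> a - b \<in> S) \<Longrightarrow> lat \<subseteq> S"
  by (auto simp: lat_def)

lemma lat_invariant: "invariant_lattice L lat"
  unfolding invariant_lattice_def lat_def by blast

lemma inj_L: "inj ((*v) L)"
  using detk k1 by (intro inj_matrix_int) auto

lemma L_diff: "L *v (x - y) = L *v x - L *v y"
  using matrix_int_add[of L "x - y" y] by simp

definition K :: "nat \<Rightarrow> (int^'n) set" where
  "K j = (((*v) L) ^^ j) ` lat"

lemma K_0: "K 0 = lat" and K_Suc: "K (Suc j) = (*v) L ` K j"
  by (simp_all add: K_def image_image)

lemma K_invariant: "invariant_lattice L (K j)"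
  by (induction j) (simp_all add: K_0 K_Suc lat_invariant invariant_lattice_image)

lemmas K_zero = invariant_latticeD(1)[OF K_invariant]
  and K_diff = invariant_latticeD(2)[OF K_invariant]
  and K_minus = invariant_latticeD(4)[OF K_invariant]
  and K_add = invariant_latticeD(5)[OF K_invariant]

lemma L_mem_K_Suc: "L *v x \<in> K (Suc j) \<longleftrightarrow> x \<in> K j"
  unfolding K_Suc using inj_L by (simp add: inj_image_mem_iff)

lemma K_Suc_subset: "K (Suc j) \<subseteq> K j"
  unfolding K_Suc using invariant_latticeD(3)[OF K_invariant] by blast

lemma K_subset_lat: "K j \<subseteq> lat"
  by (induction j) (use K_0 K_Suc_subset in auto)

lemma K_sym: "x - y \<in> K j \<Longrightarrow> y - x \<in> K j"
  using K_minus[of "x - y" j] by simp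

lemma K_trans: "x - y \<in> K j \<Longrightarrow> y - z \<in> K j \<Longrightarrow> x - z \<in> K j"
  using K_add[of "x - y" j "y - z"] by simp

lemma funpow_diff: "(((*v) L) ^^ j) (x - y) = (((*v) L) ^^ j) x - (((*v) L) ^^ j) y"
  by (induction j) (simp_all add: L_diff)

lemma funpow_mem_K: "(((*v) L) ^^ j) x \<in> K (j + i) \<longleftrightarrow> x \<in> K i"
  by (induction j) (simp_all add: L_mem_K_Suc)

text \<open>\<open>L\<close> is nilpotent modulo \<open>K j\<close>.\<close>

lemma one_plus_L_mem_K: "v \<in> lat \<Longrightarrow> v + L *v v \<in> K j \<Longrightarrow> v \<in> K j"
proof (induction j)
  case (Suc j)
  then have "v \<in> K j" using K_Suc_subset by blast
  then have "L *v v \<in> K (Suc j)" by (simp add: L_mem_K_Suc)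
  then have "(v + L *v v) - L *v v \<in> K (Suc j)" using Suc.prems(2) by (intro K_diff)
  then show ?case by simp
qed (simp add: K_0)

text \<open>\<open>x\<close> need not belong to \<open>A\<close>, so a coset missed by
  \<open>A\<close> is a class of size 0; \<open>F\<close> below lists only the non-empty
  classes.\<close>

definition cl :: "nat \<Rightarrow> int^'n \<Rightarrow> (int^'n) set" where
  "cl j x = {a\<in>A. a - x \<in> K j}"

definition F :: "nat \<Rightarrow> (int^'n) set set" where
  "F j = cl j ` A"

lemma cl_subset: "cl j x \<subseteq> A" and finite_cl: "finite (cl j x)"
  using finA by (auto simp: cl_def)

lemma mem_cl_self: "a \<in> A \<Longrightarrow> a \<in> cl j a"
  using K_zero by (simp add: cl_def)

lemma cl_cong: "x - y \<in> K j \<Longrightarrow> cl j x = cl j y"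
  unfolding cl_def using K_trans K_sym by blast

lemma cl_eqD: "a \<in> A \<Longrightarrow> cl j a = cl j b \<Longrightarrow> a - b \<in> K j"
  using mem_cl_self[of a j] by (simp add: cl_def)

lemma finite_F: "finite (F j)" and F_ne: "F j \<noteq> {}"
  using finA cardA by (auto simp: F_def)

lemma F_props: "c \<in> F j \<Longrightarrow> c \<subseteq> A \<and> c \<noteq> {} \<and> finite c \<and> card c > 0"
  unfolding F_def using cl_subset finite_cl mem_cl_self by (fastforce simp: card_gt_0_iff)

lemma F_disjoint: "c \<in> F j \<Longrightarrow> c' \<in> F j \<Longrightarrow> x \<in> c \<Longrightarrow> x \<in> c' \<Longrightarrow> c = c'"
  unfolding F_def cl_def[of j] by (auto dest: K_sym K_trans)

lemma Union_F: "\<Union> (F j) = A"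
  unfolding F_def using cl_subset mem_cl_self by blast

lemma sum_card_F: "(\<Sum>c\<in>F j. card c) = card A"
proof -
  have "card (\<Union> (F j)) = (\<Sum>c\<in>F j. card c)"
    using F_disjoint F_props by (intro card_Union_disjoint) (auto simp: pairwise_def disjnt_iff)
  then show ?thesis by (simp add: Union_F)
qed

lemma card_F_pos: "card (F j) > 0"
  using finite_F F_ne by (simp add: card_gt_0_iff)

lemma transversal_K1: obtains R where "transversal lat (K (Suc 0)) R" "card R = k"
proof -
  obtain a b where ab: "a \<in> A" "b \<in> A" "a \<noteq> b"
    using cardA by (metis card_le_Suc0_iff_eq finA not_less_eq_eq numeral_2_eq_2)
  have "det L \<noteq> 0" using detk k1 by auto
  from invariant_lattice_index[OF irr this lat_invariant lat_mem[OF ab(1,2)]] ab(3)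
  obtain R where "transversal lat ((*v) L ` lat) R" "int (card R) = \<bar>det L\<bar>" by auto
  then show ?thesis using that[of R] detk by (simp add: K_Suc K_0)
qed

text \<open>Each coset of level \<open>j\<close> splits into \<open>k\<close> cosets of the next
  level, shifted by the images of a transversal of \<open>lat\<close> modulo its image. Each of them
  gives at most one class, and exactly one if \<open>A\<close> meets it.\<close>

lemma card_F_Suc:
  "card (F (Suc j)) \<le> k * card (F j)"
  "(\<And>a v. a \<in> A \<Longrightarrow> v \<in> K j \<Longrightarrow> \<exists>w\<in>A. w - (a + v) \<in> K (Suc j)) \<Longrightarrow> card (F (Suc j)) = k * card (F j)"
proof -
  obtain R where R: "transversal lat (K (Suc 0)) R" "card R = k" by (rule transversal_K1)
  have finR: "finite R" and RL: "R \<subseteq> lat" using R by (auto simp: transversal_def)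
  define rep where "rep c = (SOME a. a \<in> c)" for c :: "(int^'n) set"
  have rep: "rep c \<in> c" if "c \<in> F j" for c
    using F_props[OF that] unfolding rep_def by (metis some_in_eq)
  have repA: "rep c \<in> A" if "c \<in> F j" for c using rep F_props that by blast
  have clrep: "cl j (rep c) = c" if c: "c \<in> F j" for c
    by (rule F_disjoint[of _ j _ "rep c"]) (use c rep repA mem_cl_self in \<open>auto simp: F_def\<close>)
  define g where "g = (\<lambda>(c, r). cl (Suc j) (rep c + (((*v) L) ^^ j) r))"
  have sub: "F (Suc j) \<subseteq> g ` (F j \<times> R)"
  proof
    fix c' assume "c' \<in> F (Suc j)"
    then obtain a where a: "a \<in> A" "c' = cl (Suc j) a" by (auto simp: F_def)
    define c where "c = cl j a"
    have c: "c \<in> F j" using a by (simp add: c_def F_def)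
    have "a - rep c \<in> K j" using rep[OF c] by (intro K_sym[of "rep c"]) (simp add: c_def cl_def)
    then obtain v where v: "v \<in> lat" "a - rep c = (((*v) L) ^^ j) v" by (auto simp: K_def)
    obtain r where r: "r \<in> R" "v - r \<in> K (Suc 0)" using R(1) v(1) unfolding transversal_def by blast
    have "(((*v) L) ^^ j) (v - r) \<in> K (j + Suc 0)" using r by (simp only: funpow_mem_K)
    then have "a - (rep c + (((*v) L) ^^ j) r) \<in> K (Suc j)"
      using v(2) by (simp add: funpow_diff diff_diff_eq[symmetric])
    then have "c' = g (c, r)" unfolding a(2) g_def by (simp add: cl_cong)
    then show "c' \<in> g ` (F j \<times> R)" using c r by blast
  qed
  have "card (F (Suc j)) \<le> card (g ` (F j \<times> R))"
    using sub finite_F finR by (intro card_mono) auto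
  also have "\<dots> \<le> card (F j \<times> R)" using finite_F finR by (intro card_image_le) auto
  finally show "card (F (Suc j)) \<le> k * card (F j)" using R(2) by (simp add: card_cartesian_product mult.commute)
  assume full: "\<And>a v. a \<in> A \<Longrightarrow> v \<in> K j \<Longrightarrow> \<exists>w\<in>A. w - (a + v) \<in> K (Suc j)"
  have wit: "\<exists>w\<in>A. w - (rep c + (((*v) L) ^^ j) r) \<in> K (Suc j)" if "c \<in> F j" "r \<in> R" for c r
    using full[OF repA[OF that(1)], of "(((*v) L) ^^ j) r"] that(2) RL by (auto simp: K_def)
  have "inj_on g (F j \<times> R)"
  proof (rule inj_onI, clarify)
    fix c r c' r' assume cr: "c \<in> F j" "r \<in> R" "c' \<in> F j" "r' \<in> R" and eq: "g (c, r) = g (c', r')"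
    obtain w where w: "w \<in> A" "w - (rep c + (((*v) L) ^^ j) r) \<in> K (Suc j)" using wit cr by blast
    then have "w \<in> g (c, r)" by (simp add: g_def cl_def)
    then have "w \<in> g (c', r')" by (simp only: eq)
    then have "w - (rep c' + (((*v) L) ^^ j) r') \<in> K (Suc j)" by (simp add: g_def cl_def)
    then have d: "(rep c + (((*v) L) ^^ j) r) - (rep c' + (((*v) L) ^^ j) r') \<in> K (Suc j)"
      using w K_sym K_trans by blast
    have rK: "(((*v) L) ^^ j) x \<in> K j" if "x \<in> R" for x using that RL by (auto simp: K_def)
    have "(rep c + (((*v) L) ^^ j) r) - (rep c' + (((*v) L) ^^ j) r') \<in> K j"
      using d K_Suc_subset by blast
    from K_diff[OF this K_diff[OF rK[OF cr(2)] rK[OF cr(4)]]]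
    have "rep c - rep c' \<in> K j" by (simp add: algebra_simps)
    then have "cl j (rep c) = cl j (rep c')" by (rule cl_cong)
    then have cc: "c = c'" using clrep cr by simp
    then have "(((*v) L) ^^ j) (r - r') \<in> K (j + Suc 0)" using d by (simp add: funpow_diff)
    then have "r - r' \<in> K (Suc 0)" by (simp only: funpow_mem_K)
    moreover have "r - r \<in> K (Suc 0)" using K_zero by simp
    ultimately have "r = r'" using R(1) cr RL unfolding transversal_def by blast
    then show "c = c' \<and> r = r'" using cc by simp
  qed
  moreover have "g ` (F j \<times> R) \<subseteq> F (Suc j)"
  proof clarify
    fix c r assume cr: "c \<in> F j" "r \<in> R"
    obtain w where w: "w \<in> A" "w - (rep c + (((*v) L) ^^ j) r) \<in> K (Suc j)" using wit cr by blast
    have "g (c, r) = cl (Suc j) w" unfolding g_def using cl_cong[OF K_sym[OF w(2)]] by simp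
    then show "g (c, r) \<in> F (Suc j)" using w by (simp add: F_def)
  qed
  then have "g ` (F j \<times> R) = F (Suc j)" using sub by blast
  ultimately show "card (F (Suc j)) = k * card (F j)"
    using R(2) by (metis card_cartesian_product card_image mult.commute)
qed

lemma card_F_le: "card (F j) \<le> k ^ j"
proof (induction j)
  case 0
  have "cl 0 a = A" if "a \<in> A" for a using that lat_mem by (auto simp: cl_def K_0)
  then have "F 0 \<subseteq> {A}" by (auto simp: F_def)
  then show ?case using card_mono[of "{A}" "F 0"] by simp
next
  case (Suc j)
  then show ?case using card_F_Suc(1)[of j] by (metis le_trans mult_le_mono2 power_Suc)
qed

text \<open>On one class of level \<open>j\<close> the values of \<open>L\<close> agree modulo
  \<open>K (Suc j)\<close>. Adding them to a class of level \<open>Suc j\<close> therefore stays in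
  one coset, which determines that class.\<close>

lemma sum_card_class_sums:
  assumes b: "b \<in> A"
  shows "(\<Sum>c\<in>F (Suc j). card (c + (*v) L ` cl j b)) \<le> card (A + (*v) L ` A)"
proof (rule sum_card_le_of_disjoint)
  show "finite (A + (*v) L ` A)" using finA by (simp add: finite_set_plus)
  show "c + (*v) L ` cl j b \<subseteq> A + (*v) L ` A" if "c \<in> F (Suc j)" for c
    using F_props[OF that] cl_subset by (intro set_plus_mono2 image_mono) auto
  fix c c' z assume c: "c \<in> F (Suc j)" "c' \<in> F (Suc j)" and z: "z \<in> c + (*v) L ` cl j b" "z \<in> c' + (*v) L ` cl j b"
  have one: "\<exists>x\<in>c. z - L *v b - x \<in> K (Suc j)" if zc: "z \<in> c + (*v) L ` cl j b" for c
  proof -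
    obtain x y where xy: "x \<in> c" "y \<in> cl j b" "z = x + L *v y" using zc by (auto simp: set_plus_def)
    have "L *v (y - b) \<in> K (Suc j)" using xy(2) by (simp add: L_mem_K_Suc cl_def)
    then show ?thesis using xy by (intro bexI[of _ x]) (simp_all add: L_diff)
  qed
  obtain x x' where x: "x \<in> c" "z - L *v b - x \<in> K (Suc j)" and x': "x' \<in> c'" "z - L *v b - x' \<in> K (Suc j)"
    using one[OF z(1)] one[OF z(2)] by blast
  have xx: "x - x' \<in> K (Suc j)" using x(2) x'(2) K_sym K_trans by blast
  have "x \<in> A" "x' \<in> A" using x x' c F_props by blast+
  then have "c = cl (Suc j) x" "c' = cl (Suc j) x'"
    using F_disjoint[of _ "Suc j"] mem_cl_self x x' c by (auto simp: F_def)
  then show "c = c'" using cl_cong[OF xx] by simp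
qed (rule finite_F)

end

section \<open>Minimal counterexamples\<close>

locale minimal_counterexample = dilate_classes L k A
  for L :: "int^'n::finite^'n" and k :: nat and A :: "(int^'n) set" +
  fixes \<kappa> C D \<sigma> :: real
  assumes \<kappa>_def: "\<kappa> = real k powr (1 / real CARD('n))" and C_def: "C = (1 + \<kappa>) ^ CARD('n)"
    and D0: "D > 0" and \<sigma>0: "0 < \<sigma>" "\<sigma> \<le> 1"
    and IH: "\<And>B. finite B \<Longrightarrow> card B < card A \<Longrightarrow>
      C * real (card B) - D * real (card B) powr (1 - \<sigma>) \<le> real (card (B + (*v) L ` B))"
    and fail: "real (card (A + (*v) L ` A)) < C * real (card A) - D * real (card A) powr (1 - \<sigma>)"
begin

abbreviation N :: real where "N \<equiv> real (card A)"

text \<open>The deficit relative to \<open>N\<close>: \<open>fail\<close> says that the dilate sum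
  has fewer than \<open>(C - \<delta>) * N\<close> elements.\<close>

definition \<delta> :: real where "\<delta> = D * N powr (- \<sigma>)"

lemma N_pos: "N > 0" using cardA by simp

lemma \<delta>_N: "D * N powr (1 - \<sigma>) = \<delta> * N"
proof -
  have "N powr (1 - \<sigma>) = N powr (- \<sigma>) * N powr 1" by (simp only: powr_add[symmetric]) simp
  then show ?thesis using N_pos by (simp add: \<delta>_def)
qed

lemma \<delta>_pos: "\<delta> > 0" using D0 N_pos by (simp add: \<delta>_def)

lemma \<kappa>_ge_1: "\<kappa> \<ge> 1" unfolding \<kappa>_def using k1 by (intro ge_one_powr_ge_zero) auto

lemma \<kappa>_power: "\<kappa> ^ CARD('n) = real k"
  unfolding \<kappa>_def by (rule powr_inverse_power) auto

lemma C_ge_2: "C \<ge> 2"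
proof -
  have "(2::real) ^ 1 \<le> 2 ^ CARD('n)" by (intro power_increasing) (auto simp: Suc_le_eq)
  also have "\<dots> \<le> C" unfolding C_def using \<kappa>_ge_1 by (intro power_mono) auto
  finally show ?thesis by simp
qed

lemma \<delta>_less_C: "\<delta> < C"
proof -
  have "\<delta> * N < C * N" using fail \<delta>_N of_nat_0_le_iff[of "card (A + (*v) L ` A)"] by linarith
  then show ?thesis using N_pos by simp
qed

lemma error_mono: "x \<le> card A \<Longrightarrow> D * real x powr (1 - \<sigma>) \<le> D * N powr (1 - \<sigma>)"
  using D0 \<sigma>0 by (intro mult_left_mono powr_mono2) auto

lemma finite_sum: "finite (A + (*v) L ` A)"
  using finA by (simp add: finite_set_plus)

text \<open>Guaranteed class size at level \<open>j\<close>, starting with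
  \<open>\<theta> 1 = N / C\<close>. The factor \<open>2 * C\<close> per level makes deleting a
  class below \<open>\<theta> (Suc j)\<close> cost at most \<open>\<theta> j / 2\<close> in the
  bound.\<close>

definition \<theta> :: "nat \<Rightarrow> real" where "\<theta> j = 2 * N / (2 * C) ^ j"

lemma \<theta>_Suc: "2 * C * \<theta> (Suc j) = \<theta> j"
  using C_ge_2 by (simp add: \<theta>_def)

lemma \<theta>_pos: "\<theta> j > 0"
  using C_ge_2 N_pos by (simp add: \<theta>_def)

text \<open>Deleting a class modulo \<open>L\<close> that is too small would cost at least \<open>card A\<close> sums.\<close>

lemma level_one_large:
  assumes a: "a \<in> A"
  shows "\<theta> 1 \<le> real (card (cl 1 a))"
proof (rule ccontr)
  assume "\<not> ?thesis"
  then have small: "C * real (card (cl 1 a)) < N" using C_ge_2 by (simp add: \<theta>_def field_simps)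
  define c where "c = cl 1 a"
  define B where "B = A - c"
  have cA: "c \<subseteq> A" "finite c" "a \<in> c" using cl_subset finite_cl mem_cl_self a by (auto simp: c_def)
  have BA: "B \<subseteq> A" "finite B" using finA by (auto simp: B_def)
  have cardB: "card B = card A - card c" "card c \<le> card A" "card c > 0"
    using cA finA card_mono by (auto simp: B_def card_Diff_subset card_gt_0_iff)
  \<comment> \<open>\<open>L\<close> is constant on \<open>A\<close> modulo \<open>K 1\<close>, so
    sums over \<open>B\<close> and over \<open>c\<close> lie in different cosets modulo
    \<open>K 1\<close>.\<close>
  have disj: "(B + (*v) L ` B) \<inter> (c + (*v) L ` A) = {}"
  proof (rule ccontr)
    assume "\<not> ?thesis"
    then obtain b b' x a' where *: "b \<in> B" "b' \<in> B" "x \<in> c" "a' \<in> A" "b + L *v b' = x + L *v a'"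
      by (auto simp: set_plus_def)
    have "b' \<in> A" using * BA by blast
    then have "L *v (a' - b') \<in> K (Suc 0)" unfolding L_mem_K_Suc K_0 using lat_mem * by blast
    moreover have "b - x = L *v (a' - b')" using *(5) by (simp add: L_diff algebra_simps)
    ultimately have "b - x \<in> K 1" by simp
    moreover have "x - a \<in> K 1" using *(3) by (simp add: c_def cl_def)
    ultimately have "b - a \<in> K 1" by (rule K_trans)
    then have "b \<in> c" using * BA by (auto simp: c_def cl_def)
    then show False using * by (simp add: B_def)
  qed
  have "card (B + (*v) L ` B) + card (c + (*v) L ` A) = card ((B + (*v) L ` B) \<union> (c + (*v) L ` A))"
    using disj BA cA finA by (intro card_Un_disjoint[symmetric] finite_set_plus) auto
  also have "\<dots> \<le> card (A + (*v) L ` A)"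
    using BA cA finite_sum by (intro card_mono Un_least set_plus_mono2 image_mono) auto
  finally have "card (B + (*v) L ` B) + card (c + (*v) L ` A) \<le> card (A + (*v) L ` A)" .
  moreover have "card A \<le> card (c + (*v) L ` A)"
    using card_sumset_ge_left[of "(*v) L ` A" c a] cA finA card_image[OF inj_on_subset[OF inj_L subset_UNIV], of A]
    by (simp add: add.commute)
  ultimately have "real (card (B + (*v) L ` B)) + N \<le> real (card (A + (*v) L ` A))" by linarith
  moreover have "C * real (card B) - D * real (card B) powr (1 - \<sigma>) \<le> real (card (B + (*v) L ` B))"
    using cardB BA by (intro IH) auto
  ultimately have "C * real (card B) + N < C * N - D * N powr (1 - \<sigma>) + D * real (card B) powr (1 - \<sigma>)"
    using fail by linarith
  also have "\<dots> \<le> C * N" using error_mono[of "card B"] cardB by simp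
  also have "real (card B) = N - real (card c)" using cardB by (simp add: of_nat_diff)
  finally show False using small by (simp add: c_def algebra_simps)
qed

text \<open>If the class of \<open>y0\<close> is removed from the class \<open>c0\<close> of \<open>a0\<close>, then translating \<open>c0\<close> by some
  \<open>L w0 - L a0\<close> must leave it again.\<close>

lemma escaping_translate:
  assumes j: "j \<ge> 1" and a0: "a0 \<in> A" and v: "v \<in> K j"
    and prev: "j \<ge> 2 \<Longrightarrow> (\<And>a v. a \<in> A \<Longrightarrow> v \<in> K (j - 1) \<Longrightarrow> \<exists>w\<in>A. w - (a + v) \<in> K j)"
    and P: "P = cl j a0 - cl (Suc j) (a0 + v)" "P \<noteq> {}"
  shows "\<exists>p\<in>P. \<exists>w0\<in>A. w0 - a0 \<in> K (j - 1) \<and> (\<forall>p1\<in>P. p1 - (p + L *v (w0 - a0)) \<notin> K (Suc j))"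
proof (cases "j \<ge> 2")
  case True
  \<comment> \<open>Since the previous level is populated, \<open>w0\<close> can be chosen so that
    \<open>p + L (w0 - a0)\<close> is congruent to \<open>a0 + v\<close> modulo
    \<open>K (Suc j)\<close>; this is exactly the removed coset.\<close>
  obtain p where p: "p \<in> P" using P(2) by blast
  have "p - a0 \<in> K j" using p P by (simp add: cl_def)
  then have "(a0 + v) - p \<in> K j" using K_diff[OF v \<open>p - a0 \<in> K j\<close>] by (simp add: algebra_simps)
  moreover have "j = Suc (j - 1)" using j by simp
  ultimately obtain v' where v': "v' \<in> K (j - 1)" "(a0 + v) - p = L *v v'" using K_Suc[of "j - 1"] by auto
  obtain w0 where w0: "w0 \<in> A" "w0 - (a0 + v') \<in> K j" using prev[OF True a0 v'(1)] by blast
  have "w0 - a0 = (w0 - (a0 + v')) + v'" by simp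
  then have "w0 - a0 \<in> K (j - 1)"
    using w0(2) v'(1) K_Suc_subset[of "j - 1"] \<open>j = Suc (j - 1)\<close> by (metis K_add subsetD)
  moreover have "p1 - (p + L *v (w0 - a0)) \<notin> K (Suc j)" if p1: "p1 \<in> P" for p1
  proof
    assume h: "p1 - (p + L *v (w0 - a0)) \<in> K (Suc j)"
    have "L *v (w0 - (a0 + v')) \<in> K (Suc j)" using w0(2) by (simp add: L_mem_K_Suc)
    then have "(p1 - (p + L *v (w0 - a0))) + L *v (w0 - (a0 + v')) \<in> K (Suc j)" using h by (intro K_add)
    moreover have "(p1 - (p + L *v (w0 - a0))) + L *v (w0 - (a0 + v')) = p1 - (a0 + v)"
      using v'(2) by (simp add: L_diff matrix_int_add algebra_simps)
    ultimately have "p1 \<in> cl (Suc j) (a0 + v)" using p1 P by (auto simp: cl_def)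
    then show False using p1 P by blast
  qed
  ultimately show ?thesis using p w0 by blast
next
  case False
  then have j1: "j = 1" using j by simp
  show ?thesis
  proof (rule ccontr)
    assume contr: "\<not> ?thesis"
    \<comment> \<open>If nothing escaped, the \<open>x\<close> whose shift \<open>L x\<close> keeps
      \<open>P\<close> inside itself modulo \<open>K (Suc j)\<close> would form an invariant lattice
      containing \<open>A - A\<close>, hence all of \<open>lat\<close>; but some \<open>x\<close> in
      \<open>lat\<close> moves a point of \<open>P\<close> to the removed coset.\<close>
    define H where "H = {x\<in>lat. \<forall>p\<in>P. \<exists>p1\<in>P. p1 - (p + L *v x) \<in> K (Suc j)}"
    have LH: "x \<in> H" if x: "x \<in> K (Suc 0)" for x
    proof -
      have "L *v x \<in> K (Suc j)" using x by (simp add: j1 L_mem_K_Suc)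
      then have "p - (p + L *v x) \<in> K (Suc j)" for p using K_minus by simp
      then show ?thesis using x K_subset_lat unfolding H_def by blast
    qed
    have Hadd: "x + y \<in> H" if x: "x \<in> H" and y: "y \<in> H" for x y
    proof -
      have "\<exists>p2\<in>P. p2 - (p + L *v (x + y)) \<in> K (Suc j)" if p: "p \<in> P" for p
      proof -
        obtain p1 where p1: "p1 \<in> P" "p1 - (p + L *v x) \<in> K (Suc j)" using x p by (auto simp: H_def)
        obtain p2 where p2: "p2 \<in> P" "p2 - (p1 + L *v y) \<in> K (Suc j)" using y p1 by (auto simp: H_def)
        have "(p2 - (p1 + L *v y)) + (p1 - (p + L *v x)) \<in> K (Suc j)" using p1 p2 by (intro K_add)
        then have "p2 - (p + L *v (x + y)) \<in> K (Suc j)" by (simp add: matrix_int_add algebra_simps)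
        then show ?thesis using p2 by blast
      qed
      then show ?thesis using x y invariant_latticeD(5)[OF lat_invariant] by (simp add: H_def)
    qed
    have Hmult: "int m *s x \<in> H" if x: "x \<in> H" for m x
    proof (induction m)
      case 0
      then show ?case using LH[OF K_zero] by simp
    next
      case (Suc m)
      have "int (Suc m) *s x = x + int m *s x" by (simp add: vec_eq_iff algebra_simps)
      then show ?case using Hadd[OF x Suc] by simp
    qed
    obtain m where m: "m > 0" "\<And>z. m *s z \<in> K (Suc 0)"
    proof -
      obtain a b where ab: "a \<in> A" "b \<in> A" "a \<noteq> b"
        using cardA by (metis card_le_Suc0_iff_eq finA not_less_eq_eq numeral_2_eq_2)
      have "L *v (a - b) \<in> K (Suc 0)" using lat_mem[OF ab(1,2)] by (simp add: L_mem_K_Suc K_0)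
      moreover have "L *v (a - b) \<noteq> 0" using inj_L ab by (simp add: L_diff inj_eq)
      ultimately show ?thesis
        using invariant_lattice_finite_index[OF irr K_invariant] that by blast
    qed
    \<comment> \<open>\<open>K 1\<close> has finite index and lies in \<open>H\<close>, so
      \<open>- x\<close> is \<open>m - 1\<close> copies of \<open>x\<close> plus an element of
      \<open>K 1\<close>.\<close>
    have Hneg: "- x \<in> H" if x: "x \<in> H" for x
    proof -
      have "- x = int (nat (m - 1)) *s x + (- m) *s x" using m(1) by (simp add: vec_eq_iff algebra_simps)
      moreover have "(- m) *s x = m *s (- x)" by (simp add: vec_eq_iff)
      ultimately show ?thesis using Hadd[OF Hmult[OF x] LH[OF m(2)]] by metis
    qed
    have "invariant_lattice L H"
      unfolding invariant_lattice_def
    proof (intro conjI ballI)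
      show "0 \<in> H" using LH[OF K_zero] .
      show "x - y \<in> H" if "x \<in> H" "y \<in> H" for x y using Hadd[OF that(1) Hneg[OF that(2)]] by simp
      show "L *v x \<in> H" if "x \<in> H" for x
        using that by (intro LH) (simp add: L_mem_K_Suc K_0 H_def)
    qed
    moreover have wH: "w - a0 \<in> H" if w: "w \<in> A" for w
    proof -
      have "w - a0 \<in> K (j - 1)" using lat_mem[OF w a0] by (simp add: j1 K_0)
      then show ?thesis using contr w lat_mem[OF w a0] unfolding H_def by blast
    qed
    then have "a - b \<in> H" if "a \<in> A" "b \<in> A" for a b
      using Hadd[OF wH[OF that(1)] Hneg[OF wH[OF that(2)]]] by simp
    ultimately have latH: "lat \<subseteq> H" by (intro lat_min)
    obtain p where p: "p \<in> P" using P(2) by blast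
    have "p - a0 \<in> K j" using p P by (simp add: cl_def)
    then have "(a0 + v) - p \<in> K (Suc 0)" using K_diff[OF v \<open>p - a0 \<in> K j\<close>] j1 by (simp add: algebra_simps)
    then obtain x where x: "x \<in> lat" "(a0 + v) - p = L *v x" unfolding K_Suc K_0 by blast
    then obtain p1 where p1: "p1 \<in> P" "p1 - (p + L *v x) \<in> K (Suc j)" using latH p by (auto simp: H_def)
    have "p + L *v x = a0 + v" using x(2) by (metis add.commute diff_add_cancel)
    then have "p1 \<in> cl (Suc j) (a0 + v)" using p1 P by (auto simp: cl_def)
    then show False using p1 P by blast
  qed
qed

text \<open>Suppose the class \<open>Y\<close> of \<open>a0 + v\<close> is too small. Remove it and
  apply minimality inside each class of level \<open>j\<close>; this loses at most
  \<open>\<theta> j / 2\<close>. The escaping translate supplies \<open>\<theta> j\<close> further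
  sums, and \<open>cond\<close> keeps the error caused by splitting below the difference.\<close>

lemma level_full:
  assumes j: "j \<ge> 1" and big: "\<And>a. a \<in> A \<Longrightarrow> \<theta> j \<le> real (card (cl j a))"
    and prev: "j \<ge> 2 \<Longrightarrow> (\<And>a v. a \<in> A \<Longrightarrow> v \<in> K (j - 1) \<Longrightarrow> \<exists>w\<in>A. w - (a + v) \<in> K j)"
    and cond: "(real k powr (real j * \<sigma>) - 1) * \<delta> * (2 * C) ^ j \<le> 1"
    and a0: "a0 \<in> A" and v: "v \<in> K j"
  shows "\<theta> (Suc j) \<le> real (card (cl (Suc j) (a0 + v)))"
proof (rule ccontr)
  define Y where "Y = cl (Suc j) (a0 + v)"
  assume "\<not> ?thesis"
  then have Ysmall: "real (card Y) < \<theta> (Suc j)" by (simp add: Y_def)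
  define c0 where "c0 = cl j a0"
  have fY: "finite Y" "Y \<subseteq> A" using finite_cl cl_subset by (auto simp: Y_def)
  have "\<theta> (Suc j) * 1 \<le> \<theta> (Suc j) * (2 * C)" using C_ge_2 \<theta>_pos[of "Suc j"] by (intro mult_left_mono) auto
  then have "\<theta> (Suc j) \<le> \<theta> j" using \<theta>_Suc[of j] by (simp add: mult.commute)
  then have "card Y < card c0" using Ysmall big[OF a0] by (simp add: c0_def)
  then have ne: "c0 - Y \<noteq> {}" using card_mono[OF fY(1), of c0] by auto
  obtain p w0 where p: "p \<in> c0 - Y" and w0: "w0 \<in> A" "w0 - a0 \<in> K (j - 1)"
    and esc: "\<And>p1. p1 \<in> c0 - Y \<Longrightarrow> p1 - (p + L *v (w0 - a0)) \<notin> K (Suc j)"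
    using escaping_translate[OF j a0 v prev refl] ne unfolding c0_def Y_def by blast
  define cw where "cw = cl j w0"
  \<comment> \<open>Hence level \<open>j\<close> has at least two classes, each smaller than
    \<open>A\<close>, so that minimality applies to all of them.\<close>
  have w0c0: "w0 - a0 \<notin> K j"
  proof
    assume "w0 - a0 \<in> K j"
    then have "L *v (w0 - a0) \<in> K (Suc j)" by (simp add: L_mem_K_Suc)
    then have "p - (p + L *v (w0 - a0)) \<in> K (Suc j)" using K_minus by simp
    then show False using esc[OF p] by blast
  qed
  have cF: "c0 \<in> F j" "cw \<in> F j" using a0 w0 by (auto simp: c0_def cw_def F_def)
  have c0w: "c0 \<noteq> cw" using w0c0 cl_eqD[OF w0(1), of j a0] by (auto simp: c0_def cw_def)
  define T where "T c = (c - Y) + (*v) L ` (c - Y)" for c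
  \<comment> \<open>The extra sums. They share the coset of \<open>T c0\<close> modulo
    \<open>K j\<close>, but modulo \<open>K (Suc j)\<close> they are all congruent to
    \<open>p + L w0\<close>, which sums within \<open>c0 - Y\<close> cannot reach by the choice of
    \<open>p\<close> and \<open>w0\<close>.\<close>
  define E where "E = (\<lambda>w. p + L *v w) ` cw"
  have jj: "Suc (j - 1) = j" using j by simp
  have Kj: "K j \<subseteq> K (j - 1)" using K_Suc_subset[of "j - 1"] by (simp only: jj)
  \<comment> \<open>\<open>T (cl j a)\<close> lies in the coset of \<open>a + L a\<close>, and
    \<open>one_plus_L_mem_K\<close> separates these cosets for different classes.\<close>
  have Tcl: "z - (a + L *v a) \<in> K j" if z: "z \<in> T (cl j a)" for z a
  proof -
    obtain p1 p2 where q: "p1 - a \<in> K j" "p2 - a \<in> K j" "z = p1 + L *v p2"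
      using z by (auto simp: T_def set_plus_def cl_def)
    have "L *v (p2 - a) \<in> K j" using q(2) K_Suc_subset L_mem_K_Suc by blast
    then have "(p1 - a) + L *v (p2 - a) \<in> K j" using q(1) by (intro K_add)
    then show ?thesis using q(3) by (simp add: L_diff algebra_simps)
  qed
  have same: "a - b \<in> K j" if "a \<in> A" "b \<in> A" "z - (a + L *v a) \<in> K j" "z - (b + L *v b) \<in> K j" for a b z
  proof -
    have "(z - (b + L *v b)) - (z - (a + L *v a)) \<in> K j" by (rule K_diff[OF that(4,3)])
    then have "(a - b) + L *v (a - b) \<in> K j" by (simp add: L_diff algebra_simps)
    then show ?thesis using one_plus_L_mem_K lat_mem that by blast
  qed
  have Ez: "z - (a0 + L *v a0) \<in> K j \<and> z \<notin> T c0" if z: "z \<in> E" for z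
  proof -
    obtain w where w: "w \<in> cw" "z = p + L *v w" using z by (auto simp: E_def)
    have ww: "w - w0 \<in> K j" using w by (simp add: cw_def cl_def)
    have "(w - w0) + (w0 - a0) \<in> K (j - 1)" using ww Kj w0(2) by (intro K_add) auto
    then have "L *v (w - a0) \<in> K j" using L_mem_K_Suc[of "w - a0" "j - 1"] by (simp only: jj) simp
    moreover have "p - a0 \<in> K j" using p by (simp add: c0_def cl_def)
    ultimately have "(p - a0) + L *v (w - a0) \<in> K j" by (intro K_add)
    then have 1: "z - (a0 + L *v a0) \<in> K j" using w(2) by (simp add: L_diff algebra_simps)
    have "z \<notin> T c0"
    proof
      assume "z \<in> T c0"
      then obtain p1 p2 where q: "p1 \<in> c0 - Y" "p2 \<in> c0 - Y" "z = p1 + L *v p2"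
        by (auto simp: T_def set_plus_def)
      have "L *v (w - w0) \<in> K (Suc j)" using ww by (simp add: L_mem_K_Suc)
      moreover have "L *v (p2 - a0) \<in> K (Suc j)" using q(2) by (simp add: L_mem_K_Suc c0_def cl_def)
      ultimately have "L *v (w - w0) - L *v (p2 - a0) \<in> K (Suc j)" by (intro K_diff)
      moreover have "L *v (w - w0) - L *v (p2 - a0) = p1 - (p + L *v (w0 - a0))"
        using q(3) w(2) by (simp add: L_diff algebra_simps)
      ultimately show False using esc[OF q(1)] by simp
    qed
    then show ?thesis using 1 by blast
  qed
  have Tdisj: "c = c'" if c: "c \<in> F j" "c' \<in> F j" "z \<in> T c" "z \<in> T c'" for c c' z
  proof -
    obtain a b where ab: "a \<in> A" "b \<in> A" "c = cl j a" "c' = cl j b" using c by (auto simp: F_def)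
    then have "a - b \<in> K j" using same Tcl c by blast
    then show ?thesis using ab cl_cong by blast
  qed
  have TE: "T c \<inter> E = {}" if c: "c \<in> F j" for c
  proof (rule ccontr)
    assume "T c \<inter> E \<noteq> {}"
    then obtain z where z: "z \<in> T c" "z \<in> E" by blast
    obtain a where a: "a \<in> A" "c = cl j a" using c by (auto simp: F_def)
    then have "a - a0 \<in> K j" using same[OF a(1) a0 Tcl] z Ez by blast
    then have "c = c0" using a cl_cong by (simp add: c0_def)
    then show False using z Ez by blast
  qed
  have "p \<in> A" "cw \<subseteq> A" using p cl_subset unfolding c0_def cw_def by blast+
  then have EA: "E \<subseteq> A + (*v) L ` A" unfolding E_def by blast
  have "(\<Sum>c\<in>F j. card (T c)) \<le> card (A + (*v) L ` A - E)"
  proof (rule sum_card_le_of_disjoint[OF _ finite_F _ Tdisj])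
    show "T c \<subseteq> A + (*v) L ` A - E" if "c \<in> F j" for c
      using TE[OF that] F_props[OF that] set_plus_mono2[of "c - Y" A "(*v) L ` (c - Y)" "(*v) L ` A"]
      unfolding T_def by blast
  qed (use finite_sum in auto)
  also have "\<dots> = card (A + (*v) L ` A) - card E"
    by (rule card_Diff_subset[OF finite_subset[OF EA finite_sum] EA])
  finally have "(\<Sum>c\<in>F j. card (T c)) + card E \<le> card (A + (*v) L ` A)"
    using card_mono[OF finite_sum EA] by linarith
  moreover have "card E = card cw"
    unfolding E_def by (rule card_image) (auto intro!: inj_onI dest: injD[OF inj_L])
  ultimately have "real ((\<Sum>c\<in>F j. card (T c)) + card cw) \<le> real (card (A + (*v) L ` A))"
    by (simp only: of_nat_le_iff)
  then have lower: "(\<Sum>c\<in>F j. real (card (T c))) + \<theta> j \<le> real (card (A + (*v) L ` A))"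
    using big[OF w0(1)] unfolding cw_def by simp
  have T: "C * real (card (c - Y)) - D * real (card c) powr (1 - \<sigma>) \<le> real (card (T c))" if c: "c \<in> F j" for c
  proof -
    have cA: "c \<subseteq> A" "finite c" using F_props[OF c] by auto
    obtain c' where c': "c' \<in> F j" "c' \<noteq> c" using cF c0w by metis
    then obtain x where "x \<in> c'" "x \<notin> c" "x \<in> A" using F_disjoint[OF c'(1) c] F_props[OF c'(1)] by blast
    then have "card c < card A" using cA finA by (intro psubset_card_mono) auto
    moreover have le: "card (c - Y) \<le> card c" using cA by (intro card_mono) auto
    ultimately have "C * real (card (c - Y)) - D * real (card (c - Y)) powr (1 - \<sigma>) \<le> real (card (T c))"
      unfolding T_def using cA by (intro IH) auto
    moreover have "D * real (card (c - Y)) powr (1 - \<sigma>) \<le> D * real (card c) powr (1 - \<sigma>)"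
      using D0 \<sigma>0 le by (intro mult_left_mono powr_mono2) auto
    ultimately show ?thesis by linarith
  qed
  have "C * (\<Sum>c\<in>F j. real (card (c - Y))) - D * (\<Sum>c\<in>F j. real (card c) powr (1 - \<sigma>))
      = (\<Sum>c\<in>F j. C * real (card (c - Y)) - D * real (card c) powr (1 - \<sigma>))"
    by (simp add: sum_subtractf sum_distrib_left)
  also have "\<dots> \<le> (\<Sum>c\<in>F j. real (card (T c)))" by (intro sum_mono T)
  finally have s1: "C * (\<Sum>c\<in>F j. real (card (c - Y))) - D * (\<Sum>c\<in>F j. real (card c) powr (1 - \<sigma>)) + \<theta> j
      \<le> real (card (A + (*v) L ` A))" using lower by linarith
  have "card (A - Y) \<le> (\<Sum>c\<in>F j. card (c - Y))"
  proof -
    have "A - Y = (\<Union>c\<in>F j. c - Y)" using Union_F[of j] by blast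
    then show ?thesis using card_UN_le[OF finite_F[of j], of "\<lambda>c. c - Y"] by simp
  qed
  then have "card A \<le> (\<Sum>c\<in>F j. card (c - Y)) + card Y"
    using fY finA by (simp add: card_Diff_subset)
  then have "real (card A) \<le> real ((\<Sum>c\<in>F j. card (c - Y)) + card Y)" by (simp only: of_nat_le_iff)
  then have "N - real (card Y) \<le> (\<Sum>c\<in>F j. real (card (c - Y)))" by simp
  then have s2: "C * (N - real (card Y)) \<le> C * (\<Sum>c\<in>F j. real (card (c - Y)))"
    using C_ge_2 by (intro mult_left_mono) auto
  have "2 * C * real (card Y) \<le> 2 * C * \<theta> (Suc j)" using Ysmall C_ge_2 by (intro mult_left_mono) auto
  then have s3: "C * real (card Y) \<le> \<theta> j / 2" unfolding \<theta>_Suc by simp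
  \<comment> \<open>Splitting into at most \<open>k ^ j\<close> classes raises the permitted error
    by a factor of at most \<open>k powr (j * \<sigma>)\<close>.\<close>
  have s4: "D * (\<Sum>c\<in>F j. real (card c) powr (1 - \<sigma>)) \<le> real k powr (real j * \<sigma>) * (\<delta> * N)"
  proof -
    have "(\<Sum>c\<in>F j. real (card c) powr (1 - \<sigma>)) \<le> real (card (F j)) powr \<sigma> * (\<Sum>c\<in>F j. real (card c)) powr (1 - \<sigma>)"
      using finite_F F_ne F_props \<sigma>0 by (intro sum_powr_le) auto
    also have "(\<Sum>c\<in>F j. real (card c)) = N" using sum_card_F[of j] by (metis of_nat_sum)
    also have "real (card (F j)) powr \<sigma> * N powr (1 - \<sigma>) \<le> real k powr (real j * \<sigma>) * N powr (1 - \<sigma>)"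
    proof (intro mult_right_mono)
      have "real (card (F j)) \<le> real (k ^ j)" using card_F_le by (simp only: of_nat_le_iff)
      then have "real (card (F j)) \<le> real k powr real j" using k1 by (simp add: powr_realpow)
      then have "real (card (F j)) powr \<sigma> \<le> (real k powr real j) powr \<sigma>" using \<sigma>0 by (intro powr_mono2) auto
      then show "real (card (F j)) powr \<sigma> \<le> real k powr (real j * \<sigma>)" by (simp add: powr_powr)
    qed simp
    finally have "D * (\<Sum>c\<in>F j. real (card c) powr (1 - \<sigma>)) \<le> D * (real k powr (real j * \<sigma>) * N powr (1 - \<sigma>))"
      using D0 by (intro mult_left_mono) auto
    also have "\<dots> = real k powr (real j * \<sigma>) * (\<delta> * N)" using \<delta>_N by (simp add: ac_simps)
    finally show ?thesis .
  qed
  have "C * N - \<theta> j / 2 - real k powr (real j * \<sigma>) * (\<delta> * N) + \<theta> j < C * N - \<delta> * N"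
    using s1 s2 s3 s4 fail \<delta>_N by (simp add: right_diff_distrib)
  then have "\<theta> j / 2 < (real k powr (real j * \<sigma>) - 1) * \<delta> * N" by (simp add: algebra_simps)
  moreover have "\<theta> j / 2 = N / (2 * C) ^ j" by (simp add: \<theta>_def)
  ultimately have "N / (2 * C) ^ j < (real k powr (real j * \<sigma>) - 1) * \<delta> * N" by simp
  then have "N < (real k powr (real j * \<sigma>) - 1) * \<delta> * N * (2 * C) ^ j"
    using C_ge_2 by (simp add: pos_divide_less_eq)
  also have "\<dots> = ((real k powr (real j * \<sigma>) - 1) * \<delta> * (2 * C) ^ j) * N" by (simp add: ac_simps)
  also have "\<dots> \<le> 1 * N" using cond by (intro mult_right_mono) auto
  finally show False by simp
qed

end

section \<open>Growth of the largest class along the levels\<close>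

context minimal_counterexample
begin

definition top_card :: "nat \<Rightarrow> nat" where "top_card j = Max (card ` F j)"

definition \<alpha> :: "nat \<Rightarrow> real" where
  "\<alpha> j = real (top_card j) * real (card (F j)) / N - 1"

lemma top_card_ge: "c \<in> F j \<Longrightarrow> card c \<le> top_card j"
  unfolding top_card_def using finite_F by (intro Max_ge) auto

lemma top_card_attained: obtains b where "b \<in> A" "card (cl j b) = top_card j"
proof -
  have "top_card j \<in> card ` F j" unfolding top_card_def using finite_F F_ne by (intro Max_in) auto
  then show ?thesis using that by (auto simp: F_def)
qed

lemma \<alpha>_nonneg: "0 \<le> \<alpha> j"
proof -
  have "card A \<le> (\<Sum>c\<in>F j. top_card j)"
    using sum_mono[of "F j" card "\<lambda>_. top_card j"] top_card_ge sum_card_F[of j] by simp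
  then have "card A \<le> top_card j * card (F j)" by (simp add: mult.commute)
  then have "N \<le> real (top_card j * card (F j))" by (simp only: of_nat_le_iff)
  then show ?thesis using N_pos by (simp add: \<alpha>_def)
qed

lemma \<alpha>_less_C:
  assumes "card (F (Suc j)) = k * card (F j)"
  shows "\<alpha> j \<le> C"
proof -
  obtain b where b: "b \<in> A" "card (cl j b) = top_card j" by (rule top_card_attained)
  have "card (cl j b) \<le> card (c + (*v) L ` cl j b)" if c: "c \<in> F (Suc j)" for c
  proof -
    obtain x where "x \<in> c" using F_props[OF c] by blast
    then have "card ((*v) L ` cl j b) \<le> card ((*v) L ` cl j b + c)"
      using F_props[OF c] finite_cl by (intro card_sumset_ge_left) auto
    then show ?thesis using inj_L by (simp add: card_image inj_on_subset add.commute)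
  qed
  then have "(\<Sum>c\<in>F (Suc j). top_card j) \<le> (\<Sum>c\<in>F (Suc j). card (c + (*v) L ` cl j b))"
    using b(2) by (intro sum_mono) simp
  then have "k * (top_card j * card (F j)) \<le> card (A + (*v) L ` A)"
    using sum_card_class_sums[OF b(1), of j] assms by (simp add: ac_simps)
  moreover have "1 * (top_card j * card (F j)) \<le> k * (top_card j * card (F j))" using k1 by (intro mult_right_mono) auto
  ultimately have "real (top_card j * card (F j)) \<le> real (card (A + (*v) L ` A))" by (simp only: of_nat_le_iff)
  also have "\<dots> \<le> C * N" using fail D0 by (smt (verit) mult_nonneg_nonneg powr_ge_zero)
  finally have "real (top_card j) * real (card (F j)) / N \<le> C" using N_pos by (simp add: divide_le_eq)
  then show ?thesis by (simp add: \<alpha>_def)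
qed

text \<open>Turns the failure for \<open>A\<close> into the normalised hypothesis of the density
  lemmas: sizes are divided by the mean class size \<open>s\<close> of level \<open>Suc j\<close>.
  One half of \<delta> pays for the Brunn-Minkowski errors of all classes, the other half
  survives.\<close>

lemma level_fail:
  assumes bm: "\<And>X Y. X \<subseteq> A \<Longrightarrow> Y \<subseteq> A \<Longrightarrow> X \<noteq> {} \<Longrightarrow> Y \<noteq> {} \<Longrightarrow>
       (real (card X) powr (1 / real CARD('n)) + real (card Y) powr (1 / real CARD('n))) ^ CARD('n)
       \<le> real (card (X + (*v) L ` Y)) + err"
    and err: "real (card (F (Suc j))) * err \<le> \<delta> / 2 * N"
    and full: "card (F (Suc j)) = k * card (F j)"
  shows "(\<Sum>c\<in>F (Suc j). ((real (card c) * real (card (F (Suc j))) / N) powr (1 / real CARD('n))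
      + \<kappa> * (1 + \<alpha> j) powr (1 / real CARD('n))) ^ CARD('n)) < real (card (F (Suc j))) * (C - \<delta> / 2)"
proof -
  define d where "d = CARD('n)"
  have d: "d > 0" by (simp add: d_def)
  define n where "n = real (card (F (Suc j)))"
  have n: "n > 0" using card_F_pos by (simp add: n_def)
  obtain b where b: "b \<in> A" "card (cl j b) = top_card j" by (rule top_card_attained)
  have clb: "cl j b \<subseteq> A" "cl j b \<noteq> {}" using cl_subset mem_cl_self[OF b(1), of j] by blast+
  define s where "s = N / n"
  have s: "s > 0" using n N_pos by (simp add: s_def)
  \<comment> \<open>The number of classes grows exactly by the factor \<open>k\<close>, so the mean
    class size of level \<open>j\<close> is \<open>k * s\<close>; its root produces the \<kappa> in
    the sum.\<close>
  have top: "real (top_card j) = s * (real k * (1 + \<alpha> j))"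
    using N_pos full k1 card_F_pos[of j] by (simp add: \<alpha>_def s_def n_def)
  have term_eq: "(real (card c) powr (1 / real d) + real (top_card j) powr (1 / real d)) ^ d
      = s * ((real (card c) * n / N) powr (1 / real d) + \<kappa> * (1 + \<alpha> j) powr (1 / real d)) ^ d" for c :: "(int^'n) set"
  proof -
    have "real (card c) = s * (real (card c) * n / N)" using n N_pos by (simp add: s_def)
    then have "real (card c) powr (1 / real d) = s powr (1 / real d) * (real (card c) * n / N) powr (1 / real d)"
      using s n by (metis powr_mult)
    moreover have "real (top_card j) powr (1 / real d) = s powr (1 / real d) * (\<kappa> * (1 + \<alpha> j) powr (1 / real d))"
      unfolding top using s \<alpha>_nonneg[of j] by (simp add: powr_mult \<kappa>_def d_def)
    ultimately have "real (card c) powr (1 / real d) + real (top_card j) powr (1 / real d)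
      = s powr (1 / real d) * ((real (card c) * n / N) powr (1 / real d) + \<kappa> * (1 + \<alpha> j) powr (1 / real d))"
      by (simp only: distrib_left)
    then show ?thesis using s d by (simp add: power_mult_distrib powr_inverse_power)
  qed
  define S where "S = (\<Sum>c\<in>F (Suc j). ((real (card c) * n / N) powr (1 / real d) + \<kappa> * (1 + \<alpha> j) powr (1 / real d)) ^ d)"
  have "s * S = (\<Sum>c\<in>F (Suc j). (real (card c) powr (1 / real d) + real (top_card j) powr (1 / real d)) ^ d)"
    unfolding S_def by (simp add: sum_distrib_left term_eq)
  also have "\<dots> \<le> (\<Sum>c\<in>F (Suc j). real (card (c + (*v) L ` cl j b)) + err)"
    using bm[OF _ clb(1) _ clb(2)] F_props by (intro sum_mono) (simp add: b(2) d_def)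
  also have "\<dots> = real (\<Sum>c\<in>F (Suc j). card (c + (*v) L ` cl j b)) + n * err"
    by (simp add: sum.distrib n_def)
  also have "\<dots> \<le> real (card (A + (*v) L ` A)) + \<delta> / 2 * N"
    using sum_card_class_sums[OF b(1), of j] err unfolding n_def by (intro add_mono) (simp_all only: of_nat_le_iff)
  also have "\<dots> < (C - \<delta> / 2) * N" using fail \<delta>_N by (simp add: algebra_simps)
  finally have "s * S < s * (n * (C - \<delta> / 2))" using n by (simp add: s_def ac_simps)
  then have "S < n * (C - \<delta> / 2)" using s by simp
  then show ?thesis by (simp add: S_def n_def d_def)
qed

lemma density_recursion:
  assumes bm: "\<And>X Y. X \<subseteq> A \<Longrightarrow> Y \<subseteq> A \<Longrightarrow> X \<noteq> {} \<Longrightarrow> Y \<noteq> {} \<Longrightarrow>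
       (real (card X) powr (1 / real CARD('n)) + real (card Y) powr (1 / real CARD('n))) ^ CARD('n)
       \<le> real (card (X + (*v) L ` Y)) + err"
    and err: "real (card (F (Suc j))) * err \<le> \<delta> / 2 * N"
    and full: "card (F (Suc j)) = k * card (F j)"
  shows "C / (C - real k) * \<alpha> j \<le> \<alpha> (Suc j)"
    and "min (1 / (2 * real k ^ Suc j)) (sqrt (1 / (real CARD('n) * C) * (\<alpha> j + \<delta>)) / real k ^ Suc j) \<le> \<alpha> (Suc j)"
proof -
  define u where "u c = real (card c) * real (card (F (Suc j))) / N" for c :: "(int^'n) set"
  define n where "n = real (card (F (Suc j)))"
  have n: "n > 0" "n \<le> real k ^ Suc j"
    using card_F_pos[of "Suc j"] card_F_le[of "Suc j"] by (simp_all add: n_def del: power_Suc flip: of_nat_power)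
  have pd: "CARD('n) > 0" by simp
  have k0: "0 \<le> \<kappa>" using \<kappa>_ge_1 by simp
  have ub: "0 \<le> u c \<and> u c \<le> 1 + \<alpha> (Suc j)" if "c \<in> F (Suc j)" for c
    using top_card_ge[OF that] N_pos by (auto simp: u_def \<alpha>_def divide_right_mono mult_right_mono)
  have us: "(\<Sum>c\<in>F (Suc j). u c) = real (card (F (Suc j)))"
  proof -
    have "(\<Sum>c\<in>F (Suc j). u c) = real (\<Sum>c\<in>F (Suc j). card c) * real (card (F (Suc j))) / N"
      by (simp add: u_def sum_divide_distrib sum_distrib_right)
    then show ?thesis using N_pos by (simp only: sum_card_F) simp
  qed
  have half: "\<delta> / 2 > 0" using \<delta>_pos by simp
  note hyps = pd k1 k0 \<kappa>_power C_def finite_F F_ne ub us \<alpha>_nonneg half level_fail[OF bm err full, folded u_def]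
  have R1: "\<alpha> j * C + \<delta> / 2 \<le> \<alpha> (Suc j) * (C - real k)"
    by (rule max_density_grows[OF hyps])
  have Ck: "C - real k > 0" using C_gt_k[OF hyps] by simp
  have "\<alpha> j * C \<le> \<alpha> (Suc j) * (C - real k)" using R1 half by linarith
  then show "C / (C - real k) * \<alpha> j \<le> \<alpha> (Suc j)" using Ck by (simp add: divide_le_eq mult.commute)
  show "min (1 / (2 * real k ^ Suc j)) (sqrt (1 / (real CARD('n) * C) * (\<alpha> j + \<delta>)) / real k ^ Suc j) \<le> \<alpha> (Suc j)"
  proof (cases "n * \<alpha> (Suc j) \<le> 1/2")
    case True
    have "\<alpha> j + \<delta> / 2 < real CARD('n) * C / 2 * (n * \<alpha> (Suc j))\<^sup>2"
      unfolding n_def by (rule max_density_quadratic[OF hyps]) (assumption | rule True[unfolded n_def])+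
    \<comment> \<open>Doubling the previous inequality replaces \<open>\<delta> / 2\<close> by
      \<delta>, since \<open>\<alpha> j \<le> 2 * \<alpha> j\<close>.\<close>
    then have "\<alpha> j + \<delta> \<le> real CARD('n) * C * (n * \<alpha> (Suc j))\<^sup>2" using \<alpha>_nonneg[of j] by simp
    then have "1 / (real CARD('n) * C) * (\<alpha> j + \<delta>) \<le> (n * \<alpha> (Suc j))\<^sup>2"
      using C_ge_2 by (simp add: divide_le_eq mult.commute)
    then have "sqrt (1 / (real CARD('n) * C) * (\<alpha> j + \<delta>)) \<le> n * \<alpha> (Suc j)"
      using n \<alpha>_nonneg by (intro real_le_lsqrt) auto
    also have "\<dots> \<le> real k ^ Suc j * \<alpha> (Suc j)" using n \<alpha>_nonneg by (intro mult_right_mono) auto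
    finally have "sqrt (1 / (real CARD('n) * C) * (\<alpha> j + \<delta>)) / real k ^ Suc j \<le> \<alpha> (Suc j)"
      using k1 by (simp add: divide_le_eq mult.commute)
    then show ?thesis by (rule min.coboundedI2)
  next
    case False
    then have "1/2 \<le> n * \<alpha> (Suc j)" by simp
    also have "\<dots> \<le> real k ^ Suc j * \<alpha> (Suc j)" using n \<alpha>_nonneg by (intro mult_right_mono) auto
    finally have "1 / (2 * real k ^ Suc j) \<le> \<alpha> (Suc j)" using k1 by (simp add: divide_le_eq mult.commute)
    then show ?thesis by (rule min.coboundedI1)
  qed
qed

text \<open>As \<theta> is positive, a class above the threshold is non-empty; this provides the
  hypothesis on the previous level in \<open>level_full\<close> as well as the exact class
  count.\<close>

lemma levels_full:
  assumes cond: "\<And>j. j \<in> {1..J} \<Longrightarrow> (real k powr (real j * \<sigma>) - 1) * \<delta> * (2 * C) ^ j \<le> 1"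
    and j: "j \<in> {1..J}"
  shows "card (F (Suc j)) = k * card (F j)"
proof -
  have full: "\<forall>a\<in>A. \<forall>v\<in>K j. \<theta> (Suc j) \<le> real (card (cl (Suc j) (a + v)))" if "j \<in> {1..J}" for j
    using that
  proof (induction j)
    case (Suc j)
    show ?case
    proof (cases "j = 0")
      case True
      show ?thesis
        using level_full[of 1] level_one_large cond[of 1] Suc.prems True by simp
    next
      case False
      then have IH: "\<forall>a\<in>A. \<forall>v\<in>K j. \<theta> (Suc j) \<le> real (card (cl (Suc j) (a + v)))" using Suc by simp
      have big: "\<theta> (Suc j) \<le> real (card (cl (Suc j) a))" if "a \<in> A" for a
        using IH that K_zero by force
      have ex: "\<exists>w\<in>A. w - (a + v) \<in> K (Suc j)" if av: "a \<in> A" "v \<in> K (Suc j - 1)" for a v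
      proof -
        have "0 < real (card (cl (Suc j) (a + v)))" using IH av \<theta>_pos[of "Suc j"] by force
        then have "cl (Suc j) (a + v) \<noteq> {}" by auto
        then show ?thesis by (auto simp: cl_def)
      qed
      show ?thesis using level_full[of "Suc j", OF _ big ex cond[OF Suc.prems]] by simp
    qed
  qed simp
  show ?thesis
  proof (rule card_F_Suc(2))
    fix a v assume "a \<in> A" "v \<in> K j"
    then have "0 < real (card (cl (Suc j) (a + v)))" using full[OF j] \<theta>_pos[of "Suc j"] by force
    then have "cl (Suc j) (a + v) \<noteq> {}" by auto
    then show "\<exists>w\<in>A. w - (a + v) \<in> K (Suc j)" by (auto simp: cl_def)
  qed
qed

end

section \<open>The theorem\<close>

lemma sum_dilate_eq: "sum_dilate A L = A + (*v) L ` A"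
  by (auto simp: sum_dilate_def set_plus_def)

text \<open>The kernel is a non-zero invariant subspace, hence everything, so \<open>L\<close>
  vanishes. Then every line is invariant and the dimension must be 1.\<close>

lemma card_sum_dilate_singular:
  fixes L :: "int^'n::finite^'n"
  assumes irr: "irreducible_mat L" and det: "det L = 0" and A: "finite A"
  shows "CARD('n) = 1 \<and> card A \<le> card (sum_dilate A L)"
proof -
  define W where "W = {w. rat_mat L *v w = 0}"
  have "\<not> inj ((*v) (rat_mat L))"
  proof
    assume "inj ((*v) (rat_mat L))"
    then have "invertible (rat_mat L)"
      by (simp add: invertible_left_inverse matrix_left_invertible_injective)
    then show False using det by (simp add: invertible_det_nz rat_mat_def det_of_int_mat)
  qed
  then obtain x y where "rat_mat L *v x = rat_mat L *v y" "x \<noteq> y" by (auto simp: inj_def)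
  then have "x - y \<in> W" "x - y \<noteq> 0" by (simp_all add: W_def matrix_vector_mult_diff_distrib)
  then have "W \<noteq> {0}" by blast
  moreover have "module.subspace (\<lambda>c (v::rat^'n). c *s v) W"
    by (auto simp: vec.subspace_def W_def matrix_vector_right_distrib vec.scale)
  moreover have "\<forall>w\<in>W. rat_mat L *v w \<in> W" by (simp add: W_def)
  ultimately have "W = UNIV" using irr unfolding nontrivial_invariant_subspace_def by blast
  then have zero: "rat_mat L *v w = 0" for w by (auto simp: W_def)
  have "CARD('n) = 1"
  proof -
    obtain i :: 'n where True by blast
    define e where "e = axis i (1::rat)"
    have e0: "e \<noteq> 0" by (simp add: e_def axis_eq_0_iff)
    have "vec.span {e} = UNIV"
      using irr vec.subspace_span[of "{e}"] vec.span_base[of e "{e}"] vec.span_zero[of "{e}"] e0 zero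
      unfolding nontrivial_invariant_subspace_def by (metis singletonD singletonI)
    then have "vec.dim (UNIV :: (rat^'n) set) \<le> card {e}"
      by (metis finite.emptyI finite.insertI order_refl vec.dim_le_card)
    then have "CARD('n) \<le> 1" unfolding vec_dim_card by simp
    then show ?thesis by (simp add: le_Suc_eq)
  qed
  moreover have "L *v v = 0" for v
  proof -
    have "rat_vec (L *v v) = 0" using zero[of "rat_vec v"] by (simp add: rat_mat_vec)
    then show ?thesis by (simp add: vec_eq_iff)
  qed
  then have "sum_dilate A L = A" by (auto simp: sum_dilate_def)
  ultimately show ?thesis by simp
qed

theorem theorem3p4:
  "\<forall>k::nat. \<exists>D2 \<sigma>2 :: real. D2 > 0 \<and> \<sigma>2 > 0 \<and>
     (\<forall>L :: int^'n::finite^'n.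
        (\<not> (\<exists>W. nontrivial_invariant_subspace L W)) \<and> \<bar>det L\<bar> = int k \<longrightarrow>
        (\<forall>A :: (int^'n) set. finite A \<longrightarrow>
           real (card (sum_dilate A L)) \<ge>
             (1 + real k powr (1 / real CARD('n))) ^ CARD('n) * real (card A)
             - D2 * real (card A) powr (1 - \<sigma>2)))"
proof (rule allI, goal_cases)
  case (1 k)
  show ?case
  proof (cases "k = 0")
    case True
    \<comment> \<open>\<open>0 powr x\<close> is 0, so for \<open>k = 0\<close> in dimension 1 the
      leading factor is 1.\<close>
    have "real (card (sum_dilate A L)) \<ge> (1 + real k powr (1 / real CARD('n))) ^ CARD('n) * real (card A)
             - 1 * real (card A) powr (1 - 1)"
      if "irreducible_mat L" "\<bar>det L\<bar> = int k" "finite A" for L :: "int^'n^'n" and A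
      using card_sum_dilate_singular[OF that(1) _ that(3)] that(2) True by simp
    then show ?thesis by (intro exI[of _ 1]) auto
  next
    case False
    then have k1: "k \<ge> 1" by simp
    define \<kappa> where "\<kappa> = real k powr (1 / real CARD('n))"
    define C where "C = (1 + \<kappa>) ^ CARD('n)"
    have \<kappa>1: "\<kappa> \<ge> 1" unfolding \<kappa>_def using k1 by (intro ge_one_powr_ge_zero) auto
    have \<kappa>d: "\<kappa> ^ CARD('n) = real k" unfolding \<kappa>_def by (rule powr_inverse_power) auto
    have C1: "C \<ge> 1" unfolding C_def using \<kappa>1 by (intro one_le_power) auto
    have "\<kappa> ^ CARD('n) < C" unfolding C_def using \<kappa>1 by (intro power_strict_mono) auto
    then have Ck: "C > real k" by (simp add: \<kappa>d)
    obtain c \<sigma>0 where c: "c > 0" and \<sigma>0: "\<sigma>0 > 0" "\<sigma>0 \<le> 1"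
      and bm: "\<forall>(L :: int^'n^'n) A. irreducible_mat L \<and> det L \<noteq> 0 \<and> finite A \<and> card A \<ge> 2 \<and>
         real (card (A + (*v) L ` A)) \<le> C * real (card A) \<longrightarrow>
         (\<forall>X Y. X \<subseteq> A \<and> Y \<subseteq> A \<and> X \<noteq> {} \<and> Y \<noteq> {} \<longrightarrow>
           (real (card X) powr (1 / real CARD('n)) + real (card Y) powr (1 / real CARD('n))) ^ CARD('n)
           \<le> real (card (X + (*v) L ` Y)) + c * real (card A) powr (1 - \<sigma>0))"
      using dilate_brunn_minkowski[OF C1, where 'n = 'n] by (elim exE conjE) (rule that)
    define \<rho> where "\<rho> = C / (C - real k)"
    \<comment> \<open>Bounds the splitting error per level in \<open>cond\<close>: \<open>k\<close>
      for the number of classes and \<open>2 * C\<close> for the decrease of \<theta>.\<close>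
    define Q where "Q = 2 * real k * C"
    have \<rho>1: "\<rho> > 1" using Ck k1 by (simp add: \<rho>_def)
    have kC: "1 \<le> real k * C" using k1 C1 mult_mono[of 1 "real k" 1 C] by simp
    have Q1: "Q > 1" using kC by (simp add: Q_def)
    have cc: "1 / (real CARD('n) * C) > 0" using C1 by simp
    obtain j0 where j0: "2 \<le> j0" and rec: "\<forall>J\<ge>j0. \<forall>\<alpha> :: nat \<Rightarrow> real. (\<forall>j. 0 \<le> \<alpha> j) \<and>
      (\<forall>j\<in>{2..J}. \<rho> * \<alpha> (j - 1) \<le> \<alpha> j) \<and>
      (\<forall>j\<in>{2..J}. min (1 / (2 * real k ^ j)) (sqrt (1 / (real CARD('n) * C) * (\<alpha> (j - 1) + 1 / Q ^ Suc J)) / real k ^ j) \<le> \<alpha> j)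
      \<longrightarrow> C < \<alpha> J"
      using density_recursion_unbounded[OF \<rho>1 Q1 cc k1, of C] by (elim exE conjE) (rule that)
    \<comment> \<open>Chosen so that \<open>\<tau> * C * (2 * C) ^ j0 = 1\<close>, which yields
      \<open>cond\<close> when \<open>J = j0\<close>.\<close>
    define \<tau> where "\<tau> = 1 / (C * (2 * C) ^ j0)"
    have \<tau>: "\<tau> > 0" using C1 by (simp add: \<tau>_def)
    have lnk: "ln (real k) \<ge> 0" using k1 by simp
    \<comment> \<open>Ensures \<open>k powr (j0 * \<sigma>1) \<le> 1 + \<tau>\<close>; the added 1
      keeps the denominator positive when \<open>k = 1\<close>.\<close>
    define \<sigma>1 where "\<sigma>1 = ln (1 + \<tau>) / (real j0 * ln (real k) + 1)"
    have den: "real j0 * ln (real k) + 1 > 0" using lnk by (simp add: add_nonneg_pos)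
    have \<sigma>1: "\<sigma>1 > 0" unfolding \<sigma>1_def using \<tau> den by (intro divide_pos_pos) auto
    \<comment> \<open>Halving \<open>\<sigma>0\<close> leaves room for about
      \<open>N powr \<sigma>\<close> classes, each with an error of order
      \<open>N powr (1 - \<sigma>0)\<close>.\<close>
    define \<sigma> where "\<sigma> = min (\<sigma>0 / 2) \<sigma>1"
    have \<sigma>: "0 < \<sigma>" "\<sigma> \<le> 1" "2 * \<sigma> \<le> \<sigma>0" "\<sigma> \<le> \<sigma>1" using \<sigma>0 \<sigma>1 by (auto simp: \<sigma>_def)
    have small_gap: "real k powr (real j0 * \<sigma>) - 1 \<le> \<tau>"
    proof -
      have "real j0 * \<sigma> * ln (real k) \<le> (real j0 * ln (real k) + 1) * \<sigma>"
        using \<sigma> by (simp add: algebra_simps)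
      also have "\<dots> \<le> (real j0 * ln (real k) + 1) * \<sigma>1" using \<sigma> den by (intro mult_left_mono) auto
      also have "\<dots> = ln (1 + \<tau>)" using den by (simp add: \<sigma>1_def)
      finally have "exp (real j0 * \<sigma> * ln (real k)) \<le> exp (ln (1 + \<tau>))" by simp
      then show ?thesis using k1 \<tau> by (simp add: powr_def)
    qed
    \<comment> \<open>\<open>C\<close> makes the claim trivial for sets with one element; the other
      term absorbs the Brunn-Minkowski errors of all classes of a level.\<close>
    define D where "D = max C (2 * (real k ^ j0 + 1) * c)"
    have D: "D \<ge> C" "D \<ge> 2 * (real k ^ j0 + 1) * c" "D \<ge> 1" "D > 0" using C1 by (auto simp: D_def)
    have main: "C * real (card A) - D * real (card A) powr (1 - \<sigma>) \<le> real (card (A + (*v) L ` A))"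
      if irr: "irreducible_mat L" and detk: "\<bar>det L\<bar> = int k" and "finite A" for L :: "int^'n^'n" and A
      using \<open>finite A\<close>
    proof (induction "card A" arbitrary: A rule: less_induct)
      case less
      show ?case
      proof (rule ccontr)
        assume fail: "\<not> ?thesis"
        have A2: "card A \<ge> 2"
        proof (rule ccontr)
          assume "\<not> ?thesis"
          then consider "card A = 0" | "card A = 1" by linarith
          then show False using fail D(1) by cases simp_all
        qed
        interpret minimal_counterexample L k A \<kappa> C D \<sigma>
          using irr detk k1 less A2 D \<sigma> fail \<kappa>_def C_def by unfold_locales auto
        have small: "real (card (A + (*v) L ` A)) \<le> C * N"
          using fail D by (smt (verit) mult_nonneg_nonneg powr_ge_zero)
        have det0: "det L \<noteq> 0" using detk k1 by auto
        define err where "err = c * N powr (1 - \<sigma>0)"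
        have bmA: "(real (card X) powr (1 / real CARD('n)) + real (card Y) powr (1 / real CARD('n))) ^ CARD('n)
           \<le> real (card (X + (*v) L ` Y)) + err" if "X \<subseteq> A" "Y \<subseteq> A" "X \<noteq> {}" "Y \<noteq> {}" for X Y
          using bm[rule_format, of L A X Y] irr det0 finA A2 small that by (simp add: err_def)
        \<comment> \<open>The least admissible depth at which \<open>1 / Q ^ Suc J\<close> drops to
          \<delta>, the starting value of the recursion. Beyond \<open>j0\<close>, minimality of
          \<open>J\<close> gives \<open>\<delta> * Q ^ J < 1\<close>, which keeps all levels up to
          \<open>J\<close> populated and their number of classes below a multiple of
          \<open>N powr \<sigma>\<close>.\<close>
        define J where "J = (LEAST J. J \<ge> j0 \<and> 1 \<le> \<delta> * Q ^ Suc J)"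
        have "\<exists>J\<ge>j0. 1 \<le> \<delta> * Q ^ Suc J"
        proof -
          obtain m where m: "1 / \<delta> < Q ^ m" using real_arch_pow[OF Q1] by blast
          have "Q ^ m \<le> Q ^ Suc (max j0 m)" using Q1 by (intro power_increasing) auto
          then have "1 / \<delta> \<le> Q ^ Suc (max j0 m)" using m by linarith
          then have "1 \<le> \<delta> * Q ^ Suc (max j0 m)" using \<delta>_pos by (simp add: pos_divide_le_eq mult.commute del: power_Suc)
          then show ?thesis by (intro exI[of _ "max j0 m"]) simp
        qed
        then have J: "J \<ge> j0" "1 \<le> \<delta> * Q ^ Suc J" unfolding J_def by (metis (mono_tags, lifting) LeastI)+
        have Jmin: "J = j0 \<or> \<delta> * Q ^ J < 1"
        proof (cases "J = j0")
          case False
          then obtain J' where J': "J = Suc J'" "J' \<ge> j0" using J(1) by (cases J) auto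
          then have "\<not> (J' \<ge> j0 \<and> 1 \<le> \<delta> * Q ^ Suc J')" unfolding J_def by (intro not_less_Least) (simp add: J_def[symmetric])
          then show ?thesis using J' by simp
        qed simp
        have cond: "(real k powr (real j * \<sigma>) - 1) * \<delta> * (2 * C) ^ j \<le> 1" if j: "j \<in> {1..J}" for j
        \<comment> \<open>For \<open>J = j0\<close> the deficit need not be small: only
          \<open>\<delta> < C\<close> is available, and the smallness comes from \<sigma>.\<close>
        proof (cases "J = j0")
          case True
          have kp: "1 \<le> real k powr (real j * \<sigma>)" using k1 \<sigma> by (intro ge_one_powr_ge_zero) auto
          have "real k powr (real j * \<sigma>) \<le> real k powr (real j0 * \<sigma>)"
            using k1 \<sigma> j True by (intro powr_mono mult_right_mono) auto
          then have "real k powr (real j * \<sigma>) - 1 \<le> \<tau>" using small_gap by linarith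
          moreover have "(2 * C) ^ j \<le> (2 * C) ^ j0" using j True C1 by (intro power_increasing) auto
          ultimately have "(real k powr (real j * \<sigma>) - 1) * \<delta> * (2 * C) ^ j \<le> \<tau> * C * (2 * C) ^ j0"
            using \<delta>_less_C \<delta>_pos kp \<tau> C1 by (intro mult_mono) auto
          also have "\<dots> = 1" using C1 by (simp add: \<tau>_def)
          finally show ?thesis .
        next
          case False
          then have dQ: "\<delta> * Q ^ J < 1" using Jmin by blast
          have "real k powr (real j * \<sigma>) \<le> real k powr real j"
            using k1 \<sigma> by (intro powr_mono) (auto simp: mult_left_le)
          then have "real k powr (real j * \<sigma>) - 1 \<le> real k ^ j" using k1 by (simp add: powr_realpow)
          then have "(real k powr (real j * \<sigma>) - 1) * (\<delta> * (2 * C) ^ j) \<le> real k ^ j * (\<delta> * (2 * C) ^ j)"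
            using \<delta>_pos C1 by (intro mult_right_mono) auto
          also have "\<dots> = \<delta> * Q ^ j" by (simp add: Q_def power_mult_distrib ac_simps)
          also have "\<dots> \<le> \<delta> * Q ^ J" using j Q1 \<delta>_pos by (intro mult_left_mono power_increasing) auto
          finally show ?thesis using dQ by (simp add: mult.assoc)
        qed
        have full: "card (F (Suc j)) = k * card (F j)" if "j \<in> {1..J}" for j
          using levels_full[OF cond that] .
        have err: "real (card (F j)) * err \<le> \<delta> / 2 * N" if j: "j \<le> J" for j
        proof -
          have N1: "N \<ge> 1" using A2 by simp
          have kJ: "real k ^ J \<le> (real k ^ j0 + 1) * N powr \<sigma>"
          proof (cases "J = j0")
            case True
            have "real k ^ j0 * 1 \<le> (real k ^ j0 + 1) * N powr \<sigma>"
              using N1 \<sigma> k1 by (intro mult_mono ge_one_powr_ge_zero) auto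
            then show ?thesis using True by simp
          next
            case False
            have "real k ^ J \<le> Q ^ J" unfolding Q_def using C1 k1 by (intro power_mono) (auto simp: mult_left_le)
            also have "\<dots> \<le> 1 / \<delta>" using Jmin False \<delta>_pos by (simp add: field_simps)
            also have "\<dots> = N powr \<sigma> / D" using N_pos by (simp add: \<delta>_def powr_minus field_simps)
            also have "\<dots> \<le> N powr \<sigma> / 1" using D by (intro divide_left_mono) auto
            also have "\<dots> \<le> (real k ^ j0 + 1) * N powr \<sigma>" using k1 by (simp add: algebra_simps)
            finally show ?thesis .
          qed
          have "card (F j) \<le> k ^ J"
            using card_F_le[of j] power_increasing[OF j k1] by linarith
          then have "real (card (F j)) \<le> real (k ^ J)" by (simp only: of_nat_le_iff)
          then have "real (card (F j)) \<le> (real k ^ j0 + 1) * N powr \<sigma>" using kJ unfolding of_nat_power by linarith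
          then have "real (card (F j)) * err \<le> ((real k ^ j0 + 1) * N powr \<sigma>) * err"
            using c by (intro mult_right_mono) (auto simp: err_def)
          also have "\<dots> = (real k ^ j0 + 1) * c * (N powr \<sigma> * N powr (1 - \<sigma>0))" by (simp add: err_def ac_simps)
          also have "N powr \<sigma> * N powr (1 - \<sigma>0) = N powr (\<sigma> + (1 - \<sigma>0))" by (simp only: powr_add)
          also have "(real k ^ j0 + 1) * c * N powr (\<sigma> + (1 - \<sigma>0)) \<le> D / 2 * N powr (1 - \<sigma>)"
            using D(2,4) N1 \<sigma> by (intro mult_mono powr_mono) (auto simp: algebra_simps)
          also have "\<dots> = \<delta> / 2 * N" using \<delta>_N by simp
          finally show ?thesis .
        qed
        have R: "\<rho> * \<alpha> (j - 1) \<le> \<alpha> j \<and>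
            min (1 / (2 * real k ^ j)) (sqrt (1 / (real CARD('n) * C) * (\<alpha> (j - 1) + 1 / Q ^ Suc J)) / real k ^ j) \<le> \<alpha> j"
          if j: "j \<in> {2..J}" for j
        proof -
          obtain i where i: "j = Suc i" "i \<in> {1..J}" using j by (cases j) auto
          have e: "real (card (F (Suc i))) * err \<le> \<delta> / 2 * N" using err[of j] j i by simp
          have "1 / Q ^ Suc J \<le> \<delta>" using J(2) Q1 by (simp add: divide_le_eq del: power_Suc)
          then have "sqrt (1 / (real CARD('n) * C) * (\<alpha> i + 1 / Q ^ Suc J)) / real k ^ Suc i
            \<le> sqrt (1 / (real CARD('n) * C) * (\<alpha> i + \<delta>)) / real k ^ Suc i"
            using cc by (intro divide_right_mono real_sqrt_le_mono mult_left_mono add_left_mono) auto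
          then have "min (1 / (2 * real k ^ Suc i)) (sqrt (1 / (real CARD('n) * C) * (\<alpha> i + 1 / Q ^ Suc J)) / real k ^ Suc i)
            \<le> min (1 / (2 * real k ^ Suc i)) (sqrt (1 / (real CARD('n) * C) * (\<alpha> i + \<delta>)) / real k ^ Suc i)"
            by (intro min.mono) auto
          also have "\<dots> \<le> \<alpha> (Suc i)" by (rule density_recursion(2)[OF bmA e full[OF i(2)]])
          finally show ?thesis
            using density_recursion(1)[OF bmA e full[OF i(2)]] i(1) by (simp add: \<rho>_def)
        qed
        \<comment> \<open>The recursion, run with threshold \<open>C\<close>, contradicts the bound
          \<open>\<alpha> J \<le> C\<close> that follows from counting sums over one largest
          class.\<close>
        have "C < \<alpha> J" using rec[rule_format, OF J(1), of \<alpha>] \<alpha>_nonneg R by blast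
        moreover have "\<alpha> J \<le> C" using J(1) j0 by (intro \<alpha>_less_C full) auto
        ultimately show False by simp
      qed
    qed
    show ?thesis
      using D(4) \<sigma>(1) main by (intro exI[of _ D] exI[of _ \<sigma>]) (auto simp: sum_dilate_eq C_def \<kappa>_def)
  qed
qed

end
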